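(* There is an algorithm which, given a trapezoid model $\tau$ consisting of $n$ trapezoids, outputs a maximum induced matching of the trapezoid graph $G(\tau)$ in $\mathcal{O}(m+n)$ time, where $m$ is the number of edges of $G(\tau)$.
   Context: A trapezoid model is a set $\tau$ of $n$ trapezoids between two parallel horizontal lines (the $x$-axis and the $y$-axis); each trapezoid $A$ is given by four values $A.x_1\le A.x_2$ and $A.y_1\le A.y_2$, where $[A.x_1,A.x_2]$ is an interval on the $x$-axis and $[A.y_1,A.y_2]$ an interval on the $y$-axis; the trapezoid is the convex hull of these two intervals. It is assumed that all $x$-coordinates of all trapezoids are mutually distinct, all $y$-coordinates are mutually distinct, and all are integers in $[1,2n]$. The trapezoid graph $G(\tau)$ has one vertex per trapezoid, and $AB$ is an edge iff the trapezoids $A$ and $B$ intersect (equivalently, a diagonal of $A$ — the segment from $x_1$ to $y_2$ or from $x_2$ to $y_1$ — intersects a diagonal of $B$). An induced matching of $G=(V,E)$ is a set $M\subseteq E$ such that for any two distinct edges $u_1v_1,u_2v_2\in M$, none of $u_1u_2,u_1v_2,v_1u_2,v_1v_2$ is in $E$; a maximum induced matching is one of maximum cardinality. Running times are in the standard RAM model. *)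

theory Defs
  imports "HOL-Analysis.Analysis"
begin

text \<open>A trapezoid is given by an interval [x1,x2] on the lower line (height 0)
  and an interval [y1,y2] on the upper line (height 1).\<close>

record trapezoid =
  tx1 :: nat
  tx2 :: nat
  ty1 :: nat
  ty2 :: nat

definition trap_set :: "trapezoid \<Rightarrow> (real \<times> real) set" where
  "trap_set A = convex hull
     ({(u, 0) | u. real (tx1 A) \<le> u \<and> u \<le> real (tx2 A)} \<union>
      {(u, 1) | u. real (ty1 A) \<le> u \<and> u \<le> real (ty2 A)})"

definition valid_model :: "trapezoid list \<Rightarrow> bool" where
  "valid_model tau \<longleftrightarrow>
     (\<forall>A\<in>set tau. tx1 A \<le> tx2 A \<and> ty1 A \<le> ty2 A) \<and>
     distinct (concat (map (\<lambda>A. [tx1 A, tx2 A]) tau)) \<and>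
     distinct (concat (map (\<lambda>A. [ty1 A, ty2 A]) tau)) \<and>
     set (concat (map (\<lambda>A. [tx1 A, tx2 A, ty1 A, ty2 A]) tau)) \<subseteq> {1..2 * length tau}"

definition tg_edges :: "trapezoid list \<Rightarrow> nat set set" where
  "tg_edges tau = {{i, j} | i j. i < length tau \<and> j < length tau \<and> i \<noteq> j \<and>
                       trap_set (tau ! i) \<inter> trap_set (tau ! j) \<noteq> {}}"

definition induced_matching :: "'a set set \<Rightarrow> 'a set set \<Rightarrow> bool" where
  "induced_matching E M \<longleftrightarrow> M \<subseteq> E \<and>
     (\<forall>e\<in>M. \<forall>f\<in>M. e \<noteq> f \<longrightarrow> (\<forall>u\<in>e. \<forall>v\<in>f. {u, v} \<notin> E))"

definition max_induced_matching :: "'a set set \<Rightarrow> 'a set set \<Rightarrow> bool" where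
  "max_induced_matching E M \<longleftrightarrow> induced_matching E M \<and>
     (\<forall>M'. induced_matching E M' \<longrightarrow> card M' \<le> card M)"

datatype instr =
    Const int int
  | Add int int int
  | Sub int int int
  | Load int int
  | Store int int
  | Jle int nat
  | Halt

type_synonym ram_state = "nat \<times> (int \<Rightarrow> int)"

definition fetch :: "instr list \<Rightarrow> nat \<Rightarrow> instr" where
  "fetch P pc = (if pc < length P then P ! pc else Halt)"

fun exec_instr :: "instr \<Rightarrow> ram_state \<Rightarrow> ram_state" where
  "exec_instr (Const a c) (pc, m) = (Suc pc, m(a := c))"
| "exec_instr (Add a b c) (pc, m) = (Suc pc, m(a := m b + m c))"
| "exec_instr (Sub a b c) (pc, m) = (Suc pc, m(a := m b - m c))"
| "exec_instr (Load a b) (pc, m) = (Suc pc, m(a := m (m b)))"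
| "exec_instr (Store a b) (pc, m) = (Suc pc, m(m a := m b))"
| "exec_instr (Jle a l) (pc, m) = (if m a \<le> 0 then (l, m) else (Suc pc, m))"
| "exec_instr Halt s = s"

definition ram_step :: "instr list \<Rightarrow> ram_state \<Rightarrow> ram_state" where
  "ram_step P s = exec_instr (fetch P (fst s)) s"

definition halted :: "instr list \<Rightarrow> ram_state \<Rightarrow> bool" where
  "halted P s \<longleftrightarrow> fetch P (fst s) = Halt"

definition init_state :: "trapezoid list \<Rightarrow> ram_state" where
  "init_state tau = (0, \<lambda>a.
     if a = 1 then int (length tau)
     else if 2 \<le> a \<and> a < 2 + 4 * int (length tau) then
       (let i = nat (a - 2) div 4; k = nat (a - 2) mod 4; A = tau ! i in
        int ([tx1 A, tx2 A, ty1 A, ty2 A] ! k))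
     else 0)"

definition output_edges :: "ram_state \<Rightarrow> int set set" where
  "output_edges s = (let m = snd s; p = m (-1); k = m (-2) in
     {{m (p + 2 * j), m (p + 2 * j + 1)} | j. 0 \<le> j \<and> j < k})"

end

(* Two edges of an induced matching are separated, so the hulls of the two pairs of trapezoids are
   comparable in the left-to-right order.  Hence a maximum induced matching is a longest chain of
   edges, where e is left of f if X2 e < X1 f and Y2 e < Y1 f for the bounding coordinates.

   The edges are enumerated by insertion sort: u and v intersect iff a diagonal of u crosses a
   diagonal of v, that is, iff they give an inversion, and every pair gives at most four inversions.

   The longest chain is found by a sweep over x, as in patience sorting: for every level j
   we keep the least Y2 of an edge that ends a chain of length j and lies left of the sweep line.
   An edge e = uv that starts at x receives the level 1 + #{j. level coordinate of j < Y1 e}.  To find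
   this number in constant time, every vertex v stores the number d v of level coordinates above y1 v.
   If w becomes the upper right corner of a level, then all vertices whose counter changes and will
   still be read are neighbours of w, so the update costs O(deg w); and each w enters a level
   at most once, since the level of such an edge is determined by the longest chain left of w. *)

theory Submission
  imports Defs
begin

section \<open>A while language compiled to the RAM\<close>

text \<open>Linear time forbids comparing pairs of edges, so every edge is treated twice only: where
  its bounding box begins (\<open>X1 e\<close>) it gets its level, where the box ends
  (\<open>X2 e\<close>) it is offered to the table of levels. The table thus holds only edges wholly
  behind the sweep line, which settles the horizontal half of \<open>eleft\<close>. The vertical
  half is a count needed once per edge but kept once per vertex, because the count for
  \<open>Y1 e\<close> is the smaller of the counts for the two end vertices. Keeping it is
  affordable by amortization: a level coordinate is the \<open>y2\<close> of a vertex, and both its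
  arrival and its later replacement are charged to the degree of that vertex. Degrees refer to
  closed neighbourhoods, as \<open>meets\<close> is reflexive on vertices; they sum to 2m + n.
  Repeated inversions are filtered through an adjacency matrix with quadratically many addresses of
  which only O(m + n) are touched; zero memory replaces its initialization. The machine has no
  multiplication, so addresses come from doublings and row offsets from repeated addition. The
  numeric time constants are generous roundings of instruction counts.\<close>

text \<open>Address of cell \<open>v\<close> of column \<open>a\<close>: for \<open>v \<ge> 0\<close> it is negative, hence disjoint from the input, and it
  also avoids the two result cells \<open>-1\<close> and \<open>-2\<close>.\<close>

definition loc :: "nat \<Rightarrow> int \<Rightarrow> int" where
  "loc a v = - 64 - 32 * v - int a"

lemma loc_eq_iff [simp]:
  assumes "a < 32" "b < 32"
  shows "loc a v = loc b w \<longleftrightarrow> a = b \<and> v = w"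
proof
  assume "loc a v = loc b w"
  then have *: "32 * v + int a = 32 * w + int b" by (simp add: loc_def)
  with assms have "v = w" by linarith
  with * show "a = b \<and> v = w" by simp
qed simp

definition ar :: "(int \<Rightarrow> int) \<Rightarrow> nat \<Rightarrow> int \<Rightarrow> int" where
  "ar m a i = m (loc a i)"

lemma ar_upd [simp]:
  assumes "a < 32" "b < 32"
  shows "ar (m(loc a i := x)) b = (if a = b then (ar m b)(i := x) else ar m b)"
  using assms by (auto simp: ar_def fun_eq_iff)

datatype aexp = N int | V int | Ix nat aexp | Plus aexp aexp | Minus aexp aexp

datatype com =
    Skip
  | Asg int aexp
  | Put nat aexp aexp
  | GetRaw int aexp
  | PutRaw aexp aexp
  | Seq com com  (infixr ";;" 60)
  | Cond aexp com com
  | While aexp com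

fun aval :: "aexp \<Rightarrow> (int \<Rightarrow> int) \<Rightarrow> int" where
  "aval (N c) m = c"
| "aval (V x) m = ar m 31 x"
| "aval (Ix a e) m = ar m a (aval e m)"
| "aval (Plus e f) m = aval e m + aval f m"
| "aval (Minus e f) m = aval e m - aval f m"

abbreviation tmp :: "nat \<Rightarrow> int" where
  "tmp r \<equiv> loc 0 (int r)"

text \<open>Five doublings multiply by 32, the stride of \<open>loc\<close>; the subtraction then
  yields the address.\<close>

definition addr_code :: "nat \<Rightarrow> nat \<Rightarrow> instr list" where
  "addr_code a r = replicate 5 (Add (tmp r) (tmp r) (tmp r)) @
     [Const (tmp (Suc r)) (- 64 - int a), Sub (tmp r) (tmp (Suc r)) (tmp r)]"

text \<open>Stack discipline: the value ends up in temporary \<open>r\<close>, and only temporaries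
  from \<open>r\<close> on are overwritten. There is no move instruction, so a variable is read by
  adding it to 0.\<close>

fun exp_code :: "aexp \<Rightarrow> nat \<Rightarrow> instr list" where
  "exp_code (N c) r = [Const (tmp r) c]"
| "exp_code (V x) r = [Const (tmp r) 0, Add (tmp r) (tmp r) (loc 31 x)]"
| "exp_code (Ix a e) r = exp_code e r @ addr_code a r @ [Load (tmp r) (tmp r)]"
| "exp_code (Plus e f) r = exp_code e r @ exp_code f (Suc r) @ [Add (tmp r) (tmp r) (tmp (Suc r))]"
| "exp_code (Minus e f) r = exp_code e r @ exp_code f (Suc r) @ [Sub (tmp r) (tmp r) (tmp (Suc r))]"

fun ecost :: "aexp \<Rightarrow> nat" where
  "ecost (N c) = 1"
| "ecost (V x) = 2"
| "ecost (Ix a e) = ecost e + 8"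
| "ecost (Plus e f) = ecost e + ecost f + 1"
| "ecost (Minus e f) = ecost e + ecost f + 1"

fun csize :: "com \<Rightarrow> nat" where
  "csize Skip = 0"
| "csize (Asg x e) = ecost e + 2"
| "csize (Put a e f) = ecost e + ecost f + 8"
| "csize (GetRaw x e) = ecost e + 1"
| "csize (PutRaw e f) = ecost e + ecost f + 1"
| "csize (c ;; d) = csize c + csize d"
| "csize (Cond e c d) = ecost e + csize c + csize d + 3"
| "csize (While e c) = ecost e + csize c + 3"

text \<open>Jump targets are absolute, hence the parameter \<open>i\<close>, the address of the
  first instruction. An unconditional jump is a \<open>Jle\<close> on a temporary that has just been
  set to 0.\<close>

fun code :: "com \<Rightarrow> nat \<Rightarrow> instr list" where
  "code Skip i = []"
| "code (Asg x e) i = exp_code e 0 @ [Const (tmp 1) 0, Add (loc 31 x) (tmp 0) (tmp 1)]"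
| "code (Put a e f) i = exp_code e 0 @ addr_code a 0 @ exp_code f 1 @ [Store (tmp 0) (tmp 1)]"
| "code (GetRaw x e) i = exp_code e 0 @ [Load (loc 31 x) (tmp 0)]"
| "code (PutRaw e f) i = exp_code e 0 @ exp_code f 1 @ [Store (tmp 0) (tmp 1)]"
| "code (c ;; d) i = code c i @ code d (i + csize c)"
| "code (Cond e c d) i = exp_code e 0 @ [Jle (tmp 0) (i + ecost e + csize c + 3)]
     @ code c (i + ecost e + 1)
     @ [Const (tmp 0) 0, Jle (tmp 0) (i + csize (Cond e c d))]
     @ code d (i + ecost e + csize c + 3)"
| "code (While e c) i = exp_code e 0 @ [Jle (tmp 0) (i + csize (While e c))]
     @ code c (i + ecost e + 1) @ [Const (tmp 0) 0, Jle (tmp 0) i]"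

text \<open>The number is the exact instruction count of the compiled code: a true branch and a loop
  round cost 3 beyond guard and body (the test and a jump of two instructions), a false guard costs
  1. \<open>GetRaw\<close> demands a nonnegative address so that it cannot read a temporary, whose
  content is not modelled here.\<close>

inductive run :: "com \<Rightarrow> (int \<Rightarrow> int) \<Rightarrow> nat \<Rightarrow> (int \<Rightarrow> int) \<Rightarrow> bool" where
  Skip: "run Skip m 0 m"
| Asg: "run (Asg x e) m (ecost e + 2) (m(loc 31 x := aval e m))"
| Put: "run (Put a e f) m (ecost e + ecost f + 8) (m(loc a (aval e m) := aval f m))"
| GetRaw: "0 \<le> aval e m \<Longrightarrow> run (GetRaw x e) m (ecost e + 1) (m(loc 31 x := m (aval e m)))"
| PutRaw: "run (PutRaw e f) m (ecost e + ecost f + 1) (m(aval e m := aval f m))"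
| Seq: "run c m t m' \<Longrightarrow> run d m' t' m'' \<Longrightarrow> run (c ;; d) m (t + t') m''"
| CondT: "aval e m > 0 \<Longrightarrow> run c m t m' \<Longrightarrow> run (Cond e c d) m (ecost e + t + 3) m'"
| CondF: "aval e m \<le> 0 \<Longrightarrow> run d m t m' \<Longrightarrow> run (Cond e c d) m (ecost e + t + 1) m'"
| WhileF: "aval e m \<le> 0 \<Longrightarrow> run (While e c) m (ecost e + 1) m"
| WhileT: "aval e m > 0 \<Longrightarrow> run c m t m' \<Longrightarrow> run (While e c) m' t' m'' \<Longrightarrow>
     run (While e c) m (ecost e + t + 3 + t') m''"

text \<open>Column 0 holds the temporaries, so programs must not read it; column 31 holds the variables.\<close>

fun ewf :: "aexp \<Rightarrow> bool" where
  "ewf (N c) \<longleftrightarrow> True"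
| "ewf (V x) \<longleftrightarrow> True"
| "ewf (Ix a e) \<longleftrightarrow> 0 < a \<and> a < 32 \<and> ewf e"
| "ewf (Plus e f) \<longleftrightarrow> ewf e \<and> ewf f"
| "ewf (Minus e f) \<longleftrightarrow> ewf e \<and> ewf f"

fun cwf :: "com \<Rightarrow> bool" where
  "cwf Skip \<longleftrightarrow> True"
| "cwf (Asg x e) \<longleftrightarrow> ewf e"
| "cwf (Put a e f) \<longleftrightarrow> ewf e \<and> ewf f \<and> 0 < a \<and> a < 32"
| "cwf (GetRaw x e) \<longleftrightarrow> ewf e"
| "cwf (PutRaw e f) \<longleftrightarrow> ewf e \<and> ewf f"
| "cwf (c ;; d) \<longleftrightarrow> cwf c \<and> cwf d"
| "cwf (Cond e c d) \<longleftrightarrow> ewf e \<and> cwf c \<and> cwf d"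
| "cwf (While e c) \<longleftrightarrow> ewf e \<and> cwf c"

lemma length_addr_code [simp]: "length (addr_code a r) = 7"
  by (simp add: addr_code_def)

lemma length_exp_code [simp]: "length (exp_code e r) = ecost e"
  by (induction e arbitrary: r) auto

lemma length_code [simp]: "length (code c i) = csize c"
  by (induction c arbitrary: i) auto

definition code_at :: "instr list \<Rightarrow> nat \<Rightarrow> instr list \<Rightarrow> bool" where
  "code_at P i is \<longleftrightarrow> (\<exists>A B. P = A @ is @ B \<and> length A = i)"

lemma code_at_append: "code_at P i (xs @ ys) \<longleftrightarrow> code_at P i xs \<and> code_at P (i + length xs) ys"
proof
  assume "code_at P i (xs @ ys)"
  then obtain A B where "P = A @ (xs @ ys) @ B" "length A = i"
    unfolding code_at_def by blast
  then show "code_at P i xs \<and> code_at P (i + length xs) ys"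
    unfolding code_at_def by (metis append_assoc length_append)
next
  assume *: "code_at P i xs \<and> code_at P (i + length xs) ys"
  then obtain A B C D where AB: "P = A @ xs @ B" "length A = i"
    and CD: "P = C @ ys @ D" "length C = i + length xs"
    unfolding code_at_def by blast
  have "(A @ xs) @ B = C @ (ys @ D)" "length (A @ xs) = length C"
    using AB CD by auto
  then have "A @ xs = C" "B = ys @ D" by (metis append_eq_append_conv)+
  then show "code_at P i (xs @ ys)"
    unfolding code_at_def using AB by auto
qed

lemma code_at_Cons: "code_at P i (x # xs) \<longleftrightarrow> code_at P i [x] \<and> code_at P (Suc i) xs"
  using code_at_append[of P i "[x]" xs] by simp

lemma fetch_code_at: "code_at P i [x] \<Longrightarrow> fetch P i = x"
  by (auto simp: code_at_def fetch_def nth_append)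

abbreviation steps :: "instr list \<Rightarrow> nat \<Rightarrow> ram_state \<Rightarrow> ram_state" where
  "steps P t \<equiv> ram_step P ^^ t"

lemma steps_add: "steps P t s = s' \<Longrightarrow> steps P t' s' = s'' \<Longrightarrow> steps P (t + t') s = s''"
  by (simp add: add.commute[of t t'] funpow_add)

lemma step_instr: "code_at P i [x] \<Longrightarrow> steps P 1 (i, m) = exec_instr x (i, m)"
  by (simp add: ram_step_def fetch_code_at)

lemma steps_instr: "steps P t s = (i, m) \<Longrightarrow> code_at P i [x] \<Longrightarrow> steps P (Suc t) s = exec_instr x (i, m)"
  using steps_add[where t' = 1] step_instr by fastforce

text \<open>Temporaries exist only on the machine, so the simulation relates the two memories
  everywhere else.\<close>

definition agree :: "(int \<Rightarrow> int) \<Rightarrow> (int \<Rightarrow> int) \<Rightarrow> bool" where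
  "agree m mm \<longleftrightarrow> (\<forall>i. (\<forall>r. i \<noteq> tmp r) \<longrightarrow> mm i = m i)"

lemma agree_tmp [simp]: "agree m (mm(tmp r := x)) \<longleftrightarrow> agree m mm"
  by (auto simp: agree_def)

lemma agree_upd: "agree m mm \<Longrightarrow> agree (m(i := x)) (mm(i := x))"
  by (auto simp: agree_def)

lemma agree_loc: "agree m mm \<Longrightarrow> 0 < a \<Longrightarrow> a < 32 \<Longrightarrow> mm (loc a v) = ar m a v"
  by (auto simp: agree_def ar_def)

lemma addr_code_correct:
  assumes "code_at P i (addr_code a r)"
  shows "\<exists>mm'. steps P 7 (i, mm) = (i + 7, mm') \<and> mm' (tmp r) = loc a (mm (tmp r)) \<and>
    (\<forall>j. j \<noteq> tmp r \<longrightarrow> j \<noteq> tmp (Suc r) \<longrightarrow> mm' j = mm j)"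
proof -
  have *: "code_at P i [Add (tmp r) (tmp r) (tmp r)]" "code_at P (i+1) [Add (tmp r) (tmp r) (tmp r)]"
    "code_at P (i+2) [Add (tmp r) (tmp r) (tmp r)]" "code_at P (i+3) [Add (tmp r) (tmp r) (tmp r)]"
    "code_at P (i+4) [Add (tmp r) (tmp r) (tmp r)]" "code_at P (i+5) [Const (tmp (Suc r)) (- 64 - int a)]"
    "code_at P (i+6) [Sub (tmp r) (tmp (Suc r)) (tmp r)]"
    using assms by (simp_all add: addr_code_def numeral_eq_Suc code_at_Cons[of _ _ _ "_ # _"])
  show ?thesis
    using *[THEN fetch_code_at]
    by (simp add: numeral_eq_Suc ram_step_def loc_def)
qed

lemma agree_weaken:
  assumes "agree m mm" "\<And>j. j \<noteq> tmp r \<Longrightarrow> j \<noteq> tmp r' \<Longrightarrow> mm' j = mm j"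
  shows "agree m mm'"
  using assms by (auto simp: agree_def)

text \<open>The last clause, on temporaries below \<open>r\<close>, keeps the first operand alive
  while the induction evaluates the second.\<close>

lemma exp_code_correct:
  assumes "code_at P i (exp_code e r)" "agree m mm" "ewf e"
  shows "\<exists>mm'. steps P (ecost e) (i, mm) = (i + ecost e, mm') \<and> mm' (tmp r) = aval e m \<and>
    agree m mm' \<and> (\<forall>q<r. mm' (tmp q) = mm (tmp q))"
  using assms
proof (induction e arbitrary: i r mm)
  case (N c)
  then show ?case by (simp add: ram_step_def fetch_code_at)
next
  case (V x)
  then have "fetch P i = Const (tmp r) 0" "fetch P (Suc i) = Add (tmp r) (tmp r) (loc 31 x)"
    by (simp_all add: code_at_Cons[of _ _ _ "_ # _"] fetch_code_at)
  moreover have "mm (loc 31 x) = ar m 31 x" using V.prems agree_loc by simp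
  ultimately show ?case using V.prems by (simp add: numeral_eq_Suc ram_step_def)
next
  case (Ix a e)
  from Ix.prems have at: "code_at P i (exp_code e r)" "code_at P (i + ecost e) (addr_code a r)"
    "code_at P (i + ecost e + 7) [Load (tmp r) (tmp r)]"
    by (simp_all add: code_at_append)
  from Ix.IH[OF at(1)] Ix.prems obtain m1 where
    1: "steps P (ecost e) (i, mm) = (i + ecost e, m1)" "m1 (tmp r) = aval e m" "agree m m1"
      "\<And>q. q<r \<Longrightarrow> m1 (tmp q) = mm (tmp q)" by auto
  from addr_code_correct[OF at(2)] obtain m2 where
    2: "steps P 7 (i + ecost e, m1) = (i + ecost e + 7, m2)" "m2 (tmp r) = loc a (m1 (tmp r))"
      "\<And>j. j \<noteq> tmp r \<Longrightarrow> j \<noteq> tmp (Suc r) \<Longrightarrow> m2 j = m1 j" by blast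
  have "agree m m2" using agree_weaken[OF 1(3)] 2(3) by blast
  then have "m2 (m2 (tmp r)) = ar m a (aval e m)"
    using 2 1 Ix.prems by (simp add: agree_loc)
  then have "steps P (ecost e + 8) (i, mm) = (i + (ecost e + 8), m2(tmp r := ar m a (aval e m)))"
    using steps_instr[OF steps_add[OF 1(1) 2(1)] at(3)] by (simp add: ac_simps)
  with 1 2 \<open>agree m m2\<close> show ?case by simp
next
  case (Plus e f)
  from Plus.prems have at: "code_at P i (exp_code e r)" "code_at P (i + ecost e) (exp_code f (Suc r))"
    "code_at P (i + ecost e + ecost f) [Add (tmp r) (tmp r) (tmp (Suc r))]"
    by (simp_all add: code_at_append)
  from Plus.IH(1)[OF at(1)] Plus.prems obtain m1 where
    1: "steps P (ecost e) (i, mm) = (i + ecost e, m1)" "m1 (tmp r) = aval e m" "agree m m1"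
      "\<And>q. q<r \<Longrightarrow> m1 (tmp q) = mm (tmp q)" by auto
  from Plus.IH(2)[OF at(2) 1(3)] Plus.prems obtain m2 where
    2: "steps P (ecost f) (i + ecost e, m1) = (i + ecost e + ecost f, m2)" "m2 (tmp (Suc r)) = aval f m" "agree m m2"
      "\<And>q. q<Suc r \<Longrightarrow> m2 (tmp q) = m1 (tmp q)" by auto
  show ?case using steps_instr[OF steps_add[OF 1(1) 2(1)] at(3)] 1 2 by simp
next
  case (Minus e f)
  from Minus.prems have at: "code_at P i (exp_code e r)" "code_at P (i + ecost e) (exp_code f (Suc r))"
    "code_at P (i + ecost e + ecost f) [Sub (tmp r) (tmp r) (tmp (Suc r))]"
    by (simp_all add: code_at_append)
  from Minus.IH(1)[OF at(1)] Minus.prems obtain m1 where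
    1: "steps P (ecost e) (i, mm) = (i + ecost e, m1)" "m1 (tmp r) = aval e m" "agree m m1"
      "\<And>q. q<r \<Longrightarrow> m1 (tmp q) = mm (tmp q)" by auto
  from Minus.IH(2)[OF at(2) 1(3)] Minus.prems obtain m2 where
    2: "steps P (ecost f) (i + ecost e, m1) = (i + ecost e + ecost f, m2)" "m2 (tmp (Suc r)) = aval f m" "agree m m2"
      "\<And>q. q<Suc r \<Longrightarrow> m2 (tmp q) = m1 (tmp q)" by auto
  show ?case using steps_instr[OF steps_add[OF 1(1) 2(1)] at(3)] 1 2 by simp
qed

text \<open>The induction is on the run and not on the command: after one round of a loop the
  machine is back at address \<open>i\<close> with the same code in place, and the hypothesis for
  the remaining rounds applies.\<close>

lemma code_correct:
  assumes "run c m t m'" "code_at P i (code c i)" "agree m mm" "cwf c"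
  shows "\<exists>mm'. steps P t (i, mm) = (i + csize c, mm') \<and> agree m' mm'"
  using assms
proof (induction arbitrary: i mm rule: run.induct)
  case (Skip m)
  then show ?case by simp
next
  case (Asg x e m)
  from Asg.prems have at: "code_at P i (exp_code e 0)" "code_at P (i + ecost e) [Const (tmp 1) 0]"
    "code_at P (Suc (i + ecost e)) [Add (loc 31 x) (tmp 0) (tmp 1)]"
    by (simp_all add: code_at_append code_at_Cons[of _ _ _ "_ # _"])
  from exp_code_correct[OF at(1)] Asg.prems obtain m1 where
    1: "steps P (ecost e) (i, mm) = (i + ecost e, m1)" "m1 (tmp 0) = aval e m" "agree m m1" by auto
  have "agree m (m1(tmp 1 := 0))" using 1(3) agree_tmp[of m m1 1 0] by simp
  then have "agree (m(loc 31 x := aval e m)) ((m1(tmp 1 := 0))(loc 31 x := aval e m))"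
    by (rule agree_upd)
  moreover have "steps P (ecost e + 2) (i, mm) = (i + ecost e + 2, (m1(tmp 1 := 0))(loc 31 x := aval e m))"
    using at(2,3)[THEN fetch_code_at] 1 by (simp add: ram_step_def)
  ultimately show ?case by (metis csize.simps(2) add.assoc)
next
  case (Put a e f m)
  from Put.prems have at: "code_at P i (exp_code e 0)" "code_at P (i + ecost e) (addr_code a 0)"
    "code_at P (i + ecost e + 7) (exp_code f 1)"
    "code_at P (i + ecost e + 7 + ecost f) [Store (tmp 0) (tmp 1)]"
    by (simp_all add: code_at_append)
  from exp_code_correct[OF at(1)] Put.prems obtain m1 where
    1: "steps P (ecost e) (i, mm) = (i + ecost e, m1)" "m1 (tmp 0) = aval e m" "agree m m1" by auto
  from addr_code_correct[OF at(2)] obtain m2 where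
    2: "steps P 7 (i + ecost e, m1) = (i + ecost e + 7, m2)" "m2 (tmp 0) = loc a (m1 (tmp 0))"
      "\<And>j. j \<noteq> tmp 0 \<Longrightarrow> j \<noteq> tmp (Suc 0) \<Longrightarrow> m2 j = m1 j" by blast
  have "agree m m2" using agree_weaken[OF 1(3)] 2(3) by blast
  from exp_code_correct[OF at(3) this] Put.prems obtain m3 where
    3: "steps P (ecost f) (i + ecost e + 7, m2) = (i + ecost e + 7 + ecost f, m3)" "m3 (tmp 1) = aval f m" "agree m m3"
      "m3 (tmp 0) = m2 (tmp 0)" by auto
  have "steps P (ecost e + ecost f + 8) (i, mm) =
      (i + csize (Put a e f), m3(loc a (aval e m) := aval f m))"
    using steps_instr[OF steps_add[OF steps_add[OF 1(1) 2(1)] 3(1)] at(4)] 1 2 3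
    by (simp add: algebra_simps)
  with agree_upd[OF 3(3)] show ?case by blast
next
  case (GetRaw e m x)
  from GetRaw.prems have at: "code_at P i (exp_code e 0)" "code_at P (i + ecost e) [Load (loc 31 x) (tmp 0)]"
    by (simp_all add: code_at_append)
  from exp_code_correct[OF at(1)] GetRaw.prems obtain m1 where
    1: "steps P (ecost e) (i, mm) = (i + ecost e, m1)" "m1 (tmp 0) = aval e m" "agree m m1" by auto
  have "m1 (aval e m) = m (aval e m)"
    using 1(3) GetRaw.hyps by (auto simp: agree_def loc_def)
  with steps_instr[OF 1(1) at(2)] 1
  have "steps P (ecost e + 1) (i, mm) = (i + csize (GetRaw x e), m1(loc 31 x := m (aval e m)))" by simp
  with agree_upd[OF 1(3)] show ?case by blast
next
  case (PutRaw e f m)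
  from PutRaw.prems have at: "code_at P i (exp_code e 0)" "code_at P (i + ecost e) (exp_code f 1)"
    "code_at P (i + ecost e + ecost f) [Store (tmp 0) (tmp 1)]"
    by (simp_all add: code_at_append)
  from exp_code_correct[OF at(1)] PutRaw.prems obtain m1 where
    1: "steps P (ecost e) (i, mm) = (i + ecost e, m1)" "m1 (tmp 0) = aval e m" "agree m m1" by auto
  from exp_code_correct[OF at(2) 1(3)] PutRaw.prems obtain m3 where
    3: "steps P (ecost f) (i + ecost e, m1) = (i + ecost e + ecost f, m3)" "m3 (tmp 1) = aval f m" "agree m m3"
      "m3 (tmp 0) = m1 (tmp 0)" by auto
  have "steps P (ecost e + ecost f + 1) (i, mm) = (i + csize (PutRaw e f), m3(aval e m := aval f m))"
    using steps_instr[OF steps_add[OF 1(1) 3(1)] at(3)] 1 3 by simp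
  with agree_upd[OF 3(3)] show ?case by blast
next
  case (Seq c m t m' d t' m'')
  from Seq.prems have at: "code_at P i (code c i)" "code_at P (i + csize c) (code d (i + csize c))"
    by (simp_all add: code_at_append)
  from Seq.IH(1)[OF at(1)] Seq.prems obtain m1 where
    1: "steps P t (i, mm) = (i + csize c, m1)" "agree m' m1" by auto
  from Seq.IH(2)[OF at(2) 1(2)] Seq.prems obtain m2 where
    2: "steps P t' (i + csize c, m1) = (i + csize c + csize d, m2)" "agree m'' m2" by auto
  show ?case using steps_add[OF 1(1) 2(1)] 2(2) by (auto simp: add.assoc)
next
  case (CondT e m c t m' d)
  let ?j = "i + ecost e"
  from CondT.prems have at: "code_at P i (exp_code e 0)"
    "code_at P ?j [Jle (tmp 0) (?j + csize c + 3)]"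
    "code_at P (?j + 1) (code c (?j + 1))"
    "code_at P (?j + 1 + csize c) [Const (tmp 0) 0]"
    "code_at P (Suc (?j + 1 + csize c)) [Jle (tmp 0) (i + csize (Cond e c d))]"
    by (simp_all add: code_at_append code_at_Cons[of _ _ _ "_ # _"] code_at_Cons[of _ _ _ "_ @ _"] code_at_Cons[of _ _ _ "code _ _"] algebra_simps)
  from exp_code_correct[OF at(1)] CondT.prems obtain m1 where
    1: "steps P (ecost e) (i, mm) = (?j, m1)" "m1 (tmp 0) = aval e m" "agree m m1" by auto
  have 2: "steps P (Suc (ecost e)) (i, mm) = (?j + 1, m1)"
    using steps_instr[OF 1(1) at(2)] 1(2) CondT.hyps by simp
  from CondT.IH[OF at(3) 1(3)] CondT.prems obtain m2 where
    3: "steps P t (?j + 1, m1) = (?j + 1 + csize c, m2)" "agree m' m2" by auto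
  from steps_instr[OF steps_add[OF 2 3(1)] at(4)]
  have 4: "steps P (Suc (Suc (ecost e) + t)) (i, mm) = (Suc (?j + 1 + csize c), m2(tmp 0 := 0))" by simp
  have 5: "steps P (ecost e + t + 3) (i, mm) = (i + csize (Cond e c d), m2(tmp 0 := 0))"
    using steps_instr[OF 4 at(5)] by (simp add: numeral_eq_Suc)
  have "agree m' (m2(tmp 0 := 0))" using 3(2) agree_tmp by blast
  then show ?case using 5 by blast
next
  case (CondF e m d t m' c)
  let ?j = "i + ecost e"
  from CondF.prems have at: "code_at P i (exp_code e 0)"
    "code_at P ?j [Jle (tmp 0) (?j + csize c + 3)]"
    "code_at P (?j + csize c + 3) (code d (?j + csize c + 3))"
    by (simp_all add: code_at_append code_at_Cons[of _ _ _ "_ # _"] code_at_Cons[of _ _ _ "code _ _"] code_at_Cons[of _ _ _ "_ @ _"] eval_nat_numeral algebra_simps)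
  from exp_code_correct[OF at(1)] CondF.prems obtain m1 where
    1: "steps P (ecost e) (i, mm) = (?j, m1)" "m1 (tmp 0) = aval e m" "agree m m1" by auto
  have 2: "steps P (Suc (ecost e)) (i, mm) = (?j + csize c + 3, m1)"
    using steps_instr[OF 1(1) at(2)] 1(2) CondF.hyps by simp
  from CondF.IH[OF at(3) 1(3)] CondF.prems obtain m2 where
    3: "steps P t (?j + csize c + 3, m1) = (?j + csize c + 3 + csize d, m2)" "agree m' m2" by auto
  show ?case using steps_add[OF 2 3(1)] 3(2) by (auto simp: algebra_simps)
next
  case (WhileF e m c)
  let ?j = "i + ecost e"
  from WhileF.prems have at: "code_at P i (exp_code e 0)"
    "code_at P ?j [Jle (tmp 0) (i + csize (While e c))]"
    by (simp_all add: code_at_append code_at_Cons[of _ _ _ "_ # _"] code_at_Cons[of _ _ _ "_ @ _"])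
  from exp_code_correct[OF at(1)] WhileF.prems obtain m1 where
    1: "steps P (ecost e) (i, mm) = (?j, m1)" "m1 (tmp 0) = aval e m" "agree m m1" by auto
  show ?case
    using steps_instr[OF 1(1) at(2)] 1 WhileF.hyps by simp
next
  case (WhileT e m c t m' t' m'')
  let ?j = "i + ecost e"
  from WhileT.prems have at: "code_at P i (exp_code e 0)"
    "code_at P ?j [Jle (tmp 0) (i + csize (While e c))]"
    "code_at P (?j + 1) (code c (?j + 1))"
    "code_at P (?j + 1 + csize c) [Const (tmp 0) 0]"
    "code_at P (Suc (?j + 1 + csize c)) [Jle (tmp 0) i]"
    by (simp_all add: code_at_append code_at_Cons[of _ _ _ "_ # _"] code_at_Cons[of _ _ _ "_ @ _"])
  from exp_code_correct[OF at(1)] WhileT.prems obtain m1 where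
    1: "steps P (ecost e) (i, mm) = (?j, m1)" "m1 (tmp 0) = aval e m" "agree m m1" by auto
  have 2: "steps P (Suc (ecost e)) (i, mm) = (?j + 1, m1)"
    using steps_instr[OF 1(1) at(2)] 1(2) WhileT.hyps by simp
  from WhileT.IH(1)[OF at(3) 1(3)] WhileT.prems obtain m2 where
    3: "steps P t (?j + 1, m1) = (?j + 1 + csize c, m2)" "agree m' m2" by auto
  from steps_instr[OF steps_add[OF 2 3(1)] at(4)]
  have 4: "steps P (Suc (Suc (ecost e) + t)) (i, mm) = (Suc (?j + 1 + csize c), m2(tmp 0 := 0))" by simp
  have 5: "steps P (ecost e + t + 3) (i, mm) = (i, m2(tmp 0 := 0))"
    using steps_instr[OF 4 at(5)] by (simp add: numeral_eq_Suc)
  have "agree m' (m2(tmp 0 := 0))" using 3(2) agree_tmp by blast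
  from WhileT.IH(2)[OF WhileT.prems(1) this WhileT.prems(3)] obtain m3 where
    6: "steps P t' (i, m2(tmp 0 := 0)) = (i + csize (While e c), m3)" "agree m'' m3" by blast
  show ?case using steps_add[OF 5 6(1)] 6(2) by blast
qed

section \<open>Hoare triples with time bounds\<close>

definition hr :: "com \<Rightarrow> (int \<Rightarrow> int) \<Rightarrow> nat \<Rightarrow> ((int \<Rightarrow> int) \<Rightarrow> bool) \<Rightarrow> bool" where
  "hr c m T Q \<longleftrightarrow> (\<exists>t m'. run c m t m' \<and> t \<le> T \<and> Q m')"

text \<open>\<open>GetRaw\<close> is excluded because it runs only under a side condition. All other
  commands without loops always run, and \<open>csize\<close> bounds their time since no instruction
  is executed twice.\<close>

fun loopfree :: "com \<Rightarrow> bool" where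
  "loopfree (c ;; d) \<longleftrightarrow> loopfree c \<and> loopfree d"
| "loopfree (Cond e c d) \<longleftrightarrow> loopfree c \<and> loopfree d"
| "loopfree (While e c) \<longleftrightarrow> False"
| "loopfree (GetRaw x e) \<longleftrightarrow> False"
| "loopfree _ \<longleftrightarrow> True"

fun sem :: "com \<Rightarrow> (int \<Rightarrow> int) \<Rightarrow> (int \<Rightarrow> int)" where
  "sem (Asg x e) m = m(loc 31 x := aval e m)"
| "sem (Put a e f) m = m(loc a (aval e m) := aval f m)"
| "sem (PutRaw e f) m = m(aval e m := aval f m)"
| "sem (c ;; d) m = sem d (sem c m)"
| "sem (Cond e c d) m = (if aval e m > 0 then sem c m else sem d m)"
| "sem _ m = m"

lemma run_loopfree: "loopfree c \<Longrightarrow> \<exists>t\<le>csize c. run c m t (sem c m)"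
proof (induction c arbitrary: m)
  case (Seq c d)
  then obtain t t' where "t \<le> csize c" "run c m t (sem c m)" "t' \<le> csize d" "run d (sem c m) t' (sem d (sem c m))"
    by (metis loopfree.simps(1))
  then show ?case by (auto intro!: exI[of _ "t + t'"] run.intros)
next
  case (Cond e c d)
  then obtain t t' where "t \<le> csize c" "run c m t (sem c m)" "t' \<le> csize d" "run d m t' (sem d m)"
    by (metis loopfree.simps(2))
  then have "ecost e + t + 3 \<le> csize (Cond e c d)" "ecost e + t' + 1 \<le> csize (Cond e c d)"
    "aval e m > 0 \<Longrightarrow> run (Cond e c d) m (ecost e + t + 3) (sem (Cond e c d) m)"
    "\<not> aval e m > 0 \<Longrightarrow> run (Cond e c d) m (ecost e + t' + 1) (sem (Cond e c d) m)"
    using run.CondT run.CondF by (fastforce simp del: One_nat_def add_Suc_right)+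
  then show ?case by blast
next
  case (Asg x e)
  show ?case unfolding sem.simps csize.simps using run.Asg[of x e m] by blast
next
  case (Put a e f)
  show ?case unfolding sem.simps csize.simps using run.Put[of a e f m] by blast
next
  case (PutRaw e f)
  show ?case unfolding sem.simps csize.simps using run.PutRaw[of e f m] by blast
qed (auto intro: run.Skip)

lemma hr_loopfree: "loopfree c \<Longrightarrow> csize c \<le> T \<Longrightarrow> Q (sem c m) \<Longrightarrow> hr c m T Q"
  unfolding hr_def using run_loopfree le_trans by blast

lemma hr_GetRaw:
  "0 \<le> aval e m \<Longrightarrow> ecost e + 1 \<le> T \<Longrightarrow> Q (m(loc 31 x := m (aval e m))) \<Longrightarrow> hr (GetRaw x e) m T Q"
  unfolding hr_def using run.GetRaw by blast

lemma hr_Seq: "hr c m T (\<lambda>m'. hr d m' T' Q) \<Longrightarrow> T + T' \<le> T'' \<Longrightarrow> hr (c ;; d) m T'' Q"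
  unfolding hr_def by (meson run.Seq add_mono le_trans)

lemma hr_weaken: "hr c m T Q \<Longrightarrow> T \<le> T' \<Longrightarrow> (\<And>m'. Q m' \<Longrightarrow> Q' m') \<Longrightarrow> hr c m T' Q'"
  unfolding hr_def using le_trans by blast

text \<open>Unlike \<open>hr\<close>, the triple \<open>hp\<close> passes the unused part \<open>p'\<close> of the time budget \<open>p\<close> on to the
  postcondition, as amortized bounds require. In \<open>hp_While\<close> the budget also gives termination.\<close>

definition hp :: "com \<Rightarrow> (int \<Rightarrow> int) \<Rightarrow> nat \<Rightarrow> ((int \<Rightarrow> int) \<Rightarrow> nat \<Rightarrow> bool) \<Rightarrow> bool" where
  "hp c m p Q \<longleftrightarrow> (\<exists>t m' p'. run c m t m' \<and> t + p' \<le> p \<and> Q m' p')"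

lemma hp_hr: "hr c m T Q' \<Longrightarrow> (\<And>m'. Q' m' \<Longrightarrow> \<exists>p'. T + p' \<le> p \<and> Q m' p') \<Longrightarrow> hp c m p Q"
proof -
  assume "hr c m T Q'" and Q: "\<And>m'. Q' m' \<Longrightarrow> \<exists>p'. T + p' \<le> p \<and> Q m' p'"
  then obtain t m' where 1: "run c m t m'" "t \<le> T" "Q' m'" by (auto simp: hr_def)
  then obtain p' where 2: "T + p' \<le> p" "Q m' p'" using Q by blast
  then have "t + p' \<le> p" using 1 by simp
  then show ?thesis unfolding hp_def using 1 2 by blast
qed

lemma hp_weaken: "hp c m p Q \<Longrightarrow> p \<le> q \<Longrightarrow> (\<And>m' p'. Q m' p' \<Longrightarrow> Q' m' p') \<Longrightarrow> hp c m q Q'"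
  unfolding hp_def using le_trans by blast

lemma hr_hp: "hp c m p Q \<Longrightarrow> hr c m p (\<lambda>m'. \<exists>p'. Q m' p')"
  unfolding hp_def hr_def using add_leD1 by blast

lemma hp_Seq: "hp c m p (\<lambda>m' p'. hp d m' p' Q) \<Longrightarrow> hp (c ;; d) m p Q"
proof -
  assume "hp c m p (\<lambda>m' p'. hp d m' p' Q)"
  then obtain t m' p' t' m'' p'' where "run c m t m'" "t + p' \<le> p" "run d m' t' m''" "t' + p'' \<le> p'" "Q m'' p''"
    unfolding hp_def by blast
  then have "run (c ;; d) m (t + t') m''" "t + t' + p'' \<le> p" "Q m'' p''" by (auto intro: run.Seq)
  then show ?thesis unfolding hp_def by blast
qed

lemma hp_Cond:
  assumes "aval e m > 0 \<Longrightarrow> hp c m p Q" "aval e m \<le> 0 \<Longrightarrow> hp d m p Q" "ecost e + 3 + p \<le> q"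
  shows "hp (Cond e c d) m q Q"
proof (cases "aval e m > 0")
  case True
  then obtain t m' p' where 1: "run c m t m'" "t + p' \<le> p" "Q m' p'" using assms(1) unfolding hp_def by blast
  then have "run (Cond e c d) m (ecost e + t + 3) m'" "ecost e + t + 3 + p' \<le> q"
    using run.CondT[OF True] assms(3) by auto
  then show ?thesis unfolding hp_def using 1 by blast
next
  case False
  then have F: "aval e m \<le> 0" by simp
  then obtain t m' p' where 1: "run d m t m'" "t + p' \<le> p" "Q m' p'" using assms(2) unfolding hp_def by blast
  have "run (Cond e c d) m (ecost e + t + 1) m'" using F 1(1) by (rule run.CondF)
  moreover have "ecost e + t + 1 + p' \<le> q" using 1 assms(3) by linarith
  ultimately show ?thesis unfolding hp_def using 1 by blast
qed

lemma hp_While: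
  assumes "I m p"
    and step: "\<And>m p. I m p \<Longrightarrow> aval e m > 0 \<Longrightarrow> \<exists>q. ecost e + 3 + q \<le> p \<and> hp c m q I"
    and fin: "\<And>m p. I m p \<Longrightarrow> aval e m \<le> 0 \<Longrightarrow> \<exists>q. ecost e + 1 + q \<le> p \<and> Q m q"
  shows "hp (While e c) m p Q"
  using assms(1)
proof (induction p arbitrary: m rule: less_induct)
  case (less p)
  show ?case
  proof (cases "aval e m > 0")
    case True
    from step[OF less.prems True] obtain q t m' p' where
      1: "ecost e + 3 + q \<le> p" "run c m t m'" "t + p' \<le> q" "I m' p'"
      unfolding hp_def by blast
    then obtain t' m'' p'' where
      2: "run (While e c) m' t' m''" "t' + p'' \<le> p'" "Q m'' p''"
      using less.IH[of p' m'] unfolding hp_def by force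
    have "run (While e c) m (ecost e + t + 3 + t') m''"
      using True 1(2) 2(1) by (rule run.WhileT)
    moreover have "ecost e + t + 3 + t' + p'' \<le> p" using 1 2 by linarith
    ultimately show ?thesis unfolding hp_def using 2 by blast
  next
    case False
    then have "run (While e c) m (ecost e + 1) m" by (intro run.WhileF) simp
    then show ?thesis using fin[OF less.prems] False unfolding hp_def by force
  qed
qed

text \<open>The potential pays for all rounds with their guards; the extra
  \<open>ecost e + 1\<close> pays for the guard that fails at the end. It is the case of
  \<open>hp_While\<close> whose invariant keeps just that much budget.\<close>

lemma hr_While:
  assumes "I m"
    and step: "\<And>m. I m \<Longrightarrow> aval e m > 0 \<Longrightarrow> \<exists>T. hr c m T (\<lambda>m'. I m' \<and> ecost e + 3 + T + pot m' \<le> pot m)"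
    and fin: "\<And>m. I m \<Longrightarrow> aval e m \<le> 0 \<Longrightarrow> Q m"
    and T: "pot m + ecost e + 1 \<le> T"
  shows "hr (While e c) m T Q"
proof -
  let ?J = "\<lambda>m p. I m \<and> pot m + ecost e + 1 \<le> p"
  have "hp (While e c) m T (\<lambda>m' _. Q m')"
  proof (rule hp_While[where I = ?J])
    show "?J m T" using assms by simp
  next
    fix m p assume J: "?J m p" and g: "aval e m > 0"
    obtain S where S: "hr c m S (\<lambda>m'. I m' \<and> ecost e + 3 + S + pot m' \<le> pot m)" using step J g by blast
    then have "ecost e + 3 + S \<le> pot m" by (auto simp: hr_def)
    then have q: "ecost e + 3 + (p - (ecost e + 3)) \<le> p" using J by simp
    have "hp c m (p - (ecost e + 3)) ?J"
    proof (rule hp_hr[OF S])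
      fix m' assume "I m' \<and> ecost e + 3 + S + pot m' \<le> pot m"
      then show "\<exists>p'. S + p' \<le> p - (ecost e + 3) \<and> ?J m' p'"
        using J by (intro exI[of _ "pot m' + ecost e + 1"] conjI) auto
    qed
    with q show "\<exists>q. ecost e + 3 + q \<le> p \<and> hp c m q ?J" by blast
  next
    fix m p assume "?J m p" "aval e m \<le> 0"
    then show "\<exists>q. ecost e + 1 + q \<le> p \<and> Q m" using fin by (intro exI[of _ 0]) simp
  qed
  then show ?thesis using hr_hp by fastforce
qed

section \<open>Trapezoids as pairs of intervals\<close>

text \<open>Vertices are integers because memory cells are. Covering of \<open>{1..2 * n}\<close>
  follows from distinctness by counting; it is recorded for the x-axis, as the loops run over all
  x-coordinates.\<close>

locale trapezoids =
  fixes n :: int and x1 x2 y1 y2 :: "int \<Rightarrow> int"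
  assumes n_nonneg: "0 \<le> n"
    and x12: "v \<in> {0..<n} \<Longrightarrow> x1 v < x2 v"
    and y12: "v \<in> {0..<n} \<Longrightarrow> y1 v < y2 v"
    and x_range: "v \<in> {0..<n} \<Longrightarrow> 1 \<le> x1 v \<and> x2 v \<le> 2 * n"
    and y_range: "v \<in> {0..<n} \<Longrightarrow> 1 \<le> y1 v \<and> y2 v \<le> 2 * n"
    and x1_inj: "u \<in> {0..<n} \<Longrightarrow> v \<in> {0..<n} \<Longrightarrow> x1 u = x1 v \<Longrightarrow> u = v"
    and x2_inj: "u \<in> {0..<n} \<Longrightarrow> v \<in> {0..<n} \<Longrightarrow> x2 u = x2 v \<Longrightarrow> u = v"
    and x1_neq_x2: "u \<in> {0..<n} \<Longrightarrow> v \<in> {0..<n} \<Longrightarrow> x1 u \<noteq> x2 v"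
    and y1_inj: "u \<in> {0..<n} \<Longrightarrow> v \<in> {0..<n} \<Longrightarrow> y1 u = y1 v \<Longrightarrow> u = v"
    and y2_inj: "u \<in> {0..<n} \<Longrightarrow> v \<in> {0..<n} \<Longrightarrow> y2 u = y2 v \<Longrightarrow> u = v"
    and y1_neq_y2: "u \<in> {0..<n} \<Longrightarrow> v \<in> {0..<n} \<Longrightarrow> y1 u \<noteq> y2 v"
    and x_cover: "1 \<le> x \<Longrightarrow> x \<le> 2 * n \<Longrightarrow> \<exists>v\<in>{0..<n}. x1 v = x \<or> x2 v = x"
begin

definition left :: "int \<Rightarrow> int \<Rightarrow> bool" where
  "left u v \<longleftrightarrow> x2 u < x1 v \<and> y2 u < y1 v"

text \<open>Reflexive on vertices, so \<open>nbrs\<close> is the closed neighbourhood and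
  \<open>deg\<close> exceeds the degree in the graph by one.\<close>

definition meets :: "int \<Rightarrow> int \<Rightarrow> bool" where
  "meets u v \<longleftrightarrow> u \<in> {0..<n} \<and> v \<in> {0..<n} \<and> \<not> left u v \<and> \<not> left v u"

definition nbrs :: "int \<Rightarrow> int set" where
  "nbrs v = {u. meets v u}"

definition deg :: "int \<Rightarrow> nat" where
  "deg v = card (nbrs v)"

text \<open>Orientation by \<open>x1\<close> selects one representative of each unordered pair and
  makes the left end of the bounding box the \<open>x1\<close> of the first component.\<close>

definition edges :: "(int \<times> int) set" where
  "edges = {(a, b). meets a b \<and> x1 a < x1 b}"

definition X1 :: "int \<times> int \<Rightarrow> int" where "X1 e = x1 (fst e)"
definition X2 :: "int \<times> int \<Rightarrow> int" where "X2 e = max (x2 (fst e)) (x2 (snd e))"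
definition Y1 :: "int \<times> int \<Rightarrow> int" where "Y1 e = min (y1 (fst e)) (y1 (snd e))"
definition Y2 :: "int \<times> int \<Rightarrow> int" where "Y2 e = max (y2 (fst e)) (y2 (snd e))"

definition eleft :: "int \<times> int \<Rightarrow> int \<times> int \<Rightarrow> bool" where
  "eleft e f \<longleftrightarrow> X2 e < X1 f \<and> Y2 e < Y1 f"

definition cd :: "int \<times> int \<Rightarrow> int" where
  "cd e = n * fst e + snd e"

lemma cell_eq_iff:
  assumes "0 \<le> b" "b < n" "0 \<le> d" "d < n"
  shows "n * a + b = n * c + d \<longleftrightarrow> a = c \<and> b = d"
proof
  assume *: "n * a + b = n * c + d"
  have "(n * a + b) div n = a" "(n * c + d) div n = c"
    using assms by (simp_all add: div_add1_eq)
  with * show "a = c \<and> b = d" by auto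
qed auto

lemma meets_sym: "meets u v \<longleftrightarrow> meets v u"
  by (auto simp: meets_def)

lemma meets_refl: "v \<in> {0..<n} \<Longrightarrow> meets v v"
  using x12[of v] by (auto simp: meets_def left_def)

lemma nbrs_subset: "nbrs v \<subseteq> {0..<n}"
  by (auto simp: nbrs_def meets_def)

lemma finite_nbrs [simp]: "finite (nbrs v)"
  using nbrs_subset finite_subset by blast

lemma edges_subset: "edges \<subseteq> {0..<n} \<times> {0..<n}"
  by (auto simp: edges_def meets_def)

lemma finite_edges [simp]: "finite edges"
  using edges_subset by (rule finite_subset) simp

lemma edgesD: "e \<in> edges \<Longrightarrow> fst e \<in> {0..<n} \<and> snd e \<in> {0..<n} \<and> x1 (fst e) < x1 (snd e) \<and> meets (fst e) (snd e)"
  by (auto simp: edges_def meets_def)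

lemma cd_eq_iff: "e \<in> edges \<Longrightarrow> f \<in> edges \<Longrightarrow> cd e = cd f \<longleftrightarrow> e = f"
  using cell_eq_iff[of "snd e" "snd f" "fst e" "fst f"] edgesD[of e] edgesD[of f]
  by (auto simp: cd_def prod_eq_iff)

lemma edge_bounds:
  assumes "e \<in> edges"
  shows "X1 e < X2 e" "Y1 e < Y2 e" "1 \<le> X1 e" "X2 e \<le> 2 * n"
  using edgesD[OF assms] x12[of "fst e"] y12[of "fst e"] x12[of "snd e"] x_range[of "fst e"] x_range[of "snd e"]
  by (auto simp: X1_def X2_def Y1_def Y2_def)

text \<open>Double counting of ordered meeting pairs: every edge in both orientations, plus the
  reflexive pairs.\<close>

lemma sum_deg: "(\<Sum>v\<in>{0..<n}. deg v) = 2 * card edges + nat n"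
proof -
  let ?A = "SIGMA v:{0..<n}. nbrs v"
  let ?D = "(\<lambda>v. (v, v)) ` {0..<n}"
  have "?A = edges \<union> prod.swap ` edges \<union> ?D"
  proof (intro equalityI subsetI)
    fix e assume "e \<in> ?A"
    then obtain u v where e: "e = (u, v)" "meets u v" "u \<in> {0..<n}" "v \<in> {0..<n}"
      by (auto simp: nbrs_def meets_def)
    then consider "x1 u < x1 v" | "x1 v < x1 u" | "u = v" using x1_inj by fastforce
    then show "e \<in> edges \<union> prod.swap ` edges \<union> ?D"
      using e meets_sym[of u v] by cases (auto simp: edges_def image_iff)
  next
    fix e assume "e \<in> edges \<union> prod.swap ` edges \<union> ?D"
    then show "e \<in> ?A"
      using meets_sym meets_refl by (auto simp: nbrs_def edges_def meets_def)
  qed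
  moreover have "edges \<inter> prod.swap ` edges = {}" "(edges \<union> prod.swap ` edges) \<inter> ?D = {}"
    by (auto simp: edges_def)
  moreover have "card (prod.swap ` edges) = card edges" by (intro card_image) simp
  moreover have "card ?D = nat n" by (subst card_image) (auto simp: inj_on_def)
  ultimately have "card ?A = 2 * card edges + nat n"
    by (simp add: card_Un_disjoint)
  then show ?thesis by (simp add: deg_def)
qed

section \<open>Diagonals and inversions\<close>

definition owner :: "int \<Rightarrow> int" where
  "owner x = (THE v. v \<in> {0..<n} \<and> (x1 v = x \<or> x2 v = x))"

text \<open>The points \<open>(x, opp x)\<close> are the diagonals.\<close>

definition opp :: "int \<Rightarrow> int" where
  "opp x = (if x < x2 (owner x) then y2 (owner x) else y1 (owner x))"

lemma owner_eq: "v \<in> {0..<n} \<Longrightarrow> x1 v = x \<or> x2 v = x \<Longrightarrow> owner x = v"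
proof -
  assume v: "v \<in> {0..<n}" "x1 v = x \<or> x2 v = x"
  have "u = v" if "u \<in> {0..<n}" "x1 u = x \<or> x2 u = x" for u
    using that v x1_inj[OF that(1) v(1)] x2_inj[OF that(1) v(1)] x1_neq_x2[OF that(1) v(1)]
      x1_neq_x2[OF v(1) that(1)] by metis
  then show ?thesis unfolding owner_def using v by (intro the_equality) blast+
qed

lemma owner_x1 [simp]: "v \<in> {0..<n} \<Longrightarrow> owner (x1 v) = v"
  and owner_x2 [simp]: "v \<in> {0..<n} \<Longrightarrow> owner (x2 v) = v"
  using owner_eq by blast+

lemma opp_x1: "v \<in> {0..<n} \<Longrightarrow> opp (x1 v) = y2 v"
  and opp_x2: "v \<in> {0..<n} \<Longrightarrow> opp (x2 v) = y1 v"
  using x12 by (auto simp: opp_def)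

lemma x_cases:
  assumes "x \<in> {1..2 * n}"
  obtains "owner x \<in> {0..<n}" "x1 (owner x) = x" "x < x2 (owner x)" "opp x = y2 (owner x)"
  | "owner x \<in> {0..<n}" "x2 (owner x) = x" "x1 (owner x) < x" "opp x = y1 (owner x)"
proof -
  from assms obtain v where v: "v \<in> {0..<n}" "x1 v = x \<or> x2 v = x"
    using x_cover[of x] by auto
  then show thesis
    using that owner_eq[OF v] x12[OF v(1)] opp_x1[OF v(1)] opp_x2[OF v(1)] by metis
qed

lemma opp_inj: "inj_on opp {1..2 * n}"
proof (rule inj_onI)
  fix x x' assume *: "x \<in> {1..2 * n}" "x' \<in> {1..2 * n}" "opp x = opp x'"
  show "x = x'"
    by (rule x_cases[OF *(1)]; rule x_cases[OF *(2)])
      (use *(3) y1_inj[of "owner x" "owner x'"] y2_inj[of "owner x" "owner x'"]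
        y1_neq_y2[of "owner x" "owner x'"] y1_neq_y2[of "owner x'" "owner x"] in metis)+
qed

text \<open>Each point \<open>(z, opp z)\<close> lies in the coordinate ranges of its owner. If one
  owner were left of the other, all its points would be smaller in both coordinates.\<close>

lemma inversion_meets:
  assumes "x \<in> {1..2 * n}" "x' \<in> {1..2 * n}" "x < x'" "opp x' < opp x"
  shows "meets (owner x) (owner x')"
proof -
  have *: "owner z \<in> {0..<n} \<and> x1 (owner z) \<le> z \<and> z \<le> x2 (owner z) \<and>
      y1 (owner z) \<le> opp z \<and> opp z \<le> y2 (owner z)" if "z \<in> {1..2 * n}" for z
  proof (cases rule: x_cases[OF that])
    case 1
    then show ?thesis using y12[of "owner z"] by simp
  next
    case 2
    then show ?thesis using y12[of "owner z"] by simp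
  qed
  show ?thesis
    using *[OF assms(1)] *[OF assms(2)] assms(3,4) unfolding meets_def left_def by linarith
qed

text \<open>A trapezoid is inverted with itself by its own two diagonals. For distinct vertices the
  absence of inversions makes \<open>opp\<close> monotone across the pair, and three comparisons of
  diagonal ends then force \<open>left\<close>.\<close>

lemma meets_inversion:
  assumes "meets u v"
  shows "\<exists>x\<in>{1..2 * n}. \<exists>x'\<in>{1..2 * n}. x < x' \<and> opp x' < opp x \<and>
    (owner x = u \<and> owner x' = v \<or> owner x = v \<and> owner x' = u)"
proof -
  have V: "u \<in> {0..<n}" "v \<in> {0..<n}" using assms by (auto simp: meets_def)
  note facts = x12[OF V(1)] x12[OF V(2)] y12[OF V(1)] y12[OF V(2)]
  have in_range: "x1 w \<in> {1..2 * n}" "x2 w \<in> {1..2 * n}" if "w \<in> {0..<n}" for w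
    using x12[OF that] x_range[OF that] by auto
  have cross: ?thesis if "x < x'" "opp x' < opp x" "x = x1 a \<or> x = x2 a" "x' = x1 b \<or> x' = x2 b"
    "a = u \<and> b = v \<or> a = v \<and> b = u" for x x' a b
  proof -
    have ab: "a \<in> {0..<n}" "b \<in> {0..<n}" using that(5) V by auto
    have "x \<in> {1..2 * n}" "x' \<in> {1..2 * n}" "owner x = a" "owner x' = b"
      using that(3,4) in_range[OF ab(1)] in_range[OF ab(2)] owner_eq[OF ab(1), of x] owner_eq[OF ab(2), of x']
      by metis+
    then show ?thesis using that(1,2,5) by metis
  qed
  show ?thesis
  proof (cases "u = v")
    case True
    show ?thesis by (rule cross[of "x1 u" "x2 u" u u]) (use True facts V opp_x1 opp_x2 in auto)
  next
    case False
    show ?thesis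
    proof (rule ccontr)
      assume no: "\<not> ?thesis"
      have mono: "opp x < opp x'" if "x < x'" "x = x1 a \<or> x = x2 a" "x' = x1 b \<or> x' = x2 b"
        "a = u \<and> b = v \<or> a = v \<and> b = u" for x x' a b
      proof -
        have "a \<in> {0..<n}" "b \<in> {0..<n}" using that(4) V by auto
        then have "x \<in> {1..2 * n}" "x' \<in> {1..2 * n}" using that(2,3) in_range by blast+
        then have "opp x \<noteq> opp x'" using inj_onD[OF opp_inj, of x x'] that(1) by auto
        then show ?thesis using cross[OF that(1) _ that(2,3,4)] no by (meson linorder_neqE_linordered_idom)
      qed
      have key: "left a b" if ab: "a = u \<and> b = v \<or> a = v \<and> b = u" and lt: "x1 a < x1 b" for a b
      proof -
        have aV: "a \<in> {0..<n}" "b \<in> {0..<n}" using ab V by auto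
        note f = x12[OF aV(1)] x12[OF aV(2)] y12[OF aV(1)] y12[OF aV(2)]
        have 1: "y2 a < y2 b" using mono[OF lt _ _ ab] aV by (simp add: opp_x1)
        \<comment> \<open>Otherwise \<open>x1 b < x2 a\<close>, and monotonicity gives
          \<open>y2 b < y1 a\<close>, which contradicts 1 because
          \<open>y1 a < y2 a\<close>.\<close>
        have 2: "x2 a < x1 b"
        proof (rule ccontr)
          assume "\<not> x2 a < x1 b"
          then have "x1 b < x2 a" using x1_neq_x2[OF aV(2,1)] by simp
          then have "y2 b < y1 a" using mono[of "x1 b" "x2 a" b a] aV ab by (auto simp: opp_x1 opp_x2)
          then show False using 1 f by simp
        qed
        have "y2 a < y1 b" using mono[of "x1 a" "x2 b" a b] aV ab lt f by (auto simp: opp_x1 opp_x2)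
        then show ?thesis using 2 by (simp add: left_def)
      qed
      have "x1 u \<noteq> x1 v" using x1_inj V False by blast
      then have "left u v \<or> left v u" using key[of u v] key[of v u] by (meson linorder_neqE_linordered_idom)
      then show False using assms by (simp add: meets_def)
    qed
  qed
qed

text \<open>Each neighbour owns two x-coordinates. This bounds the number of shifts in one
  insertion.\<close>

lemma card_inversions_le:
  assumes "v \<in> {0..<n}"
  shows "card {x \<in> {1..2 * n}. meets (owner x) v} \<le> 2 * deg v"
proof -
  have "{x \<in> {1..2 * n}. meets (owner x) v} \<subseteq> x1 ` nbrs v \<union> x2 ` nbrs v"
  proof
    fix x assume x: "x \<in> {x \<in> {1..2 * n}. meets (owner x) v}"
    then have "owner x \<in> nbrs v" by (auto simp: nbrs_def meets_sym)
    then show "x \<in> x1 ` nbrs v \<union> x2 ` nbrs v"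
      using x x_cases[of x] by (metis (no_types, lifting) UnI1 UnI2 image_eqI mem_Collect_eq)
  qed
  then have "card {x \<in> {1..2 * n}. meets (owner x) v} \<le> card (x1 ` nbrs v \<union> x2 ` nbrs v)"
    by (intro card_mono) auto
  also have "\<dots> \<le> deg v + deg v"
    unfolding deg_def by (intro order_trans[OF card_Un_le] add_mono card_image_le) auto
  finally show ?thesis by simp
qed

lemma sum_deg_owner: "(\<Sum>x\<in>{1..2 * n}. deg (owner x)) = 2 * (\<Sum>v\<in>{0..<n}. deg v)"
proof -
  have "{1..2 * n} = x1 ` {0..<n} \<union> x2 ` {0..<n}"
  proof (intro equalityI subsetI)
    fix x assume "x \<in> {1..2 * n}"
    then show "x \<in> x1 ` {0..<n} \<union> x2 ` {0..<n}"
      using x_cases[of x] by (metis UnI1 UnI2 image_eqI)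
  next
    fix x assume "x \<in> x1 ` {0..<n} \<union> x2 ` {0..<n}"
    then obtain v where v: "v \<in> {0..<n}" "x = x1 v \<or> x = x2 v" by blast
    then show "x \<in> {1..2 * n}" using x12[OF v(1)] x_range[OF v(1)] by auto
  qed
  then have "(\<Sum>x\<in>{1..2 * n}. deg (owner x)) = (\<Sum>x\<in>x1 ` {0..<n} \<union> x2 ` {0..<n}. deg (owner x))" by simp
  also have "\<dots> = (\<Sum>x\<in>x1 ` {0..<n}. deg (owner x)) + (\<Sum>x\<in>x2 ` {0..<n}. deg (owner x))"
    by (intro sum.union_disjoint) (auto dest: x1_neq_x2)
  also have "\<dots> = 2 * (\<Sum>v\<in>{0..<n}. deg v)"
  proof -
    have "inj_on x1 {0..<n}" "inj_on x2 {0..<n}"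
      using x1_inj x2_inj by (auto intro!: inj_onI)
    then show ?thesis by (simp add: sum.reindex)
  qed
  finally show ?thesis .
qed

end

section \<open>Levels of edges and the sweep invariants\<close>

lemma finite_int_range [simp]: "finite {j::int. a \<le> j \<and> j \<le> b \<and> P j}"
  by (rule finite_subset[of _ "{a..b}"]) auto

lemma card_below:
  fixes b :: "int \<Rightarrow> int" and k z :: int
  assumes mono: "\<forall>i j. 1 \<le> i \<longrightarrow> i < j \<longrightarrow> j \<le> k \<longrightarrow> b i < b j" and "0 \<le> k"
  defines "c \<equiv> int (card {j \<in> {1..k}. b j < z})"
  shows "0 \<le> c" "c \<le> k" "\<And>j. 1 \<le> j \<Longrightarrow> j \<le> k \<Longrightarrow> b j < z \<longleftrightarrow> j \<le> c"
proof -
  let ?S = "{j \<in> {1..k}. b j < z}"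
  have "\<exists>p. 0 \<le> p \<and> p \<le> k \<and> ?S = {1..p}"
  proof (cases "?S = {}")
    case True
    then show ?thesis using \<open>0 \<le> k\<close> by (intro exI[of _ 0]) auto
  next
    case False
    have fin: "finite ?S" by (rule finite_subset[of _ "{1..k}"]) auto
    define p where "p = Max ?S"
    have p: "p \<in> ?S" unfolding p_def using Max_in[OF fin False] .
    have "?S = {1..p}"
    proof (intro equalityI subsetI)
      fix j assume "j \<in> ?S"
      then show "j \<in> {1..p}" unfolding p_def using Max_ge[OF fin] by auto
    next
      fix j assume j: "j \<in> {1..p}"
      then have "b j \<le> b p" using mono[rule_format, of j p] p by (cases "j = p") auto
      then show "j \<in> ?S" using j p by auto
    qed
    moreover have "0 \<le> p" "p \<le> k" using p by auto
    ultimately show ?thesis by blast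
  qed
  then obtain p where p: "0 \<le> p" "p \<le> k" "?S = {1..p}" by blast
  then have "c = p" by (simp add: c_def)
  then show "0 \<le> c" "c \<le> k" using p by auto
  show "b j < z \<longleftrightarrow> j \<le> c" if "1 \<le> j" "j \<le> k" for j
  proof -
    have "j \<in> ?S \<longleftrightarrow> j \<in> {1..p}" using p(3) by (rule arg_cong)
    then show ?thesis using that \<open>c = p\<close> by simp
  qed
qed

context trapezoids
begin

text \<open>\<open>PL\<close> is the set of edges that have received their level \<open>lam\<close>, \<open>PU\<close> the set of those that lie behind
  the sweep line. The last chain edge of level \<open>j\<close> is \<open>be j\<close>, and \<open>bo j\<close> is its end vertex with larger
  \<open>y2\<close>.\<close>

definition sweep_inv ::
  "(int \<Rightarrow> int) \<Rightarrow> (int \<Rightarrow> int) \<Rightarrow> int \<Rightarrow> (int \<Rightarrow> int) \<Rightarrow> (int \<Rightarrow> int) \<Rightarrow>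
   (int \<times> int) set \<Rightarrow> (int \<times> int) set \<Rightarrow> bool" where
  "sweep_inv lam prd k be bo PL PU \<longleftrightarrow>
     PU \<subseteq> PL \<and> PL \<subseteq> edges \<and> 0 \<le> k \<and>
     (\<forall>e\<in>PL. 1 \<le> lam (cd e) \<and> (lam (cd e) = 1 \<or>
        (\<exists>f\<in>PU. prd (cd e) = cd f \<and> eleft f e \<and> lam (cd f) = lam (cd e) - 1))) \<and>
     (\<forall>e\<in>PU. lam (cd e) \<le> k \<and> y2 (bo (lam (cd e))) \<le> Y2 e) \<and>
     (\<forall>j. 1 \<le> j \<longrightarrow> j \<le> k \<longrightarrow> bo j \<in> {0..<n} \<and>
        (\<exists>e\<in>PU. be j = cd e \<and> lam (cd e) = j \<and> y2 (bo j) = Y2 e \<and> x2 (bo j) \<le> X2 e)) \<and>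
     (\<forall>i j. 1 \<le> i \<longrightarrow> i < j \<longrightarrow> j \<le> k \<longrightarrow> y2 (bo i) < y2 (bo j)) \<and>
     (\<forall>e\<in>PL. \<forall>f\<in>edges. eleft f e \<longrightarrow> f \<in> PU \<and> lam (cd f) < lam (cd e))"

text \<open>By \<open>before\<close> and \<open>after\<close>, \<open>PU\<close> consists of the
  edges that end before \<open>X1 e\<close>. Any \<open>f\<close> left of \<open>e\<close> has a
  level whose coordinate is at most \<open>Y2 f < Y1 e\<close>, so this level is at most
  \<open>l\<close>; conversely the edge stored at level \<open>l\<close> is left of \<open>e\<close>
  and becomes its predecessor. For \<open>l = 0\<close> the predecessor entry is arbitrary, and it
  is never followed.\<close>

lemma sweep_inv_label:
  assumes inv: "sweep_inv lam prd k be bo PL PU"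
    and e: "e \<in> edges" "e \<notin> PL"
    and before: "\<And>f. f \<in> edges \<Longrightarrow> X2 f < X1 e \<Longrightarrow> f \<in> PU"
    and after: "\<And>f. f \<in> PU \<Longrightarrow> X2 f < X1 e"
    and l: "l = int (card {j \<in> {1..k}. y2 (bo j) < Y1 e})"
  shows "sweep_inv (lam(cd e := l + 1)) (prd(cd e := be l)) k be bo (insert e PL) PU"
proof -
  note I = inv[unfolded sweep_inv_def]
  have mono: "\<forall>i j. 1 \<le> i \<longrightarrow> i < j \<longrightarrow> j \<le> k \<longrightarrow> y2 (bo i) < y2 (bo j)" using I by blast
  have k0: "0 \<le> k" using I by blast
  note cb = card_below[where b = "\<lambda>j. y2 (bo j)" and z = "Y1 e", OF mono k0, folded l]
  have PLe: "PL \<subseteq> edges" "PU \<subseteq> PL" using I by auto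
  have neq: "cd f \<noteq> cd e" if "f \<in> PL" for f
    using cd_eq_iff[of f e] e that PLe by auto
  let ?lam = "lam(cd e := l + 1)" and ?prd = "prd(cd e := be l)"
  have lamPL: "?lam (cd f) = lam (cd f)" "?prd (cd f) = prd (cd f)" if "f \<in> PL" for f
    using neq[OF that] by auto
  have lamPU: "?lam (cd f) = lam (cd f)" if "f \<in> PU" for f
    using lamPL(1) PLe that by blast
  have 1: "1 \<le> ?lam (cd f) \<and> (?lam (cd f) = 1 \<or>
        (\<exists>g\<in>PU. ?prd (cd f) = cd g \<and> eleft g f \<and> ?lam (cd g) = ?lam (cd f) - 1))"
    if "f \<in> insert e PL" for f
  proof (cases "f = e")
    case True
    show ?thesis
    proof (cases "l = 0")
      case True
      then show ?thesis using \<open>f = e\<close> by simp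
    next
      case False
      then have lr: "1 \<le> l" "l \<le> k" using cb by auto
      then obtain g where g: "g \<in> PU" "be l = cd g" "lam (cd g) = l" "y2 (bo l) = Y2 g"
        using I by meson
      have "y2 (bo l) < Y1 e" using cb(3)[OF lr] by simp
      then have "eleft g e" using g after by (simp add: eleft_def)
      moreover have "cd g \<noteq> cd e" using neq g PLe by blast
      ultimately have "\<exists>g\<in>PU. ?prd (cd f) = cd g \<and> eleft g f \<and> ?lam (cd g) = ?lam (cd f) - 1"
        using g \<open>f = e\<close> by (intro bexI[of _ g]) auto
      then show ?thesis using \<open>f = e\<close> lr by simp
    qed
  next
    case False
    then have f: "f \<in> PL" using that by simp
    with I have "1 \<le> lam (cd f) \<and> (lam (cd f) = 1 \<or>
        (\<exists>g\<in>PU. prd (cd f) = cd g \<and> eleft g f \<and> lam (cd g) = lam (cd f) - 1))" by blast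
    then show ?thesis using lamPL[OF f] lamPU by metis
  qed
  have 2: "f \<in> PU \<and> ?lam (cd f) < ?lam (cd g)"
    if "g \<in> insert e PL" "f \<in> edges" "eleft f g" for f g
  proof (cases "g = e")
    case True
    then have f: "f \<in> PU" using before[OF that(2)] that(3) by (simp add: eleft_def)
    then have "1 \<le> lam (cd f)" "lam (cd f) \<le> k" "y2 (bo (lam (cd f))) \<le> Y2 f"
      using I by blast+
    moreover have "Y2 f < Y1 e" using that(3) True by (simp add: eleft_def)
    ultimately have "lam (cd f) \<le> l" using cb(3)[of "lam (cd f)"] by simp
    then show ?thesis using f lamPU[OF f] True by simp
  next
    case False
    then have "g \<in> PL" "f \<in> PU" "lam (cd f) < lam (cd g)" using I that by auto
    then show ?thesis using lamPL lamPU by metis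
  qed
  have 3: "?lam (cd f) \<le> k \<and> y2 (bo (?lam (cd f))) \<le> Y2 f" if "f \<in> PU" for f
    using I that lamPU by metis
  have 4: "bo j \<in> {0..<n} \<and>
        (\<exists>f\<in>PU. be j = cd f \<and> ?lam (cd f) = j \<and> y2 (bo j) = Y2 f \<and> x2 (bo j) \<le> X2 f)" if "1 \<le> j" "j \<le> k" for j
  proof -
    from I that obtain f where "bo j \<in> {0..<n}" "f \<in> PU" "be j = cd f" "lam (cd f) = j" "y2 (bo j) = Y2 f"
      "x2 (bo j) \<le> X2 f"
      by meson
    then show ?thesis using lamPU[of f] by blast
  qed
  show ?thesis
    unfolding sweep_inv_def
  proof (intro conjI)
    show "PU \<subseteq> insert e PL" "insert e PL \<subseteq> edges" using PLe e by auto
  qed (use 1 2 3 4 k0 mono in blast)+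
qed

lemma sweep_inv_skip:
  assumes "sweep_inv lam prd k be bo PL PU" "e \<in> PL" "lam (cd e) \<le> k" "y2 (bo (lam (cd e))) \<le> Y2 e"
  shows "sweep_inv lam prd k be bo PL (insert e PU)"
  using assms unfolding sweep_inv_def by blast

text \<open>The table may have changed since \<open>e\<close> was labelled. What persists is that
  the predecessor \<open>f\<close> keeps the coordinate of level \<open>lam (cd e) - 1\<close> at
  most \<open>Y2 f\<close>, hence below \<open>Y1 e\<close>; the smaller levels follow by
  monotonicity.\<close>

lemma sweep_inv_lower:
  assumes inv: "sweep_inv lam prd k be bo PL PU" and e: "e \<in> PL"
  shows "1 \<le> lam (cd e)" "lam (cd e) \<le> k + 1"
    "\<And>j. 1 \<le> j \<Longrightarrow> j < lam (cd e) \<Longrightarrow> y2 (bo j) < Y1 e"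
proof -
  note I = inv[unfolded sweep_inv_def]
  have mono: "y2 (bo i) < y2 (bo j)" if "1 \<le> i" "i < j" "j \<le> k" for i j using I that by blast
  let ?l = "lam (cd e)"
  show l1: "1 \<le> ?l" using I e by blast
  have *: "?l = 1 \<or> (?l - 1 \<le> k \<and> 1 \<le> ?l - 1 \<and> y2 (bo (?l - 1)) < Y1 e)"
  proof (cases "?l = 1")
    case False
    then obtain f where f: "f \<in> PU" "eleft f e" "lam (cd f) = ?l - 1" using I e by meson
    then have "lam (cd f) \<le> k" "y2 (bo (lam (cd f))) \<le> Y2 f" using I by blast+
    then show ?thesis using f False l1 by (auto simp: eleft_def)
  qed simp
  then show "?l \<le> k + 1" using I by auto
  show "y2 (bo j) < Y1 e" if "1 \<le> j" "j < ?l" for j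
    using * that mono[of j "?l - 1"] by (cases "j = ?l - 1") auto
qed

lemma sweep_inv_push:
  assumes inv: "sweep_inv lam prd k be bo PL PU"
    and e: "e \<in> PL"
    and l: "l = lam (cd e)" and better: "k < l \<or> y2 w < y2 (bo l)"
    and w: "w = fst e \<or> w = snd e" "y2 w = Y2 e"
  shows "sweep_inv lam prd (max k l) (be(l := cd e)) (bo(l := w)) PL (insert e PU)"
proof -
  note I = inv[unfolded sweep_inv_def]
  have mono: "y2 (bo i) < y2 (bo j)" if "1 \<le> i" "i < j" "j \<le> k" for i j using I that by blast
  note lower = sweep_inv_lower[OF inv e, folded l]
  have e': "e \<in> edges" using I e by blast
  have wV: "w \<in> {0..<n}" using w edgesD[OF e'] by auto
  have wx: "x2 w \<le> X2 e" using w by (auto simp: X2_def)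
  note bnd = edge_bounds[OF e']
  let ?bo = "bo(l := w)" and ?be = "be(l := cd e)"
  have 1: "lam (cd f) \<le> max k l \<and> y2 (?bo (lam (cd f))) \<le> Y2 f" if "f \<in> insert e PU" for f
  proof (cases "f = e")
    case True
    then show ?thesis using l w by simp
  next
    case False
    then have f: "lam (cd f) \<le> k" "y2 (bo (lam (cd f))) \<le> Y2 f" using I that by blast+
    show ?thesis
    proof (cases "lam (cd f) = l")
      case True
      then show ?thesis using f better by auto
    qed (use f in auto)
  qed
  have 2: "?bo j \<in> {0..<n} \<and>
    (\<exists>f\<in>insert e PU. ?be j = cd f \<and> lam (cd f) = j \<and> y2 (?bo j) = Y2 f \<and> x2 (?bo j) \<le> X2 f)"
    if h: "1 \<le> j" "j \<le> max k l" for j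
  proof (cases "j = l")
    case True
    then show ?thesis using wV w wx l by auto
  next
    case False
    then have "j \<le> k" using h lower by auto
    then have "bo j \<in> {0..<n} \<and>
      (\<exists>f\<in>PU. be j = cd f \<and> lam (cd f) = j \<and> y2 (bo j) = Y2 f \<and> x2 (bo j) \<le> X2 f)"
      using I that by blast
    then show ?thesis using False by auto
  qed
  \<comment> \<open>The new entry exceeds all lower levels by \<open>lower\<close>, and stays below
    all higher ones because it is smaller than the entry it replaces.\<close>
  have 3: "y2 (?bo i) < y2 (?bo j)" if h: "1 \<le> i" "i < j" "j \<le> max k l" for i j
  proof -
    consider "j = l" | "i = l" "j \<le> k" "l \<le> k" | "i \<noteq> l" "j \<noteq> l" "j \<le> k" using h lower by linarith
    then show ?thesis
    proof cases
      case 1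
      then show ?thesis using lower(3)[of i] h bnd w by auto
    next
      case 2
      then show ?thesis using mono[of l j] h lower better by auto
    next
      case 3
      then show ?thesis using mono[of i j] h by auto
    qed
  qed
  show ?thesis
    unfolding sweep_inv_def
  proof (intro conjI)
    show "insert e PU \<subseteq> PL" "PL \<subseteq> edges" "0 \<le> max k l" using I e by auto
  qed (use I 1 2 3 in \<open>blast | meson insertI2\<close>)+
qed

section \<open>Every vertex enters the table of levels at most once\<close>

definition vleft :: "int \<times> int \<Rightarrow> int \<Rightarrow> bool" where
  "vleft e v \<longleftrightarrow> X2 e < x1 v \<and> Y2 e < y1 v"

text \<open>Level \<open>l\<close> can be taken over by a vertex \<open>w\<close> only if \<open>l - 1\<close> is the length of a longest chain
  of edges to the left of \<open>w\<close>, and from then on the level \<open>l\<close> never rises above \<open>y2 w\<close>. Hence every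
  vertex is recorded at most once, which makes the total running time linear.\<close>

definition rec_inv :: "(int \<Rightarrow> int) \<Rightarrow> int \<Rightarrow> (int \<Rightarrow> int) \<Rightarrow> int set \<Rightarrow> bool" where
  "rec_inv lam k bo W \<longleftrightarrow> W \<subseteq> {0..<n} \<and>
     (\<forall>w\<in>W. \<forall>j. (j = 0 \<or> (\<exists>f\<in>edges. vleft f w \<and> lam (cd f) = j)) \<longrightarrow>
        j + 1 \<le> k \<and> y2 (bo (j + 1)) \<le> y2 w)"

text \<open>An edge that reaches \<open>x1 w\<close> or beyond is not left of \<open>w\<close>, so
  its new label does not affect the condition on \<open>w\<close>.\<close>

lemma rec_inv_label:
  assumes "rec_inv lam k bo W" "e \<in> edges" "\<And>w. w \<in> W \<Longrightarrow> x1 w \<le> X2 e"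
  shows "rec_inv (lam(cd e := l)) k bo W"
proof -
  have "cd f \<noteq> cd e" if "f \<in> edges" "vleft f w" "w \<in> W" for f w
    using cd_eq_iff[of f e] that assms(2) assms(3)[OF that(3)] by (auto simp: vleft_def)
  then show ?thesis using assms(1) unfolding rec_inv_def by (metis fun_upd_apply)
qed

text \<open>If \<open>w\<close> were already in \<open>W\<close>, the invariant for the predecessor
  of \<open>e\<close>, which is left of \<open>w\<close> and has level \<open>l - 1\<close> (or for
  \<open>j = 0\<close> if \<open>l = 1\<close>), would put level \<open>l\<close> at or below
  \<open>y2 w\<close>, against \<open>better\<close>. For the new member \<open>w\<close> the point
  is that all edges left of \<open>w\<close> have levels below \<open>l\<close>. For old members
  nothing is lost, since entries only decrease and \<open>k\<close> only grows.\<close>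

lemma rec_inv_push:
  assumes inv: "sweep_inv lam prd k be bo PL PU"
    and rinv: "rec_inv lam k bo W"
    and e: "e \<in> PL"
    and l: "l = lam (cd e)" and better: "k < l \<or> y2 w < y2 (bo l)"
    and w: "w = fst e \<or> w = snd e" "y2 w = Y2 e"
    and before: "\<And>f. f \<in> edges \<Longrightarrow> X2 f < X2 e \<Longrightarrow> f \<in> PU"
  shows "w \<notin> W" "rec_inv lam (max k l) (bo(l := w)) (insert w W)"
proof -
  note I = inv[unfolded sweep_inv_def]
  have mono: "y2 (bo i) < y2 (bo j)" if "1 \<le> i" "i < j" "j \<le> k" for i j using I that by blast
  note lower = sweep_inv_lower[OF inv e, folded l]
  have e': "e \<in> edges" using I e by blast
  have wV: "w \<in> {0..<n}" using w edgesD[OF e'] by auto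
  have x1w: "X1 e \<le> x1 w" "Y1 e \<le> y1 w" "x2 w \<le> X2 e"
    using w edgesD[OF e'] by (auto simp: X1_def Y1_def X2_def)
  have "l = 1 \<or> (\<exists>f\<in>edges. vleft f w \<and> lam (cd f) = l - 1)"
  proof (cases "l = 1")
    case False
    then obtain f where f: "f \<in> PU" "eleft f e" "lam (cd f) = l - 1" using I e l by meson
    then have "f \<in> edges" "vleft f w" using I x1w by (auto simp: eleft_def vleft_def)
    then show ?thesis using f by blast
  qed simp
  then have "w \<in> W \<Longrightarrow> l - 1 + 1 \<le> k \<and> y2 (bo (l - 1 + 1)) \<le> y2 w"
    using rinv unfolding rec_inv_def by (metis diff_self)
  then show "w \<notin> W" using better by auto
  have new: "j + 1 \<le> max k l \<and> y2 ((bo(l := w)) (j + 1)) \<le> y2 w"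
    if h: "j = 0 \<or> (\<exists>f\<in>edges. vleft f w \<and> lam (cd f) = j)" for j
  proof -
    \<comment> \<open>An edge \<open>f\<close> left of \<open>w\<close> with level
      \<open>j >= l\<close> would make the coordinate of level \<open>l\<close> at most
      \<open>Y2 f < y2 w\<close>, against \<open>better\<close>.\<close>
    have "0 \<le> j \<and> j + 1 \<le> l"
    proof (cases "j = 0")
      case True
      then show ?thesis using lower by simp
    next
      case False
      then obtain f where f: "f \<in> edges" "vleft f w" "lam (cd f) = j" using h by blast
      then have "f \<in> PU" using before[OF f(1)] x1w x12[OF wV] by (auto simp: vleft_def)
      then have 1: "1 \<le> j" "j \<le> k" "y2 (bo j) \<le> Y2 f" using I f by blast+
      have "Y2 f < y2 w" using f y12[OF wV] by (auto simp: vleft_def)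
      then have "j < l"
        using 1 better mono[of l j] lower(1) by (cases "l = j"; cases "l < j") auto
      then show ?thesis using 1 by simp
    qed
    moreover have "y2 (bo (j + 1)) \<le> y2 w" if "j + 1 < l" "0 \<le> j"
      using lower(3)[of "j + 1"] that edge_bounds[OF e'] w by auto
    ultimately show ?thesis by auto
  qed
  have old: "j + 1 \<le> max k l \<and> y2 ((bo(l := w)) (j + 1)) \<le> y2 v"
    if "v \<in> W" "j = 0 \<or> (\<exists>f\<in>edges. vleft f v \<and> lam (cd f) = j)" for v j
  proof -
    have "j + 1 \<le> k \<and> y2 (bo (j + 1)) \<le> y2 v" using rinv that unfolding rec_inv_def by blast
    then show ?thesis using better by auto
  qed
  show "rec_inv lam (max k l) (bo(l := w)) (insert w W)"
    unfolding rec_inv_def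
  proof (intro conjI ballI allI)
    show "insert w W \<subseteq> {0..<n}" using rinv wV by (auto simp: rec_inv_def)
  next
    fix v j assume "v \<in> insert w W"
    then show "(j = 0 \<or> (\<exists>f\<in>edges. vleft f v \<and> lam (cd f) = j)) \<longrightarrow>
        j + 1 \<le> max k l \<and> y2 ((bo(l := w)) (j + 1)) \<le> y2 v"
      using new old by blast
  qed
qed

text \<open>Counters of vertices that begin before \<open>t\<close> are no longer consulted when
  levels are computed; leaving them unconstrained is what confines updates to a neighbourhood.
  \<open>J\<close> is a set and not \<open>{1..k}\<close> because a level is missing while its entry
  is being exchanged.\<close>

definition count_inv :: "(int \<Rightarrow> int) \<Rightarrow> int set \<Rightarrow> (int \<Rightarrow> int) \<Rightarrow> int \<Rightarrow> bool" where
  "count_inv d J bo t \<longleftrightarrow> (\<forall>v\<in>{0..<n}. t \<le> x1 v \<longrightarrow> d v = int (card {j \<in> J. y1 v < y2 (bo j)}))"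

text \<open>No \<open>y1\<close> equals a \<open>y2\<close>, so \<open>k - d v\<close> counts the
  levels below \<open>y1 v\<close>. The end vertex with the smaller \<open>y1\<close> has the
  smaller count, hence the \<open>max\<close>.\<close>

lemma count_inv_label:
  assumes inv: "sweep_inv lam prd k be bo PL PU" and c: "count_inv d {1..k} bo t"
    and e: "e \<in> edges" "t \<le> X1 e"
  shows "k - max (d (fst e)) (d (snd e)) = int (card {j \<in> {1..k}. y2 (bo j) < Y1 e})"
proof -
  note I = inv[unfolded sweep_inv_def]
  have k0: "0 \<le> k" using I by blast
  have bV: "bo j \<in> {0..<n}" if "j \<in> {1..k}" for j using I that by auto
  have *: "d v = int (card {j \<in> {1..k}. y1 v < y2 (bo j)})" if "v = fst e \<or> v = snd e" for v
    using c e edgesD[OF e(1)] that unfolding count_inv_def X1_def by auto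
  have **: "k - d v = int (card {j \<in> {1..k}. y2 (bo j) < y1 v})" if v: "v = fst e \<or> v = snd e" for v
  proof -
    have vV: "v \<in> {0..<n}" using v edgesD[OF e(1)] by auto
    have "card {1..k} = card {j \<in> {1..k}. y2 (bo j) < y1 v} + card {j \<in> {1..k}. y1 v < y2 (bo j)}"
    proof (subst card_Un_disjoint[symmetric])
      have *: "\<forall>j\<in>{1..k}. y2 (bo j) < y1 v \<or> y1 v < y2 (bo j)"
        using y1_neq_y2[OF vV bV] by (metis linorder_neqE_linordered_idom)
      show "card {1..k} = card ({j \<in> {1..k}. y2 (bo j) < y1 v} \<union> {j \<in> {1..k}. y1 v < y2 (bo j)})"
        using * by (intro arg_cong[of _ _ card]) blast
    qed auto
    then show ?thesis using *[OF v] k0 by simp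
  qed
  show ?thesis
  proof (cases "y1 (fst e) \<le> y1 (snd e)")
    case True
    then have "card {j \<in> {1..k}. y2 (bo j) < y1 (fst e)} \<le> card {j \<in> {1..k}. y2 (bo j) < y1 (snd e)}"
      by (intro card_mono) auto
    then show ?thesis using **[of "fst e"] **[of "snd e"] True by (simp add: Y1_def)
  next
    case False
    then have "card {j \<in> {1..k}. y2 (bo j) < y1 (snd e)} \<le> card {j \<in> {1..k}. y2 (bo j) < y1 (fst e)}"
      by (intro card_mono) auto
    then show ?thesis using **[of "fst e"] **[of "snd e"] False by (simp add: Y1_def)
  qed
qed

text \<open>A vertex \<open>v\<close> with \<open>x2 w < x1 v\<close> and \<open>y1 v < y2 w\<close> is a neighbour of \<open>w\<close>, so recording \<open>w\<close>
  changes the counters of neighbours of \<open>w\<close> only.\<close>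

lemma count_inv_add:
  assumes "count_inv d J bo t" "w \<in> {0..<n}" "x2 w < t" "finite J" "l \<notin> J"
    and d': "\<And>v. d' v = d v + (if v \<in> nbrs w \<and> y1 v < y2 w then 1 else 0)"
  shows "count_inv d' (insert l J) (bo(l := w)) t"
  unfolding count_inv_def
proof (intro ballI impI)
  fix v assume v: "v \<in> {0..<n}" "t \<le> x1 v"
  have "v \<in> nbrs w" if "y1 v < y2 w"
    using that v assms(2,3) x12[OF v(1)] x12[OF assms(2)] y12[OF v(1)] by (auto simp: nbrs_def meets_def left_def)
  then have "d' v = d v + (if y1 v < y2 w then 1 else 0)" using d' by auto
  moreover have "{j \<in> insert l J. y1 v < y2 ((bo(l := w)) j)} =
      (if y1 v < y2 w then insert l else id) {j \<in> J. y1 v < y2 (bo j)}"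
    using \<open>l \<notin> J\<close> by auto
  moreover have "d v = int (card {j \<in> J. y1 v < y2 (bo j)})"
    using assms(1) v by (auto simp: count_inv_def)
  ultimately show "d' v = int (card {j \<in> insert l J. y1 v < y2 ((bo(l := w)) j)})"
    using \<open>l \<notin> J\<close> \<open>finite J\<close> by simp
qed

lemma count_inv_remove:
  assumes "count_inv d J bo t" "bo l \<in> {0..<n}" "x2 (bo l) < t" "finite J" "l \<in> J"
    and d': "\<And>v. d' v = d v + (if v \<in> nbrs (bo l) \<and> y1 v < y2 (bo l) then - 1 else 0)"
  shows "count_inv d' (J - {l}) bo t"
  unfolding count_inv_def
proof (intro ballI impI)
  fix v assume v: "v \<in> {0..<n}" "t \<le> x1 v"
  let ?w = "bo l"
  have "v \<in> nbrs ?w" if "y1 v < y2 ?w"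
    using that v assms(2,3) x12[OF v(1)] x12[OF assms(2)] y12[OF v(1)] by (auto simp: nbrs_def meets_def left_def)
  then have "d' v = d v - (if y1 v < y2 ?w then 1 else 0)" using d' by auto
  moreover have "{j \<in> J. y1 v < y2 (bo j)} =
      (if y1 v < y2 ?w then insert l else id) {j \<in> J - {l}. y1 v < y2 (bo j)}"
    using \<open>l \<in> J\<close> by auto
  moreover have "d v = int (card {j \<in> J. y1 v < y2 (bo j)})"
    using assms(1) v by (auto simp: count_inv_def)
  ultimately show "d' v = int (card {j \<in> J - {l}. y1 v < y2 (bo j)})"
    using \<open>finite J\<close> by simp
qed

lemma count_inv_mono: "count_inv d J bo t \<Longrightarrow> t \<le> t' \<Longrightarrow> count_inv d J bo t'"
  by (auto simp: count_inv_def)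

text \<open>Levels increase strictly along \<open>eleft\<close>, so they map a chain injectively
  into \<open>{1..k}\<close>.\<close>

lemma chain_card_le:
  assumes inv: "sweep_inv lam prd k be bo edges edges"
    and C: "C \<subseteq> edges" "\<And>e f. e \<in> C \<Longrightarrow> f \<in> C \<Longrightarrow> e \<noteq> f \<Longrightarrow> eleft e f \<or> eleft f e"
  shows "int (card C) \<le> k"
proof -
  note I = inv[unfolded sweep_inv_def]
  have lt: "lam (cd f) < lam (cd e)" if "e \<in> edges" "f \<in> edges" "eleft f e" for e f
    using I that by meson
  have "inj_on (\<lambda>e. lam (cd e)) C"
  proof (rule inj_onI, rule ccontr)
    fix e f assume *: "e \<in> C" "f \<in> C" "lam (cd e) = lam (cd f)" "e \<noteq> f"
    then have "eleft e f \<or> eleft f e" using C by blast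
    then have "lam (cd e) < lam (cd f) \<or> lam (cd f) < lam (cd e)" using lt * C(1) by (meson subsetD)
    then show False using * by simp
  qed
  moreover have "lam (cd e) \<in> {1..k}" if "e \<in> C" for e
  proof -
    have "e \<in> edges" using that C(1) by blast
    then have "1 \<le> lam (cd e)" "lam (cd e) \<le> k" using I by meson+
    then show ?thesis by simp
  qed
  then have "(\<lambda>e. lam (cd e)) ` C \<subseteq> {1..k}" by blast
  ultimately have "card C \<le> card {1..k}" by (intro card_inj_on_le[where f = "\<lambda>e. lam (cd e)"]) auto
  moreover have "0 \<le> k" using I by blast
  ultimately show ?thesis by simp
qed

end

section \<open>Constructing the adjacency lists\<close>

text \<open>Columns: coordinates of the trapezoids (\<open>cX1\<close> to \<open>cY2\<close>); vertex at a coordinate (\<open>cXV\<close>, \<open>cYV\<close>);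
  offset \<open>n * v\<close> of row \<open>v\<close> in a matrix (\<open>cRow\<close>); sorted list of insertion sort (\<open>cS\<close>); adjacency matrix, degrees
  and adjacency lists (\<open>cM\<close>, \<open>cDeg\<close>, \<open>cAdj\<close>); counters \<open>d\<close> (\<open>cD\<close>); level, predecessor and
  end vertices of the edge with code \<open>n * a + b\<close> (\<open>cLam\<close> to \<open>cEW\<close>); edge and upper right vertex of a
  level (\<open>cBE\<close>, \<open>cBO\<close>). The matrix \<open>cM\<close> relies on the memory being 0 initially.\<close>

abbreviation (input) "cX1 \<equiv> 2 :: nat"
abbreviation (input) "cX2 \<equiv> 3 :: nat"
abbreviation (input) "cY1 \<equiv> 4 :: nat"
abbreviation (input) "cY2 \<equiv> 5 :: nat"
abbreviation (input) "cXV \<equiv> 6 :: nat"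
abbreviation (input) "cYV \<equiv> 7 :: nat"
abbreviation (input) "cRow \<equiv> 8 :: nat"
abbreviation (input) "cS \<equiv> 9 :: nat"
abbreviation (input) "cM \<equiv> 10 :: nat"
abbreviation (input) "cDeg \<equiv> 11 :: nat"
abbreviation (input) "cAdj \<equiv> 12 :: nat"
abbreviation (input) "cD \<equiv> 13 :: nat"
abbreviation (input) "cLam \<equiv> 14 :: nat"
abbreviation (input) "cPrd \<equiv> 15 :: nat"
abbreviation (input) "cEU \<equiv> 16 :: nat"
abbreviation (input) "cEW \<equiv> 17 :: nat"
abbreviation (input) "cBE \<equiv> 18 :: nat"
abbreviation (input) "cBO \<equiv> 19 :: nat"

abbreviation (input) "vn \<equiv> 0 :: int"
abbreviation (input) "vi \<equiv> 1 :: int"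
abbreviation (input) "vr \<equiv> 2 :: int"
abbreviation (input) "vacc \<equiv> 3 :: int"
abbreviation (input) "vz \<equiv> 4 :: int"
abbreviation (input) "vx \<equiv> 5 :: int"
abbreviation (input) "vv \<equiv> 6 :: int"
abbreviation (input) "vy \<equiv> 7 :: int"
abbreviation (input) "vj \<equiv> 8 :: int"
abbreviation (input) "vu \<equiv> 9 :: int"
abbreviation (input) "vq \<equiv> 10 :: int"
abbreviation (input) "vk \<equiv> 11 :: int"
abbreviation (input) "vp \<equiv> 12 :: int"
abbreviation (input) "vpe \<equiv> 13 :: int"
abbreviation (input) "vb \<equiv> 14 :: int"
abbreviation (input) "vl \<equiv> 15 :: int"
abbreviation (input) "vw \<equiv> 16 :: int"
abbreviation (input) "vf \<equiv> 17 :: int"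
abbreviation (input) "vo \<equiv> 18 :: int"
abbreviation (input) "vs \<equiv> 19 :: int"
abbreviation (input) "vse \<equiv> 20 :: int"
abbreviation (input) "vc \<equiv> 21 :: int"

text \<open>The frame condition of a program piece. Column 31 is treated cell by cell because all
  variables share it.\<close>

definition same :: "(int \<Rightarrow> int) \<Rightarrow> (int \<Rightarrow> int) \<Rightarrow> nat set \<Rightarrow> int set \<Rightarrow> bool" where
  "same m m' A X \<longleftrightarrow> (\<forall>a<32. a \<noteq> 31 \<longrightarrow> a \<notin> A \<longrightarrow> ar m' a = ar m a) \<and>
     (\<forall>x. x \<notin> X \<longrightarrow> ar m' 31 x = ar m 31 x)"

lemma sameD: "same m m' A X \<Longrightarrow> a < 32 \<Longrightarrow> a \<noteq> 31 \<Longrightarrow> a \<notin> A \<Longrightarrow> ar m' a = ar m a"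
  and sameD1: "same m m' A X \<Longrightarrow> x \<notin> X \<Longrightarrow> ar m' 31 x = ar m 31 x"
  unfolding same_def by blast+

lemma same_refl [simp]: "same m m A X"
  by (simp add: same_def)

lemma same_trans:
  "same m m' A X \<Longrightarrow> same m' m'' B Y \<Longrightarrow> A \<subseteq> C \<Longrightarrow> B \<subseteq> C \<Longrightarrow> X \<subseteq> Z \<Longrightarrow> Y \<subseteq> Z \<Longrightarrow> same m m'' C Z"
  unfolding same_def by (metis subsetD)

lemma same_mono: "same m m' A X \<Longrightarrow> A \<subseteq> C \<Longrightarrow> X \<subseteq> Z \<Longrightarrow> same m m' C Z"
  unfolding same_def by blast

lemma same_upd [simp]:
  assumes "a < 32" "if a = 31 then i \<in> X else a \<in> A"
  shows "same m (m'(loc a i := z)) A X \<longleftrightarrow> same m m' A X"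
proof -
  have "ar (m'(loc a i := z)) b = ar m' b" if "b < 32" "b \<noteq> 31" "b \<notin> A" for b
  proof -
    have "a \<noteq> b" using assms(2) that by (cases "a = 31") auto
    then show ?thesis using assms(1) that(1) by simp
  qed
  moreover have "ar (m'(loc a i := z)) 31 x = ar m' 31 x" if "x \<notin> X" for x
  proof (cases "a = 31")
    case True
    then have "i \<noteq> x" using assms(2) that by auto
    then show ?thesis using True by simp
  qed (use assms(1) in simp)
  ultimately show ?thesis unfolding same_def by (simp cong: conj_cong imp_cong)
qed

text \<open>The same pair may be announced by up to four inversions; the matrix cell lets only the
  first one through. The current degree is the next free position of the list.\<close>

definition add_arc :: "int \<Rightarrow> int \<Rightarrow> com" where
  "add_arc a b = Asg vq (Plus (Ix cRow (V a)) (V b)) ;;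
     Cond (Minus (N 1) (Ix cM (V vq)))
       (Put cM (V vq) (N 1) ;;
        Put cAdj (Plus (Ix cRow (V a)) (Ix cDeg (V a))) (V b) ;;
        Put cDeg (V a) (Plus (Ix cDeg (V a)) (N 1)))
       Skip"

text \<open>Every shift past a larger entry is one inversion with the current point, so the sorting
  work and the number of announced arcs are proportional. \<open>cS\<close> holds y-coordinates,
  which \<open>cYV\<close> turns back into vertices.\<close>

definition insert_body :: com where
  "insert_body =
     Asg vu (Ix cYV (Ix cS (V vj))) ;;
     add_arc vu vv ;;
     add_arc vv vu ;;
     Put cS (Plus (V vj) (N 1)) (Ix cS (V vj)) ;;
     Asg vj (Minus (V vj) (N 1))"

text \<open>No bound on the index is tested: cell 0 of \<open>cS\<close> contains 0, a sentinel
  below every y-coordinate.\<close>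

definition insert_loop :: com where
  "insert_loop = While (Minus (Ix cS (V vj)) (V vy)) insert_body"

definition arcs_pre :: com where
  "arcs_pre =
     Asg vv (Ix cXV (V vx)) ;;
     Cond (Minus (Ix cX2 (V vv)) (V vx)) (Asg vy (Ix cY2 (V vv))) (Asg vy (Ix cY1 (V vv))) ;;
     Asg vj (Minus (V vx) (N 1))"

definition arcs_post :: com where
  "arcs_post = Put cS (Plus (V vj) (N 1)) (V vy) ;; Asg vx (Plus (V vx) (N 1))"

definition arcs_body :: com where
  "arcs_body = arcs_pre ;; insert_loop ;; arcs_post"

definition arcs_loop :: com where
  "arcs_loop = While (Minus (Plus (Plus (V vn) (V vn)) (N 1)) (V vx)) arcs_body"

context trapezoids
begin

definition input_ok :: "(int \<Rightarrow> int) \<Rightarrow> bool" where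
  "input_ok m \<longleftrightarrow> ar m 31 vn = n \<and>
     (\<forall>v\<in>{0..<n}. ar m cX1 v = x1 v \<and> ar m cX2 v = x2 v \<and> ar m cY1 v = y1 v \<and> ar m cY2 v = y2 v \<and>
        ar m cRow v = n * v \<and> ar m cYV (y1 v) = v \<and> ar m cYV (y2 v) = v) \<and>
     (\<forall>x\<in>{1..2*n}. ar m cXV x = owner x)"

lemma input_ok_same:
  assumes "input_ok m" "same m m' A X" "A \<inter> {2..8} = {}" "0 \<notin> X"
  shows "input_ok m'"
proof -
  have "ar m' c = ar m c" if "c \<in> {2..8}" for c
  proof -
    have "c \<notin> A" using assms(3) that by blast
    then show ?thesis using sameD[OF assms(2), of c] that by auto
  qed
  then have "ar m' 2 = ar m 2" "ar m' 3 = ar m 3" "ar m' 4 = ar m 4" "ar m' 5 = ar m 5" "ar m' 6 = ar m 6"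
    "ar m' 7 = ar m 7" "ar m' 8 = ar m 8" by simp_all
  then show ?thesis
    using assms(1) sameD1[OF assms(2,4)] unfolding input_ok_def by simp
qed

definition arcs_ok :: "(int \<times> int) set \<Rightarrow> (int \<Rightarrow> int) \<Rightarrow> bool" where
  "arcs_ok Q m \<longleftrightarrow> Q \<subseteq> {0..<n} \<times> {0..<n} \<and>
     (\<forall>u\<in>{0..<n}. \<forall>v\<in>{0..<n}. ar m cM (n * u + v) = (if (u, v) \<in> Q then 1 else 0)) \<and>
     (\<forall>u\<in>{0..<n}. ar m cDeg u = int (card (Q `` {u})) \<and>
        bij_betw (\<lambda>i. ar m cAdj (n * u + i)) {0..<ar m cDeg u} (Q `` {u}))"

lemma arcs_ok_same:
  assumes "arcs_ok Q m" "same m m' A X" "A \<inter> {10..12} = {}"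
  shows "arcs_ok Q m'"
proof -
  have "ar m' c = ar m c" if "c \<in> {10..12}" for c
  proof -
    have "c \<notin> A" using assms(3) that by blast
    then show ?thesis using sameD[OF assms(2), of c] that by auto
  qed
  then have eq: "ar m' 10 = ar m 10" "ar m' 11 = ar m 11" "ar m' 12 = ar m 12" by simp_all
  show ?thesis
    using assms(1) unfolding arcs_ok_def eq .
qed

lemma add_arc_sem:
  assumes inp: "input_ok m" and arcs: "arcs_ok Q m" and u: "u \<in> {0..<n}" and v: "v \<in> {0..<n}"
    and a: "ar m 31 a = u" "ar m 31 b = v" "a \<noteq> vq" "b \<noteq> vq"
  shows "arcs_ok (insert (u, v) Q) (sem (add_arc a b) m)"
    and "same m (sem (add_arc a b) m) {cM, cDeg, cAdj} {vq}"
proof -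
  show "same m (sem (add_arc a b) m) {cM, cDeg, cAdj} {vq}"
    using a by (simp add: add_arc_def)
  have row: "ar m cRow u = n * u" using inp u by (simp add: input_ok_def)
  note A = arcs[unfolded arcs_ok_def]
  have Qsub: "Q \<subseteq> {0..<n} \<times> {0..<n}" using A by blast
  show "arcs_ok (insert (u, v) Q) (sem (add_arc a b) m)"
  proof (cases "(u, v) \<in> Q")
    case True
    then have "ar m cM (n * u + v) = 1" using A u v by simp
    then have "sem (add_arc a b) m = m(loc 31 vq := n * u + v)"
      using a row by (simp add: add_arc_def)
    moreover have "same m (m(loc 31 vq := n * u + v)) {} {vq}" by simp
    ultimately have "arcs_ok Q (sem (add_arc a b) m)" using arcs_ok_same[OF arcs] by fastforce
    then show ?thesis using True by (simp add: insert_absorb)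
  next
    case False
    then have "ar m cM (n * u + v) = 0" using A u v by simp
    then have m': "sem (add_arc a b) m = m(loc 31 vq := n * u + v, loc cM (n * u + v) := 1,
        loc cAdj (n * u + ar m cDeg u) := v, loc cDeg u := ar m cDeg u + 1)"
      using a row by (simp add: add_arc_def)
    have fin: "finite (Q `` {w})" for w
      by (rule finite_subset[of _ "{0..<n}"]) (use Qsub in auto)
    have Q': "insert (u, v) Q `` {w} = (if w = u then insert v (Q `` {u}) else Q `` {w})" for w by auto
    have deg_u: "ar m cDeg u = int (card (Q `` {u}))" using A u by simp
    \<comment> \<open>The pair is new, so row \<open>u\<close> has fewer than \<open>n\<close>
      entries and the appended one does not spill into the next row.\<close>
    have "card (insert v (Q `` {u})) \<le> card {0..<n}"
      by (intro card_mono) (use Qsub u v in auto)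
    then have deg_lt: "ar m cDeg u < n" using fin False deg_u u by simp
    show ?thesis
      unfolding arcs_ok_def
    proof (intro conjI ballI)
      show "insert (u, v) Q \<subseteq> {0..<n} \<times> {0..<n}" using Qsub u v by simp
    next
      fix s t assume st: "s \<in> {0..<n}" "t \<in> {0..<n}"
      then show "ar (sem (add_arc a b) m) cM (n * s + t) = (if (s, t) \<in> insert (u, v) Q then 1 else 0)"
        unfolding m' using A u v cell_eq_iff[of t v s u] by simp
    next
      fix s assume s: "s \<in> {0..<n}"
      then show "ar (sem (add_arc a b) m) cDeg s = int (card (insert (u, v) Q `` {s}))"
        unfolding m' Q' using A fin False by simp
      show "bij_betw (\<lambda>i. ar (sem (add_arc a b) m) cAdj (n * s + i))
          {0..<ar (sem (add_arc a b) m) cDeg s} (insert (u, v) Q `` {s})"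
      proof (cases "s = u")
        case True
        let ?d = "ar m cDeg u"
        have "bij_betw (\<lambda>i. ar m cAdj (n * u + i)) {0..<?d} (Q `` {u})" using A u by blast
        then have "bij_betw (\<lambda>i. if i = ?d then v else ar m cAdj (n * u + i)) {0..<?d} (Q `` {u})"
          by (rule bij_betw_cong[THEN iffD1, rotated]) simp
        then have "bij_betw (\<lambda>i. if i = ?d then v else ar m cAdj (n * u + i)) (insert ?d {0..<?d}) (insert v (Q `` {u}))"
          using notIn_Un_bij_betw[of ?d "{0..<?d}" "\<lambda>i. if i = ?d then v else ar m cAdj (n * u + i)" "Q `` {u}"] False
          by simp
        moreover have "insert ?d {0..<?d} = {0..<?d + 1}" using deg_u by auto
        ultimately show ?thesis
          unfolding m' Q' using True by simp
      next
        case False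
        have "n * s + i \<noteq> n * u + ar m cDeg u" if "i \<in> {0..<ar m cDeg s}" for i
        proof -
          have "ar m cDeg s = int (card (Q `` {s}))" using A s by simp
          moreover have "card (Q `` {s}) \<le> card {0..<n}" by (intro card_mono) (use Qsub in auto)
          ultimately have "i < n" "0 \<le> i" using that by auto
          then show ?thesis using cell_eq_iff[of i "ar m cDeg u" s u] deg_lt deg_u False by simp
        qed
        moreover have "bij_betw (\<lambda>i. ar m cAdj (n * s + i)) {0..<ar m cDeg s} (Q `` {s})" using A s by blast
        ultimately have "bij_betw (\<lambda>i. if n * s + i = n * u + ar m cDeg u then v else ar m cAdj (n * s + i)) {0..<ar m cDeg s} (Q `` {s})"
          by (subst bij_betw_cong) auto
        then show ?thesis
          unfolding m' Q' using False by simp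
      qed
    qed
  qed
qed

text \<open>\<open>m\<close> is the memory before the loop. Entries behind position \<open>j\<close>
  have moved one place to the right, leaving a hole at \<open>j + 1\<close> whose content is
  irrelevant.\<close>

definition shift_inv :: "(int \<Rightarrow> int) \<Rightarrow> int \<Rightarrow> (int \<times> int) set \<Rightarrow> int \<Rightarrow> (int \<Rightarrow> int) \<Rightarrow> bool" where
  "shift_inv m x Q j m' \<longleftrightarrow> 0 \<le> j \<and> j < x \<and> ar m' 31 vj = j \<and>
     (\<forall>i. j < i \<longrightarrow> i < x \<longrightarrow> opp x < ar m cS i) \<and>
     (\<forall>i. 0 \<le> i \<longrightarrow> i \<le> j \<longrightarrow> ar m' cS i = ar m cS i) \<and>
     (\<forall>i. j + 1 < i \<longrightarrow> i \<le> x \<longrightarrow> ar m' cS i = ar m cS (i - 1)) \<and>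
     arcs_ok (Q \<union> (\<Union>i\<in>{j<..<x}. {(ar m cYV (ar m cS i), owner x), (owner x, ar m cYV (ar m cS i))})) m' \<and>
     same m m' {cS, cM, cDeg, cAdj} {vu, vq, vj}"

lemma insert_body_ok:
  assumes inp: "input_ok m" and x: "x \<in> {1..2 * n}"
    and vars: "ar m 31 vv = owner x" "ar m 31 vy = opp x"
    and own: "\<And>i. 1 \<le> i \<Longrightarrow> i < x \<Longrightarrow> ar m cYV (ar m cS i) \<in> {0..<n}"
    and S0: "ar m cS 0 = 0"
    and inv: "shift_inv m x Q j m'" and guard: "opp x < ar m cS j"
  shows "shift_inv m x Q (j - 1) (sem insert_body m')"
proof -
  note I = inv[unfolded shift_inv_def]
  have v: "owner x \<in> {0..<n}" using x x_cases by blast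
  \<comment> \<open>With the sentinel this excludes \<open>j = 0\<close>, so the entry compared
    belongs to an earlier point.\<close>
  have "0 < opp x" using x_cases[OF x] y_range y12 by (metis zless_add1_eq less_le_trans zero_less_one_class.zero_less_one less_trans)
  then have j: "1 \<le> j" "j < x" using I guard S0 by (cases "j = 0"; force)+
  define u where "u = ar m cYV (ar m cS j)"
  have u: "u \<in> {0..<n}" unfolding u_def using own j by blast
  have same0: "same m m' {cS, cM, cDeg, cAdj} {vu, vq, vj}" using I by blast
  have m'_vars: "ar m' 31 vv = owner x" "ar m' 31 vy = opp x" "ar m' 31 vj = j" "ar m' cYV = ar m cYV"
    "ar m' cS j = ar m cS j"
    using sameD1[OF same0, of vv] sameD1[OF same0, of vy] sameD[OF same0, of cYV] vars I j by auto
  let ?N = "Q \<union> (\<Union>i\<in>{j<..<x}. {(ar m cYV (ar m cS i), owner x), (owner x, ar m cYV (ar m cS i))})"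
  have inp': "input_ok m'" by (rule input_ok_same[OF inp same0]) auto
  define m1 where "m1 = m'(loc 31 vu := u)"
  have s1: "same m' m1 {} {vu}" by (simp add: m1_def)
  have inp1: "input_ok m1" by (rule input_ok_same[OF inp' s1]) auto
  have arcs1: "arcs_ok ?N m1" using arcs_ok_same[OF _ s1] I by simp
  have m1_vars: "ar m1 31 vu = u" "ar m1 31 vv = owner x" using m'_vars by (simp_all add: m1_def)
  define m2 where "m2 = sem (add_arc vu vv) m1"
  note 2 = add_arc_sem[OF inp1 arcs1 u v m1_vars, simplified, folded m2_def]
  have inp2: "input_ok m2" by (rule input_ok_same[OF inp1 2(2)]) auto
  have m2_vars: "ar m2 31 vu = u" "ar m2 31 vv = owner x" using m1_vars sameD1[OF 2(2)] by simp_all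
  define m3 where "m3 = sem (add_arc vv vu) m2"
  note 3 = add_arc_sem[OF inp2 2(1) v u m2_vars(2,1), simplified, folded m3_def]
  have s3: "same m' m3 {cM, cDeg, cAdj} {vu, vq}"
    by (rule same_trans[OF s1 same_trans[OF 2(2) 3(2), of "{cM, cDeg, cAdj}" "{vq}"]]) auto
  have m3_vars: "ar m3 31 vj = j" "ar m3 cS = ar m' cS"
    using sameD1[OF s3, of vj] sameD[OF s3, of cS] m'_vars by auto
  define m4 where "m4 = m3(loc cS (j + 1) := ar m cS j, loc 31 vj := j - 1)"
  have sem: "sem insert_body m' = m4"
    using m'_vars m3_vars by (simp add: insert_body_def m4_def m3_def m2_def m1_def u_def)
  have s4: "same m3 m4 {cS} {vj}" by (simp add: m4_def)
  have same4: "same m m4 {cS, cM, cDeg, cAdj} {vu, vq, vj}"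
    by (rule same_trans[OF same_trans[OF same0 s3, of "{cS, cM, cDeg, cAdj}" "{vu, vq, vj}"] s4]) auto
  have "{j - 1<..<x} = insert j {j<..<x}" using j by auto
  then have N': "Q \<union> (\<Union>i\<in>{j - 1<..<x}. {(ar m cYV (ar m cS i), owner x), (owner x, ar m cYV (ar m cS i))}) =
      insert (owner x, u) (insert (u, owner x) ?N)"
    by (auto simp: u_def)
  have arcs4: "arcs_ok (insert (owner x, u) (insert (u, owner x) ?N)) m4"
    by (rule arcs_ok_same[OF 3(1) s4]) auto
  have m4S: "ar m4 cS i = (if i = j + 1 then ar m cS j else ar m' cS i)" for i
    using m3_vars by (simp add: m4_def)
  show ?thesis
    unfolding shift_inv_def sem N'
  proof (intro conjI allI impI)
    show "0 \<le> j - 1" "j - 1 < x" using j by auto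
    show "ar m4 31 vj = j - 1" by (simp add: m4_def)
    show "arcs_ok (insert (owner x, u) (insert (u, owner x) ?N)) m4" by (fact arcs4)
    show "same m m4 {cS, cM, cDeg, cAdj} {vu, vq, vj}" by (fact same4)
  next
    fix i assume "j - 1 < i" "i < x"
    then show "opp x < ar m cS i" using I guard by (cases "i = j") auto
  next
    fix i assume "0 \<le> i" "i \<le> j - 1"
    then show "ar m4 cS i = ar m cS i" using I m4S[of i] by auto
  next
    fix i assume "j - 1 + 1 < i" "i \<le> x"
    then show "ar m4 cS i = ar m cS (i - 1)" using I m4S[of i] by (cases "i = j + 1") auto
  qed
qed

definition ins_const :: nat where "ins_const = 1000"

text \<open>There is one round per larger entry among the first \<open>x - 1\<close>, that is, per
  inversion with \<open>x\<close>, hence at most \<open>2 * deg (owner x)\<close> rounds. The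
  summand 1 leaves room for the final guard.\<close>

lemma insert_loop_ok:
  assumes inp: "input_ok m" and arcs: "arcs_ok Q m" and x: "x \<in> {1..2 * n}"
    and vars: "ar m 31 vv = owner x" "ar m 31 vy = opp x" "ar m 31 vj = x - 1"
    and S0: "ar m cS 0 = 0"
    and sorted: "\<And>i i'. 1 \<le> i \<Longrightarrow> i < i' \<Longrightarrow> i' < x \<Longrightarrow> ar m cS i < ar m cS i'"
    and S: "ar m cS ` {1..<x} = opp ` {1..<x}"
  shows "hr insert_loop m (ins_const * (2 * deg (owner x) + 1))
    (\<lambda>m'. \<exists>j. shift_inv m x Q j m' \<and> ar m cS j \<le> opp x)"
proof -
  have v: "owner x \<in> {0..<n}" using x x_cases by blast
  have yv: "ar m cYV (opp a) = owner a \<and> owner a \<in> {0..<n}" if "a \<in> {1..2 * n}" for a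
    by (rule x_cases[OF that]) (use inp in \<open>auto simp: input_ok_def\<close>)
  have own: "ar m cYV (ar m cS i) \<in> {0..<n}" if "1 \<le> i" "i < x" for i
  proof -
    have "ar m cS i \<in> opp ` {1..<x}" using S that by (metis atLeastLessThan_iff image_eqI)
    then show ?thesis using yv x by auto
  qed
  define big where "big j = {i \<in> {1..j}. opp x < ar m cS i}" for j
  have fin: "finite (big j)" for j by (simp add: big_def)
  have big_le: "card (big (x - 1)) \<le> 2 * deg (owner x)"
  proof -
    have "inj_on (ar m cS) (big (x - 1))"
    proof (rule inj_onI, rule ccontr)
      fix i i' assume *: "i \<in> big (x - 1)" "i' \<in> big (x - 1)" "ar m cS i = ar m cS i'" "i \<noteq> i'"
      then show False using sorted[of i i'] sorted[of i' i] by (cases "i < i'") (auto simp: big_def)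
    qed
    then have "card (big (x - 1)) = card (ar m cS ` big (x - 1))" by (simp add: card_image)
    also have "\<dots> \<le> card (opp ` {a \<in> {1..2 * n}. meets (owner a) (owner x)})"
    proof (intro card_mono)
      show "ar m cS ` big (x - 1) \<subseteq> opp ` {a \<in> {1..2 * n}. meets (owner a) (owner x)}"
      proof
        fix z assume "z \<in> ar m cS ` big (x - 1)"
        then have z: "z \<in> ar m cS ` {1..<x}" "opp x < z" by (auto simp: big_def)
        then obtain a where a: "a \<in> {1..<x}" "z = opp a" using S by auto
        then have "meets (owner a) (owner x)" using inversion_meets[of a x] x z by auto
        then show "z \<in> opp ` {a \<in> {1..2 * n}. meets (owner a) (owner x)}" using a x by auto
      qed
    qed auto
    also have "\<dots> \<le> card {a \<in> {1..2 * n}. meets (owner a) (owner x)}" by (intro card_image_le) auto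
    also have "\<dots> \<le> 2 * deg (owner x)" by (rule card_inversions_le[OF v])
    finally show ?thesis .
  qed
  show ?thesis
    unfolding insert_loop_def
  proof (rule hr_While[where I = "\<lambda>m'. shift_inv m x Q (ar m' 31 vj) m'"
        and pot = "\<lambda>m'. ins_const * card (big (ar m' 31 vj))"])
    have x1: "1 \<le> x" using x by simp
    have "{x - 1<..<x} = {}" by auto
    then show "shift_inv m x Q (ar m 31 vj) m" using vars(3) arcs x1 by (simp add: shift_inv_def)
  next
    fix m' assume inv: "shift_inv m x Q (ar m' 31 vj) m'" and g: "0 < aval (Minus (Ix cS (V vj)) (V vy)) m'"
    define j where "j = ar m' 31 vj"
    have same0: "same m m' {cS, cM, cDeg, cAdj} {vu, vq, vj}" using inv by (simp add: shift_inv_def)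
    have y: "ar m' 31 vy = opp x" using vars(2) sameD1[OF same0, of vy] by simp
    have jx: "0 \<le> j" "j < x" "ar m' cS j = ar m cS j" using inv by (auto simp: shift_inv_def j_def)
    then have guard: "opp x < ar m cS j" using g y by (simp add: j_def)
    have next_inv: "shift_inv m x Q (j - 1) (sem insert_body m')"
      using insert_body_ok[OF inp x vars(1,2) own S0 inv[folded j_def] guard] .
    then have j': "ar (sem insert_body m') 31 vj = j - 1" "0 \<le> j - 1" by (auto simp: shift_inv_def)
    have "big j = insert j (big (j - 1))" using guard j' by (auto simp: big_def)
    moreover have "j \<notin> big (j - 1)" by (simp add: big_def)
    ultimately have "card (big j) = Suc (card (big (j - 1)))" using fin by simp
    moreover have "csize insert_body \<le> 500" "loopfree insert_body"
      by (simp_all add: insert_body_def add_arc_def)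
    ultimately show "\<exists>T. hr insert_body m' T (\<lambda>m''. shift_inv m x Q (ar m'' 31 vj) m'' \<and>
          ecost (Minus (Ix cS (V vj)) (V vy)) + 3 + T + ins_const * card (big (ar m'' 31 vj)) \<le> ins_const * card (big (ar m' 31 vj)))"
      using next_inv j' by (intro exI[of _ 500] hr_loopfree) (auto simp: ins_const_def j_def)
  next
    fix m' assume inv: "shift_inv m x Q (ar m' 31 vj) m'" and g: "aval (Minus (Ix cS (V vj)) (V vy)) m' \<le> 0"
    have same0: "same m m' {cS, cM, cDeg, cAdj} {vu, vq, vj}" using inv by (simp add: shift_inv_def)
    have y: "ar m' 31 vy = opp x" using vars(2) sameD1[OF same0, of vy] by simp
    have "ar m' cS (ar m' 31 vj) = ar m cS (ar m' 31 vj)" using inv by (auto simp: shift_inv_def)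
    then show "\<exists>j. shift_inv m x Q j m' \<and> ar m cS j \<le> opp x"
      using inv g y by (intro exI[of _ "ar m' 31 vj"]) auto
  next
    show "ins_const * card (big (ar m 31 vj)) + ecost (Minus (Ix cS (V vj)) (V vy)) + 1
        \<le> ins_const * (2 * deg (owner x) + 1)"
      using big_le vars(3) by (simp add: ins_const_def)
  qed
qed

definition inv_pairs :: "int \<Rightarrow> (int \<times> int) set" where
  "inv_pairs x = {(u, v). \<exists>a b. 1 \<le> a \<and> a < b \<and> b < x \<and> opp b < opp a \<and>
     (u = owner a \<and> v = owner b \<or> u = owner b \<and> v = owner a)}"

lemma inv_pairs_step:
  "inv_pairs (x + 1) = inv_pairs x \<union>
     (\<Union>a\<in>{a. 1 \<le> a \<and> a < x \<and> opp x < opp a}. {(owner a, owner x), (owner x, owner a)})"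
proof (intro equalityI subsetI)
  fix e assume "e \<in> inv_pairs (x + 1)"
  then obtain a b where ab: "1 \<le> a" "a < b" "b < x + 1" "opp b < opp a"
    "e = (owner a, owner b) \<or> e = (owner b, owner a)" by (auto simp: inv_pairs_def)
  show "e \<in> inv_pairs x \<union> (\<Union>a\<in>{a. 1 \<le> a \<and> a < x \<and> opp x < opp a}. {(owner a, owner x), (owner x, owner a)})"
  proof (cases "b = x")
    case False
    then have "b < x" using ab by simp
    then have "e \<in> inv_pairs x" unfolding inv_pairs_def using ab by blast
    then show ?thesis by blast
  qed (use ab in blast)
next
  fix e assume e: "e \<in> inv_pairs x \<union> (\<Union>a\<in>{a. 1 \<le> a \<and> a < x \<and> opp x < opp a}. {(owner a, owner x), (owner x, owner a)})"
  then consider "e \<in> inv_pairs x"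
    | a where "1 \<le> a" "a < x" "opp x < opp a" "e = (owner a, owner x) \<or> e = (owner x, owner a)" by blast
  then show "e \<in> inv_pairs (x + 1)"
  proof cases
    case 1
    then obtain a b where "1 \<le> a" "a < b" "b < x" "opp b < opp a"
      "e = (owner a, owner b) \<or> e = (owner b, owner a)" by (auto simp: inv_pairs_def)
    moreover then have "b < x + 1" by simp
    ultimately show ?thesis unfolding inv_pairs_def by blast
  next
    case 2
    moreover have "x < x + 1" by simp
    ultimately show ?thesis unfolding inv_pairs_def by blast
  qed
qed

lemma inv_pairs_final: "inv_pairs (2 * n + 1) = {(u, v). meets u v}"
proof (intro equalityI subsetI)
  fix e assume "e \<in> inv_pairs (2 * n + 1)"
  then show "e \<in> {(u, v). meets u v}"
    using inversion_meets meets_sym by (fastforce simp: inv_pairs_def)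
next
  fix e assume "e \<in> {(u, v). meets u v}"
  then obtain u v where e: "e = (u, v)" "meets u v" by blast
  from meets_inversion[OF e(2)] obtain a b where "1 \<le> a" "a < b" "b < 2 * n + 1" "opp b < opp a"
    "owner a = u \<and> owner b = v \<or> owner a = v \<and> owner b = u" by auto
  then show "e \<in> inv_pairs (2 * n + 1)" unfolding inv_pairs_def e(1) by blast
qed

definition arcs_inv :: "(int \<Rightarrow> int) \<Rightarrow> int \<Rightarrow> (int \<Rightarrow> int) \<Rightarrow> bool" where
  "arcs_inv m x m' \<longleftrightarrow> 1 \<le> x \<and> x \<le> 2 * n + 1 \<and> ar m' 31 vx = x \<and> ar m' cS 0 = 0 \<and>
     (\<forall>i i'. 1 \<le> i \<longrightarrow> i < i' \<longrightarrow> i' < x \<longrightarrow> ar m' cS i < ar m' cS i') \<and>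
     ar m' cS ` {1..<x} = opp ` {1..<x} \<and>
     arcs_ok (inv_pairs x) m' \<and>
     same m m' {cS, cM, cDeg, cAdj} {vx, vv, vy, vu, vq, vj}"

text \<open>Writing \<open>opp x\<close> into the hole restores a sorted list with one more point.
  The entries that were shifted are exactly the earlier values exceeding \<open>opp x\<close>, so
  their owners give the arcs required by \<open>inv_pairs_step\<close>.\<close>

lemma arcs_post_ok:
  assumes inv: "arcs_inv m x m0" and x: "x \<in> {1..2 * n}" and inp: "input_ok m0"
    and S: "ar m' cS = ar m0 cS" "ar m' cYV = ar m0 cYV"
    and sh: "shift_inv m' x (inv_pairs x) j m''" and le: "ar m' cS j \<le> opp x"
    and same0: "same m0 m' {} {vv, vy, vj}" and vars: "ar m' 31 vy = opp x"
  shows "arcs_inv m (x + 1) (sem arcs_post m'')"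
proof -
  note I = inv[unfolded arcs_inv_def]
  note H = sh[unfolded shift_inv_def]
  define S0 where "S0 = ar m0 cS"
  have j: "0 \<le> j" "j < x" "ar m'' 31 vj = j" using H by auto
  have sameH: "same m' m'' {cS, cM, cDeg, cAdj} {vu, vq, vj}" using H by blast
  have same1: "same m0 m'' {cS, cM, cDeg, cAdj} {vv, vy, vu, vq, vj}"
    by (rule same_trans[OF same0 sameH]) auto
  have vars'': "ar m'' 31 vy = opp x" "ar m'' 31 vx = x"
    using sameD1[OF sameH, of vy] sameD1[OF same1, of vx] vars I by auto
  define m4 where "m4 = m''(loc cS (j + 1) := opp x, loc 31 vx := x + 1)"
  have sem: "sem arcs_post m'' = m4" using j vars'' by (simp add: arcs_post_def m4_def)
  have s4: "same m'' m4 {cS} {vx}" by (simp add: m4_def)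
  have m4S: "ar m4 cS i = (if i = j + 1 then opp x else ar m'' cS i)" for i by (simp add: m4_def)
  have S1: "ar m4 cS i = S0 i" if "0 \<le> i" "i \<le> j" for i
    using that H S m4S[of i] by (auto simp: S0_def)
  have S2: "ar m4 cS (j + 1) = opp x" using m4S by simp
  have S3: "ar m4 cS i = S0 (i - 1)" if "j + 1 < i" "i \<le> x" for i
    using that H S m4S[of i] by (auto simp: S0_def)
  have big: "opp x < S0 i" if "j < i" "i < x" for i using H S that by (auto simp: S0_def)
  have srt: "S0 i < S0 i'" if "1 \<le> i" "i < i'" "i' < x" for i i' using I that by (auto simp: S0_def)
  have img: "S0 ` {1..<x} = opp ` {1..<x}" using I by (simp add: S0_def)
  have small: "S0 i < opp x" if "1 \<le> i" "i \<le> j" for i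
  proof -
    have "S0 i \<le> S0 j" using srt[of i j] that j by (cases "i = j") auto
    then have "S0 i \<le> opp x" using le S by (simp add: S0_def)
    \<comment> \<open>The loop only guarantees a weak inequality; it becomes strict because
      \<open>opp\<close> is injective and \<open>S0 i\<close> is a value at an earlier
      point.\<close>
    moreover have "S0 i \<in> opp ` {1..<x}" using img that j by (metis atLeastLessThan_iff image_eqI le_less_trans)
    then obtain a where "S0 i = opp a" "1 \<le> a" "a < x" by auto
    then have "S0 i \<noteq> opp x" using inj_onD[OF opp_inj, of a x] x by auto
    ultimately show ?thesis by simp
  qed
  have sorted: "ar m4 cS i < ar m4 cS i'" if h: "1 \<le> i" "i < i'" "i' < x + 1" for i i'
  proof -
    consider "i' \<le> j" | "i \<le> j" "i' = j + 1" | "i \<le> j" "j + 1 < i'" | "i = j + 1" "j + 1 < i'" | "j + 1 < i"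
      using h by linarith
    then show ?thesis
    proof cases
      case 1
      then show ?thesis using h S1[of i] S1[of i'] srt[of i i'] j by auto
    next
      case 2
      then show ?thesis using h S1[of i] S2 small[of i] by auto
    next
      case 3
      then show ?thesis using h S1[of i] S3[of i'] srt[of i "i' - 1"] by auto
    next
      case 4
      then show ?thesis using h S2 S3[of i'] big[of "i' - 1"] by auto
    next
      case 5
      then show ?thesis using h S3[of i] S3[of i'] srt[of "i - 1" "i' - 1"] j by auto
    qed
  qed
  have image: "ar m4 cS ` {1..<x + 1} = opp ` {1..<x + 1}"
  proof -
    have "{1..<x + 1} = {1..j} \<union> {j + 1} \<union> (\<lambda>i. i + 1) ` {j + 1..<x}"
      using j by (auto simp: image_iff)
    then have "ar m4 cS ` {1..<x + 1} = ar m4 cS ` {1..j} \<union> {opp x} \<union> (\<lambda>i. ar m4 cS (i + 1)) ` {j + 1..<x}"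
      by (simp only: image_Un image_image image_insert image_empty S2)
    also have "ar m4 cS ` {1..j} = S0 ` {1..j}" using S1 by (intro image_cong) auto
    also have "(\<lambda>i. ar m4 cS (i + 1)) ` {j + 1..<x} = S0 ` {j + 1..<x}" using S3 by (intro image_cong) auto
    also have "S0 ` {1..j} \<union> {opp x} \<union> S0 ` {j + 1..<x} = insert (opp x) (S0 ` ({1..j} \<union> {j + 1..<x}))" by auto
    also have "{1..j} \<union> {j + 1..<x} = {1..<x}" using j by auto
    also have "insert (opp x) (S0 ` {1..<x}) = opp ` (insert x {1..<x})" using img by simp
    also have "insert x {1..<x} = {1..<x + 1}" using x by auto
    finally show ?thesis .
  qed
  have yv: "ar m0 cYV (opp a) = owner a" if "a \<in> {1..2 * n}" for a
    by (rule x_cases[OF that]) (use inp in \<open>auto simp: input_ok_def\<close>)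
  have own: "(\<lambda>i. ar m0 cYV (S0 i)) ` {j<..<x} = owner ` {a. 1 \<le> a \<and> a < x \<and> opp x < opp a}"
  proof (intro equalityI subsetI)
    fix w assume "w \<in> (\<lambda>i. ar m0 cYV (S0 i)) ` {j<..<x}"
    then obtain i where i: "j < i" "i < x" "w = ar m0 cYV (S0 i)" by auto
    then have "S0 i \<in> opp ` {1..<x}" using img j by (metis atLeastLessThan_iff image_eqI le_less_trans int_one_le_iff_zero_less)
    then obtain a where a: "1 \<le> a" "a < x" "S0 i = opp a" by auto
    then show "w \<in> owner ` {a. 1 \<le> a \<and> a < x \<and> opp x < opp a}" using i big[of i] yv[of a] x by auto
  next
    fix w assume "w \<in> owner ` {a. 1 \<le> a \<and> a < x \<and> opp x < opp a}"
    then obtain a where a: "1 \<le> a" "a < x" "opp x < opp a" "w = owner a" by auto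
    then have "opp a \<in> S0 ` {1..<x}" using img by auto
    then obtain i where i: "1 \<le> i" "i < x" "S0 i = opp a" by force
    then have "j < i" using small[of i] a by force
    then show "w \<in> (\<lambda>i. ar m0 cYV (S0 i)) ` {j<..<x}" using i a yv[of a] x by force
  qed
  have "(\<Union>i\<in>{j<..<x}. {(ar m' cYV (ar m' cS i), owner x), (owner x, ar m' cYV (ar m' cS i))}) =
      (\<Union>u\<in>(\<lambda>i. ar m0 cYV (S0 i)) ` {j<..<x}. {(u, owner x), (owner x, u)})"
    using S by (simp add: S0_def)
  also have "\<dots> = (\<Union>a\<in>{a. 1 \<le> a \<and> a < x \<and> opp x < opp a}. {(owner a, owner x), (owner x, owner a)})"
    unfolding own by simp
  finally have "arcs_ok (inv_pairs (x + 1)) m''" using H by (simp add: inv_pairs_step)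
  then have arcs: "arcs_ok (inv_pairs (x + 1)) m4" by (rule arcs_ok_same[OF _ s4]) auto
  have s04: "same m0 m4 {cS, cM, cDeg, cAdj} {vx, vv, vy, vu, vq, vj}"
    by (rule same_trans[OF same1 s4]) auto
  have "same m m0 {cS, cM, cDeg, cAdj} {vx, vv, vy, vu, vq, vj}" using I by blast
  then have "same m m4 {cS, cM, cDeg, cAdj} {vx, vv, vy, vu, vq, vj}"
    by (rule same_trans[OF _ s04]) auto
  moreover have "ar m4 cS 0 = 0" using S1[of 0] j I by (simp add: S0_def)
  ultimately show ?thesis
    unfolding arcs_inv_def sem using sorted image arcs x by (simp add: m4_def)
qed

lemma arcs_body_ok:
  assumes inp: "input_ok m" and inv: "arcs_inv m x m0" and x: "x \<in> {1..2 * n}"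
  shows "hr arcs_body m0 (2200 * (deg (owner x) + 1)) (arcs_inv m (x + 1))"
proof -
  note I = inv[unfolded arcs_inv_def]
  have same0: "same m m0 {cS, cM, cDeg, cAdj} {vx, vv, vy, vu, vq, vj}" using I by blast
  have inp0: "input_ok m0" by (rule input_ok_same[OF inp same0]) auto
  have v: "owner x \<in> {0..<n}" using x x_cases by blast
  define m1 where "m1 = m0(loc 31 vv := owner x, loc 31 vy := opp x, loc 31 vj := x - 1)"
  have "ar m0 cXV x = owner x" "ar m0 cX2 (owner x) = x2 (owner x)" "ar m0 cY1 (owner x) = y1 (owner x)"
    "ar m0 cY2 (owner x) = y2 (owner x)"
    using inp0 x v by (auto simp: input_ok_def)
  then have pre: "sem arcs_pre m0 = m1"
    using I by (simp add: arcs_pre_def m1_def opp_def)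
  have s1: "same m0 m1 {} {vv, vy, vj}" by (simp add: m1_def)
  have inp1: "input_ok m1" by (rule input_ok_same[OF inp0 s1]) auto
  have arcs1: "arcs_ok (inv_pairs x) m1" using I by (intro arcs_ok_same[OF _ s1]) auto
  have vars1: "ar m1 31 vv = owner x" "ar m1 31 vy = opp x" "ar m1 31 vj = x - 1" by (simp_all add: m1_def)
  have S1: "ar m1 cS = ar m0 cS" "ar m1 cYV = ar m0 cYV" by (simp_all add: m1_def)
  have loop: "hr insert_loop m1 (ins_const * (2 * deg (owner x) + 1))
      (\<lambda>m'. \<exists>j. shift_inv m1 x (inv_pairs x) j m' \<and> ar m1 cS j \<le> opp x)"
    using I by (intro insert_loop_ok[OF inp1 arcs1 x vars1]) (auto simp: S1)
  have post: "hr arcs_post m' 100 (arcs_inv m (x + 1))"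
    if "\<exists>j. shift_inv m1 x (inv_pairs x) j m' \<and> ar m1 cS j \<le> opp x" for m'
  proof -
    from that obtain j where "shift_inv m1 x (inv_pairs x) j m'" "ar m1 cS j \<le> opp x" by blast
    then have "arcs_inv m (x + 1) (sem arcs_post m')"
      by (rule arcs_post_ok[OF inv x inp0 S1 _ _ s1 vars1(2)])
    then show ?thesis by (intro hr_loopfree) (simp_all add: arcs_post_def)
  qed
  have "hr (insert_loop ;; arcs_post) m1 (ins_const * (2 * deg (owner x) + 1) + 100) (arcs_inv m (x + 1))"
    by (rule hr_Seq[OF hr_weaken[OF loop order_refl post]]) auto
  then have "hr arcs_pre m0 100
      (\<lambda>m'. hr (insert_loop ;; arcs_post) m' (ins_const * (2 * deg (owner x) + 1) + 100) (arcs_inv m (x + 1)))"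
    by - (rule hr_loopfree, simp_all only: pre, simp_all add: arcs_pre_def)
  then show ?thesis
    unfolding arcs_body_def by (rule hr_Seq) (simp add: ins_const_def)
qed

lemma arcs_loop_ok:
  assumes inp: "input_ok m" and x: "ar m 31 vx = 1"
    and zero: "ar m cS 0 = 0" "\<And>i. 0 \<le> i \<Longrightarrow> ar m cM i = 0" "\<And>i. 0 \<le> i \<Longrightarrow> ar m cDeg i = 0"
  shows "hr arcs_loop m (2300 * (4 * card edges + 4 * nat n) + 100)
    (\<lambda>m'. arcs_ok {(u, v). meets u v} m' \<and> same m m' {cS, cM, cDeg, cAdj} {vx, vv, vy, vu, vq, vj})"
  unfolding arcs_loop_def
proof (rule hr_While[where I = "\<lambda>m'. arcs_inv m (ar m' 31 vx) m'"
      and pot = "\<lambda>m'. \<Sum>a\<in>{ar m' 31 vx..2 * n}. 2300 * (deg (owner a) + 1)"])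
  have "inv_pairs 1 = {}" by (auto simp: inv_pairs_def)
  moreover have "0 \<le> n * u + v" if "0 \<le> u" "0 \<le> v" for u v using that n_nonneg by simp
  ultimately have "arcs_ok (inv_pairs 1) m" using zero by (auto simp: arcs_ok_def bij_betw_def)
  then show "arcs_inv m (ar m 31 vx) m" using x zero n_nonneg by (simp add: arcs_inv_def)
next
  fix m' assume inv: "arcs_inv m (ar m' 31 vx) m'" and g: "0 < aval (Minus (Plus (Plus (V vn) (V vn)) (N 1)) (V vx)) m'"
  define x where "x = ar m' 31 vx"
  have "same m m' {cS, cM, cDeg, cAdj} {vx, vv, vy, vu, vq, vj}" using inv by (simp add: arcs_inv_def)
  then have "ar m' 31 vn = n" using sameD1[of m m' _ _ vn] inp by (auto simp: input_ok_def)
  then have xr: "x \<in> {1..2 * n}" using g inv by (auto simp: arcs_inv_def x_def)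
  have step: "hr arcs_body m' (2200 * (deg (owner x) + 1)) (arcs_inv m (x + 1))"
    using arcs_body_ok[OF inp _ xr] inv by (simp add: x_def)
  have "{x..2 * n} = insert x {x + 1..2 * n}" using xr by auto
  then have "(\<Sum>a\<in>{x..2 * n}. 2300 * (deg (owner a) + 1)) =
      2300 * (deg (owner x) + 1) + (\<Sum>a\<in>{x + 1..2 * n}. 2300 * (deg (owner a) + 1))" by simp
  then have "hr arcs_body m' (2200 * (deg (owner x) + 1)) (\<lambda>m''. arcs_inv m (ar m'' 31 vx) m'' \<and>
          ecost (Minus (Plus (Plus (V vn) (V vn)) (N 1)) (V vx)) + 3 + 2200 * (deg (owner x) + 1) +
          (\<Sum>a\<in>{ar m'' 31 vx..2 * n}. 2300 * (deg (owner a) + 1))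
          \<le> (\<Sum>a\<in>{ar m' 31 vx..2 * n}. 2300 * (deg (owner a) + 1)))"
    by (intro hr_weaken[OF step]) (auto simp: arcs_inv_def x_def)
  then show "\<exists>T. hr arcs_body m' T (\<lambda>m''. arcs_inv m (ar m'' 31 vx) m'' \<and>
          ecost (Minus (Plus (Plus (V vn) (V vn)) (N 1)) (V vx)) + 3 + T +
          (\<Sum>a\<in>{ar m'' 31 vx..2 * n}. 2300 * (deg (owner a) + 1))
          \<le> (\<Sum>a\<in>{ar m' 31 vx..2 * n}. 2300 * (deg (owner a) + 1)))" by blast
next
  fix m' assume inv: "arcs_inv m (ar m' 31 vx) m'" and g: "aval (Minus (Plus (Plus (V vn) (V vn)) (N 1)) (V vx)) m' \<le> 0"
  have same: "same m m' {cS, cM, cDeg, cAdj} {vx, vv, vy, vu, vq, vj}" using inv by (simp add: arcs_inv_def)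
  then have "ar m' 31 vn = n" using sameD1[of m m' _ _ vn] inp by (auto simp: input_ok_def)
  then have "ar m' 31 vx = 2 * n + 1" using g inv by (auto simp: arcs_inv_def)
  then have "arcs_ok (inv_pairs (2 * n + 1)) m'" using inv by (auto simp: arcs_inv_def)
  then show "arcs_ok {(u, v). meets u v} m' \<and> same m m' {cS, cM, cDeg, cAdj} {vx, vv, vy, vu, vq, vj}"
    using same by (simp add: inv_pairs_final)
next
  \<comment> \<open>Every vertex owns two points and the closed degrees sum to 2m + n. One further
    unit for each of the 2n points makes 4m + 4n.\<close>
  have "(\<Sum>a\<in>{1..2 * n}. deg (owner a)) = 4 * card edges + 2 * nat n"
    using sum_deg_owner sum_deg by simp
  moreover have "card {1..2 * n} = 2 * nat n" by simp
  ultimately have "(\<Sum>a\<in>{1..2 * n}. deg (owner a) + 1) = 4 * card edges + 4 * nat n"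
    by (simp only: sum.distrib sum_constant) simp
  then show "(\<Sum>a\<in>{ar m 31 vx..2 * n}. 2300 * (deg (owner a) + 1)) +
      ecost (Minus (Plus (Plus (V vn) (V vn)) (N 1)) (V vx)) + 1 \<le> 2300 * (4 * card edges + 4 * nat n) + 100"
    by (simp only: x sum_distrib_left[symmetric]) simp
qed

definition graph_ok :: "(int \<Rightarrow> int) \<Rightarrow> bool" where
  "graph_ok m \<longleftrightarrow> (\<forall>v\<in>{0..<n}. ar m cDeg v = int (deg v) \<and>
     bij_betw (\<lambda>i. ar m cAdj (n * v + i)) {0..<int (deg v)} (nbrs v))"

lemma arcs_ok_graph_ok: "arcs_ok {(u, v). meets u v} m \<Longrightarrow> graph_ok m"
proof -
  assume *: "arcs_ok {(u, v). meets u v} m"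
  have "{(u, v). meets u v} `` {v} = nbrs v" for v by (auto simp: nbrs_def)
  then show ?thesis using * unfolding arcs_ok_def graph_ok_def deg_def by metis
qed

lemma graph_ok_same:
  assumes "graph_ok m" "same m m' A X" "A \<inter> {11..12} = {}"
  shows "graph_ok m'"
proof -
  have "ar m' c = ar m c" if "c \<in> {11..12}" for c
  proof -
    have "c \<notin> A" using assms(3) that by blast
    then show ?thesis using sameD[OF assms(2), of c] that by auto
  qed
  then have eq: "ar m' 11 = ar m 11" "ar m' 12 = ar m 12" by simp_all
  show ?thesis using assms(1) unfolding graph_ok_def eq .
qed

end

section \<open>The sweep\<close>

definition upd_body :: "int \<Rightarrow> com" where
  "upd_body \<delta> =
     Asg vc (Ix cAdj (V vs)) ;;
     Asg vs (Plus (V vs) (N 1)) ;;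
     Cond (Minus (Ix cY2 (V vo)) (Ix cY1 (V vc))) (Put cD (V vc) (Plus (Ix cD (V vc)) (N \<delta>))) Skip"

definition upd_pre :: com where
  "upd_pre = Asg vs (Ix cRow (V vo)) ;; Asg vse (Plus (V vs) (Ix cDeg (V vo)))"

definition upd :: "int \<Rightarrow> com" where
  "upd \<delta> = upd_pre ;; While (Minus (V vse) (V vs)) (upd_body \<delta>)"

text \<open>A neighbour with larger \<open>x1\<close> is the second end vertex of an edge whose box
  begins at the sweep line; the other neighbours belong to edges labelled earlier.\<close>

definition label_body :: com where
  "label_body =
     Asg vb (Ix cAdj (V vp)) ;;
     Asg vp (Plus (V vp) (N 1)) ;;
     Cond (Minus (Ix cX1 (V vb)) (V vx))
       (Cond (Minus (Ix cD (V vb)) (Ix cD (V vv)))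
          (Asg vl (Minus (V vk) (Ix cD (V vb))))
          (Asg vl (Minus (V vk) (Ix cD (V vv)))) ;;
        Asg vq (Plus (Ix cRow (V vv)) (V vb)) ;;
        Put cLam (V vq) (Plus (V vl) (N 1)) ;;
        Put cPrd (V vq) (Ix cBE (V vl)) ;;
        Put cEU (V vq) (V vv) ;;
        Put cEW (V vq) (V vb))
       Skip"

definition record_pre :: com where
  "record_pre = Put cBE (V vl) (V vq) ;; Put cBO (V vl) (V vw) ;; Asg vo (V vw)"

definition record_edge :: com where
  "record_edge = record_pre ;; upd 1"

definition push_pre :: com where
  "push_pre =
     Cond (Minus (Ix cX1 (V vb)) (Ix cX1 (V vv)))
       (Asg vq (Plus (Ix cRow (V vv)) (V vb)))
       (Asg vq (Plus (Ix cRow (V vb)) (V vv))) ;;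
     Asg vl (Ix cLam (V vq)) ;;
     Cond (Minus (Ix cY2 (V vb)) (Ix cY2 (V vv))) (Asg vw (V vb)) (Asg vw (V vv))"

text \<open>Before a corner is replaced, its contribution to the counters is withdrawn; a newly
  opened level has nothing to withdraw.\<close>

definition push_edge :: com where
  "push_edge =
     push_pre ;;
     Cond (Minus (V vl) (V vk))
       (Asg vk (V vl) ;; record_edge)
       (Cond (Minus (Ix cY2 (Ix cBO (V vl))) (Ix cY2 (V vw)))
          (Asg vo (Ix cBO (V vl)) ;; upd (- 1) ;; record_edge)
          Skip)"

definition push_body :: com where
  "push_body =
     (Asg vb (Ix cAdj (V vp)) ;;
      Asg vp (Plus (V vp) (N 1))) ;;
     Cond (Minus (V vx) (Ix cX2 (V vb))) push_edge Skip"

definition event_pre :: com where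
  "event_pre =
     Asg vv (Ix cXV (V vx)) ;;
     Asg vp (Ix cRow (V vv)) ;;
     Asg vpe (Plus (V vp) (Ix cDeg (V vv)))"

definition label_loop :: com where
  "label_loop = While (Minus (V vpe) (V vp)) label_body"

definition push_loop :: com where
  "push_loop = While (Minus (V vpe) (V vp)) push_body"

definition sweep_body :: com where
  "sweep_body =
     event_pre ;;
     Cond (Minus (Ix cX2 (V vv)) (V vx)) label_loop push_loop ;;
     Asg vx (Plus (V vx) (N 1))"

definition sweep_loop :: com where
  "sweep_loop = While (Minus (Plus (Plus (V vn) (V vn)) (N 1)) (V vx)) sweep_body"

context trapezoids
begin

text \<open>A scan of an adjacency list meets every neighbour once: no counter is changed twice in
  an update, and no edge is labelled twice.\<close>

lemma notin_image_prefix: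
  assumes "bij_betw A {0..<d} B" "(i::int) < d" "0 \<le> i"
  shows "A i \<notin> A ` {0..<i}"
proof
  assume "A i \<in> A ` {0..<i}"
  then obtain j where "j \<in> {0..<i}" "A i = A j" by blast
  then show False using inj_onD[OF bij_betw_imp_inj_on[OF assms(1)], of i j] assms by auto
qed

lemma upd_ok:
  assumes inp: "input_ok m" and graph: "graph_ok m" and w: "ar m 31 vo = w" "w \<in> {0..<n}"
  shows "hr (upd \<delta>) m (200 * (deg w + 1))
    (\<lambda>m'. (\<forall>v. ar m' cD v = ar m cD v + (if v \<in> nbrs w \<and> y1 v < y2 w then \<delta> else 0)) \<and>
       same m m' {cD} {vs, vse, vc})"
proof -
  define A where "A i = ar m cAdj (n * w + i)" for i
  have bij: "bij_betw A {0..<int (deg w)} (nbrs w)" and degw: "ar m cDeg w = int (deg w)"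
    using graph w unfolding graph_ok_def A_def by auto
  have row: "ar m cRow w = n * w" "ar m cY2 w = y2 w" using inp w by (auto simp: input_ok_def)
  define inv where "inv i m' \<longleftrightarrow> 0 \<le> i \<and> i \<le> int (deg w) \<and> ar m' 31 vs = n * w + i \<and>
      ar m' 31 vse = n * w + int (deg w) \<and>
      (\<forall>v. ar m' cD v = ar m cD v + (if v \<in> A ` {0..<i} \<and> y1 v < y2 w then \<delta> else 0)) \<and>
      same m m' {cD} {vs, vse, vc}" for i m'
  define m1 where "m1 = m(loc 31 vs := n * w, loc 31 vse := n * w + int (deg w))"
  have pre: "sem upd_pre m = m1" using w row degw by (simp add: upd_pre_def m1_def)
  have inv0: "inv 0 m1" by (simp add: inv_def m1_def)
  have step: "inv (i + 1) (sem (upd_body \<delta>) m')" if inv: "inv i m'" and i: "i < int (deg w)" for i m'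
  proof -
    note I = inv[unfolded inv_def]
    have same: "same m m' {cD} {vs, vse, vc}" using I by blast
    have i0: "i \<in> {0..<int (deg w)}" using I i by auto
    have An: "A i \<in> nbrs w" using bij_betwE[OF bij] i0 by blast
    then have AV: "A i \<in> {0..<n}" using nbrs_subset by blast
    have eqs: "ar m' cAdj = ar m cAdj" "ar m' cY1 = ar m cY1" "ar m' cY2 = ar m cY2" "ar m' 31 vo = w"
      using sameD[OF same, of cAdj] sameD[OF same, of cY1] sameD[OF same, of cY2] sameD1[OF same, of vo] w by auto
    have y: "ar m cY1 (A i) = y1 (A i)" using inp AV by (auto simp: input_ok_def)
    have Adj: "ar m cAdj (n * w + i) = A i" by (simp add: A_def)
    let ?m2 = "m'(loc 31 vc := A i, loc 31 vs := n * w + i + 1)"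
    have sem: "sem (upd_body \<delta>) m' = (if y1 (A i) < y2 w then ?m2(loc cD (A i) := ar m' cD (A i) + \<delta>) else ?m2)"
      using I eqs row y by (simp add: upd_body_def Adj)
    have "same m ?m2 {cD} {vs, vse, vc}" using same by simp
    then have same': "same m (sem (upd_body \<delta>) m') {cD} {vs, vse, vc}" unfolding sem by simp
    have "A i \<notin> A ` {0..<i}" by (rule notin_image_prefix[OF bij]) (use i0 in auto)
    moreover have "{0..<i + 1} = insert i {0..<i}" using i0 by auto
    ultimately have "ar (sem (upd_body \<delta>) m') cD v =
        ar m cD v + (if v \<in> A ` {0..<i + 1} \<and> y1 v < y2 w then \<delta> else 0)" for v
      unfolding sem using I by auto
    then show ?thesis
      unfolding inv_def using same' I i by (simp add: sem)
  qed
  have size: "csize (upd_body \<delta>) \<le> 150" "loopfree (upd_body \<delta>)" by (simp_all add: upd_body_def)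
  have "hr (While (Minus (V vse) (V vs)) (upd_body \<delta>)) m1 (170 * deg w + 10) (inv (int (deg w)))"
  proof (rule hr_While[where I = "\<lambda>m'. inv (ar m' 31 vs - n * w) m'"
        and pot = "\<lambda>m'. 170 * nat (ar m' 31 vse - ar m' 31 vs)"])
    show "inv (ar m1 31 vs - n * w) m1" using inv0 by (simp add: m1_def)
  next
    fix m' assume inv: "inv (ar m' 31 vs - n * w) m'" and g: "0 < aval (Minus (V vse) (V vs)) m'"
    define i where "i = ar m' 31 vs - n * w"
    have i: "i < int (deg w)" using inv g by (auto simp: inv_def i_def)
    have "inv (i + 1) (sem (upd_body \<delta>) m')" using step[OF _ i] inv by (simp add: i_def)
    then show "\<exists>T. hr (upd_body \<delta>) m' T (\<lambda>m''. inv (ar m'' 31 vs - n * w) m'' \<and>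
        ecost (Minus (V vse) (V vs)) + 3 + T + 170 * nat (ar m'' 31 vse - ar m'' 31 vs)
        \<le> 170 * nat (ar m' 31 vse - ar m' 31 vs))"
      using size inv i by (intro exI[of _ 150] hr_loopfree) (auto simp: inv_def i_def)
  next
    fix m' assume "inv (ar m' 31 vs - n * w) m'" "aval (Minus (V vse) (V vs)) m' \<le> 0"
    moreover then have "ar m' 31 vs - n * w = int (deg w)" by (auto simp: inv_def)
    ultimately show "inv (int (deg w)) m'" by simp
  next
    show "170 * nat (ar m1 31 vse - ar m1 31 vs) + ecost (Minus (V vse) (V vs)) + 1 \<le> 170 * deg w + 10"
      by (simp add: m1_def)
  qed
  then have "hr upd_pre m 30 (\<lambda>m'. hr (While (Minus (V vse) (V vs)) (upd_body \<delta>)) m' (170 * deg w + 10) (inv (int (deg w))))"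
    by - (rule hr_loopfree, simp_all only: pre, simp_all add: upd_pre_def)
  then have "hr (upd \<delta>) m (200 * (deg w + 1)) (inv (int (deg w)))"
    unfolding upd_def by (rule hr_Seq) simp
  then show ?thesis
    by (rule hr_weaken[OF _ order_refl]) (use bij in \<open>simp add: inv_def bij_betw_def\<close>)
qed

text \<open>\<open>W\<close> is a ghost set, the vertices that have entered the table so far; it is
  not in memory and serves the amortized analysis. The counters are kept out of this predicate
  because they have to be valid for \<open>t + 1\<close> while a right end \<open>t\<close> is still
  being processed.\<close>

definition sweep_st :: "int \<Rightarrow> (int \<times> int) set \<Rightarrow> (int \<times> int) set \<Rightarrow> int set \<Rightarrow> (int \<Rightarrow> int) \<Rightarrow> bool" where
  "sweep_st t PL PU W m \<longleftrightarrow> input_ok m \<and> graph_ok m \<and> ar m 31 vx = t \<and>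
     sweep_inv (ar m cLam) (ar m cPrd) (ar m 31 vk) (ar m cBE) (ar m cBO) PL PU \<and>
     rec_inv (ar m cLam) (ar m 31 vk) (ar m cBO) W \<and>
     (\<forall>e\<in>PL. ar m cEU (cd e) = fst e \<and> ar m cEW (cd e) = snd e)"

definition counts_ok :: "int \<Rightarrow> (int \<Rightarrow> int) \<Rightarrow> bool" where
  "counts_ok t m \<longleftrightarrow> count_inv (ar m cD) {1..ar m 31 vk} (ar m cBO) t"

lemma label_loop_ok:
  assumes st: "sweep_st t {e \<in> edges. X1 e < t} {e \<in> edges. X2 e < t} W m"
    and cnt: "counts_ok t m"
    and a: "a \<in> {0..<n}" "t = x1 a" "ar m 31 vv = a" "ar m 31 vp = n * a" "ar m 31 vpe = n * a + int (deg a)"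
    and W: "\<And>w. w \<in> W \<Longrightarrow> x2 w < t"
  shows "hr label_loop m (500 * (deg a + 1))
    (\<lambda>m'. sweep_st t {e \<in> edges. X1 e < t + 1} {e \<in> edges. X2 e < t} W m' \<and>
       same m m' {cLam, cPrd, cEU, cEW} {vb, vp, vl, vq})"
proof -
  define A where "A i = ar m cAdj (n * a + i)" for i
  note S = st[unfolded sweep_st_def]
  have inp: "input_ok m" and graph: "graph_ok m" using S by auto
  have bij: "bij_betw A {0..<int (deg a)} (nbrs a)"
    using graph a unfolding graph_ok_def A_def by auto
  let ?PU = "{e \<in> edges. X2 e < t}"
  define PL where "PL i = {e \<in> edges. X1 e < t} \<union> {(a, b) | b. b \<in> A ` {0..<i} \<and> t < x1 b}" for i
  have PL_end: "PL (int (deg a)) = {e \<in> edges. X1 e < t + 1}"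
  proof -
    have "A ` {0..<int (deg a)} = nbrs a" using bij by (simp add: bij_betw_def)
    moreover have "{(a, b) | b. b \<in> nbrs a \<and> t < x1 b} = {e \<in> edges. X1 e = t}"
    proof (intro equalityI subsetI)
      fix e assume "e \<in> {(a, b) | b. b \<in> nbrs a \<and> t < x1 b}"
      then show "e \<in> {e \<in> edges. X1 e = t}" using a by (auto simp: nbrs_def edges_def X1_def)
    next
      fix e assume e: "e \<in> {e \<in> edges. X1 e = t}"
      then have "fst e = a" using edgesD[of e] x1_inj[of "fst e" a] a by (auto simp: X1_def)
      then have "e = (a, snd e)" "snd e \<in> nbrs a" "t < x1 (snd e)"
        using e edgesD[of e] a by (auto simp: nbrs_def prod_eq_iff)
      then show "e \<in> {(a, b) | b. b \<in> nbrs a \<and> t < x1 b}" by blast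
    qed
    ultimately have "PL (int (deg a)) = {e \<in> edges. X1 e < t} \<union> {e \<in> edges. X1 e = t}"
      by (simp add: PL_def)
    also have "\<dots> = {e \<in> edges. X1 e < t + 1}" by auto
    finally show ?thesis .
  qed
  define inv where "inv i m' \<longleftrightarrow> 0 \<le> i \<and> i \<le> int (deg a) \<and> ar m' 31 vp = n * a + i \<and>
      sweep_st t (PL i) ?PU W m' \<and> same m m' {cLam, cPrd, cEU, cEW} {vb, vp, vl, vq}" for i m'
  have inv0: "inv 0 m" using st a by (simp add: inv_def PL_def)
  have step: "inv (i + 1) (sem label_body m')" if inv: "inv i m'" and i: "i < int (deg a)" for i m'
  proof -
    note I = inv[unfolded inv_def]
    have same: "same m m' {cLam, cPrd, cEU, cEW} {vb, vp, vl, vq}" using I by blast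
    note S' = I[THEN conjunct2, THEN conjunct2, THEN conjunct2, THEN conjunct1, unfolded sweep_st_def]
    have i0: "i \<in> {0..<int (deg a)}" using I i by auto
    define b where "b = A i"
    have bn: "b \<in> nbrs a" unfolding b_def using bij_betwE[OF bij] i0 by blast
    then have bV: "b \<in> {0..<n}" using nbrs_subset by blast
    have inp': "input_ok m'" using S' by blast
    define k where "k = ar m 31 vk"
    have eqs: "ar m' cAdj = ar m cAdj" "ar m' cD = ar m cD" "ar m' cBE = ar m cBE" "ar m' cBO = ar m cBO"
      "ar m' 31 vv = a" "ar m' 31 vk = k" "ar m' 31 vx = t" "ar m' 31 vp = n * a + i"
      using sameD[OF same, of cAdj] sameD[OF same, of cD] sameD[OF same, of cBE] sameD[OF same, of cBO]
        sameD1[OF same, of vv] sameD1[OF same, of vk] sameD1[OF same, of vx] a S I by (auto simp: k_def)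
    have Adj: "ar m cAdj (n * a + i) = b" by (simp add: A_def b_def)
    have inp_eqs: "ar m' cX1 b = x1 b" "ar m' cRow a = n * a" using inp' bV a by (auto simp: input_ok_def)
    have prefix: "A ` {0..<i + 1} = insert b (A ` {0..<i})"
    proof -
      have "{0..<i + 1} = insert i {0..<i}" using i0 by auto
      then show ?thesis by (simp add: b_def)
    qed
    show ?thesis
    proof (cases "t < x1 b")
      case False
      let ?m2 = "m'(loc 31 vb := b, loc 31 vp := n * a + i + 1)"
      have sem: "sem label_body m' = ?m2"
        using False by (simp add: label_body_def eqs Adj inp_eqs)
      have "PL (i + 1) = PL i" unfolding PL_def prefix using False by auto
      moreover have s2: "same m' ?m2 {} {vb, vp}" by simp
      moreover have "input_ok ?m2" by (rule input_ok_same[OF inp' s2]) auto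
      moreover have "graph_ok ?m2" by (rule graph_ok_same[OF _ s2]) (use S' in auto)
      ultimately show ?thesis
        unfolding inv_def sem using I i S' by (simp add: sweep_st_def)
    next
      case True
      define e where "e = (a, b)"
      have e: "e \<in> edges" using bn True a by (simp add: e_def edges_def nbrs_def)
      have X1e: "X1 e = t" using a by (simp add: e_def X1_def)
      have cde: "cd e = n * a + b" by (simp add: e_def cd_def)
      have ePL: "e \<notin> PL i"
      proof -
        have "b \<notin> A ` {0..<i}" unfolding b_def by (rule notin_image_prefix[OF bij]) (use i0 in auto)
        then show ?thesis using X1e by (auto simp: PL_def e_def)
      qed
      have PLi: "PL (i + 1) = insert e (PL i)" unfolding PL_def prefix using True by (auto simp: e_def)
      define l where "l = k - max (ar m cD a) (ar m cD b)"
      let ?m2 = "m'(loc 31 vb := b, loc 31 vp := n * a + i + 1, loc 31 vl := l, loc 31 vq := n * a + b,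
          loc cLam (n * a + b) := l + 1, loc cPrd (n * a + b) := ar m cBE l,
          loc cEU (n * a + b) := a, loc cEW (n * a + b) := b)"
      have sem: "sem label_body m' = ?m2"
        using True by (cases "ar m cD a < ar m cD b") (simp_all add: label_body_def eqs Adj inp_eqs l_def max_def)
      have SI: "sweep_inv (ar m' cLam) (ar m' cPrd) k (ar m cBE) (ar m cBO) (PL i) ?PU"
        using S' eqs by simp
      have leq: "l = int (card {j \<in> {1..k}. y2 (ar m cBO j) < Y1 e})"
        using count_inv_label[OF SI _ e, of "ar m cD" t] cnt X1e
        by (simp add: counts_ok_def k_def l_def e_def)
      have "sweep_inv ((ar m' cLam)(cd e := l + 1)) ((ar m' cPrd)(cd e := ar m cBE l)) k (ar m cBE) (ar m cBO) (insert e (PL i)) ?PU"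
        by (rule sweep_inv_label[OF SI e ePL _ _ leq]) (use X1e in auto)
      moreover have "rec_inv ((ar m' cLam)(cd e := l + 1)) k (ar m cBO) W"
      proof (rule rec_inv_label[OF _ e])
        show "rec_inv (ar m' cLam) k (ar m cBO) W" using S' eqs by simp
        fix w assume w: "w \<in> W"
        then have "w \<in> {0..<n}" using S unfolding rec_inv_def by blast
        \<comment> \<open>Recorded vertices end before the sweep line and \<open>e\<close> begins on
          it, so \<open>e\<close> is not left of any of them.\<close>
        then show "x1 w \<le> X2 e" using W[OF w] x12[of w] edge_bounds[OF e] X1e by auto
      qed
      moreover have s2: "same m' ?m2 {cLam, cPrd, cEU, cEW} {vb, vp, vl, vq}" by simp
      moreover have "input_ok ?m2" by (rule input_ok_same[OF inp' s2]) auto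
      moreover have "graph_ok ?m2" by (rule graph_ok_same[OF _ s2]) (use S' in auto)
      moreover have "same m ?m2 {cLam, cPrd, cEU, cEW} {vb, vp, vl, vq}" by (rule same_trans[OF same s2]) auto
      moreover have "ar ?m2 cEU (cd f) = fst f \<and> ar ?m2 cEW (cd f) = snd f" if "f \<in> insert e (PL i)" for f
      proof (cases "f = e")
        case True
        then show ?thesis using cde by (simp add: e_def)
      next
        case False
        then have f: "f \<in> PL i" using that by blast
        then have "f \<in> edges" using SI unfolding sweep_inv_def by blast
        then have "cd f \<noteq> n * a + b" using cd_eq_iff[OF _ e, of f] False cde by simp
        then show ?thesis using S' f by simp
      qed
      ultimately show ?thesis
        unfolding inv_def sem sweep_st_def PLi using I i eqs cde by simp
    qed
  qed
  have size: "csize label_body \<le> 300" "loopfree label_body" by (simp_all add: label_body_def)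
  have vpe: "ar m' 31 vpe = n * a + int (deg a)" if "inv i m'" for i m'
    using that sameD1[of m m' _ _ vpe] a by (auto simp: inv_def)
  show ?thesis
    unfolding label_loop_def
  proof (rule hr_While[where I = "\<lambda>m'. inv (ar m' 31 vp - n * a) m'"
        and pot = "\<lambda>m'. 350 * nat (n * a + int (deg a) - ar m' 31 vp)"])
    show "inv (ar m 31 vp - n * a) m" using inv0 a by simp
  next
    fix m' assume inv: "inv (ar m' 31 vp - n * a) m'" and g: "0 < aval (Minus (V vpe) (V vp)) m'"
    define i where "i = ar m' 31 vp - n * a"
    have i: "i < int (deg a)" using inv g vpe[OF inv] by (auto simp: i_def)
    have next_inv: "inv (i + 1) (sem label_body m')" using step[OF _ i] inv by (simp add: i_def)
    then have vp': "ar (sem label_body m') 31 vp = ar m' 31 vp + 1" by (simp add: inv_def i_def)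
    then have "inv (ar (sem label_body m') 31 vp - n * a) (sem label_body m')"
      using next_inv by (simp add: i_def algebra_simps)
    then show "\<exists>T. hr label_body m' T (\<lambda>m''. inv (ar m'' 31 vp - n * a) m'' \<and>
        ecost (Minus (V vpe) (V vp)) + 3 + T + 350 * nat (n * a + int (deg a) - ar m'' 31 vp)
        \<le> 350 * nat (n * a + int (deg a) - ar m' 31 vp))"
      using size vp' i by (intro exI[of _ 300] hr_loopfree) (auto simp: i_def)
  next
    fix m' assume inv: "inv (ar m' 31 vp - n * a) m'" and g: "aval (Minus (V vpe) (V vp)) m' \<le> 0"
    then have "ar m' 31 vp - n * a = int (deg a)" using vpe[OF inv] by (auto simp: inv_def)
    then have "inv (int (deg a)) m'" using inv by simp
    then show "sweep_st t {e \<in> edges. X1 e < t + 1} {e \<in> edges. X2 e < t} W m' \<and>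
       same m m' {cLam, cPrd, cEU, cEW} {vb, vp, vl, vq}"
      using PL_end by (simp add: inv_def)
  next
    show "350 * nat (n * a + int (deg a) - ar m 31 vp) + ecost (Minus (V vpe) (V vp)) + 1 \<le> 500 * (deg a + 1)"
      using a by simp
  qed
qed

lemma record_edge_ok:
  assumes inp: "input_ok m" and graph: "graph_ok m"
    and vars: "ar m 31 vw = w" "w \<in> {0..<n}" "ar m 31 vl = l" "ar m 31 vq = q"
  shows "hr record_edge m (200 * (deg w + 1) + 60)
    (\<lambda>m'. ar m' cBE = (ar m cBE)(l := q) \<and> ar m' cBO = (ar m cBO)(l := w) \<and>
       (\<forall>v. ar m' cD v = ar m cD v + (if v \<in> nbrs w \<and> y1 v < y2 w then 1 else 0)) \<and>
       same m m' {cBE, cBO, cD} {vo, vs, vse, vc})"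
proof -
  define m1 where "m1 = m(loc cBE l := q, loc cBO l := w, loc 31 vo := w)"
  have pre: "sem record_pre m = m1" using vars by (simp add: record_pre_def m1_def)
  have s1: "same m m1 {cBE, cBO} {vo}" by (simp add: m1_def)
  have "input_ok m1" by (rule input_ok_same[OF inp s1]) auto
  moreover have "graph_ok m1" by (rule graph_ok_same[OF graph s1]) auto
  moreover have "ar m1 31 vo = w" by (simp add: m1_def)
  ultimately have "hr (upd 1) m1 (200 * (deg w + 1))
    (\<lambda>m'. (\<forall>v. ar m' cD v = ar m1 cD v + (if v \<in> nbrs w \<and> y1 v < y2 w then 1 else 0)) \<and>
       same m1 m' {cD} {vs, vse, vc})"
    using vars(2) by (rule upd_ok)
  then have "hr (upd 1) m1 (200 * (deg w + 1))
    (\<lambda>m'. ar m' cBE = (ar m cBE)(l := q) \<and> ar m' cBO = (ar m cBO)(l := w) \<and>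
       (\<forall>v. ar m' cD v = ar m cD v + (if v \<in> nbrs w \<and> y1 v < y2 w then 1 else 0)) \<and>
       same m m' {cBE, cBO, cD} {vo, vs, vse, vc})"
  proof (rule hr_weaken[OF _ order_refl], elim conjE)
    fix m' assume D: "\<forall>v. ar m' cD v = ar m1 cD v + (if v \<in> nbrs w \<and> y1 v < y2 w then 1 else 0)"
      and s2: "same m1 m' {cD} {vs, vse, vc}"
    have "same m m' {cBE, cBO, cD} {vo, vs, vse, vc}" by (rule same_trans[OF s1 s2]) auto
    then show "ar m' cBE = (ar m cBE)(l := q) \<and> ar m' cBO = (ar m cBO)(l := w) \<and>
       (\<forall>v. ar m' cD v = ar m cD v + (if v \<in> nbrs w \<and> y1 v < y2 w then 1 else 0)) \<and>
       same m m' {cBE, cBO, cD} {vo, vs, vse, vc}"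
      using D sameD[OF s2, of cBE] sameD[OF s2, of cBO] by (simp add: m1_def)
  qed
  then have "hr record_pre m 60 (\<lambda>m'. hr (upd 1) m' (200 * (deg w + 1))
    (\<lambda>m'. ar m' cBE = (ar m cBE)(l := q) \<and> ar m' cBO = (ar m cBO)(l := w) \<and>
       (\<forall>v. ar m' cD v = ar m cD v + (if v \<in> nbrs w \<and> y1 v < y2 w then 1 else 0)) \<and>
       same m m' {cBE, cBO, cD} {vo, vs, vse, vc}))"
    by - (rule hr_loopfree, simp_all only: pre, simp_all add: record_pre_def)
  then show ?thesis
    unfolding record_edge_def by (rule hr_Seq) simp
qed

text \<open>A vertex pays twice when it enters a level: for its own entry and for its later removal.\<close>

definition potential :: "int set \<Rightarrow> (int \<Rightarrow> int) \<Rightarrow> nat" where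
  "potential W m = 1000 * (2 * (\<Sum>v\<in>{0..<n} - W. deg v + 1) + (\<Sum>j\<in>{1..ar m 31 vk}. deg (ar m cBO j) + 1))"

text \<open>Recording \<open>w\<close> releases its reserve of 2000 per unit of
  \<open>deg w + 1\<close>. One half may be spent at once, the other half is deposited at level
  \<open>l\<close>; the deposit of a replaced vertex becomes available for its removal.\<close>

lemma potential_push:
  assumes w: "w \<in> {0..<n}" "w \<notin> W" and l: "1 \<le> l" "l \<le> ar m 31 vk + 1"
    and m': "ar m' 31 vk = max (ar m 31 vk) l" "ar m' cBO = (ar m cBO)(l := w)"
  shows "potential (insert w W) m' + 1000 * (deg w + 1) +
      (if l \<le> ar m 31 vk then 1000 * (deg (ar m cBO l) + 1) else 0) \<le> potential W m"
proof -
  define k where "k = ar m 31 vk"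
  have 1: "(\<Sum>v\<in>{0..<n} - W. deg v + 1) = (deg w + 1) + (\<Sum>v\<in>{0..<n} - insert w W. deg v + 1)"
    using sum.remove[of "{0..<n} - W" w "\<lambda>v. deg v + 1"] w by (simp add: Diff_insert[of _ w W])
  have eq: "{1..max k l} = insert l ({1..k} - {l})" using l by (auto simp: k_def)
  have 2: "(\<Sum>j\<in>{1..max k l}. deg (((ar m cBO)(l := w)) j) + 1) =
      (deg w + 1) + (\<Sum>j\<in>{1..k} - {l}. deg (ar m cBO j) + 1)"
    unfolding eq by (subst sum.insert) (auto intro!: sum.cong)
  have 3: "(\<Sum>j\<in>{1..k}. deg (ar m cBO j) + 1) =
      (\<Sum>j\<in>{1..k} - {l}. deg (ar m cBO j) + 1) + (if l \<le> k then deg (ar m cBO l) + 1 else 0)"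
  proof (cases "l \<le> k")
    case True
    then show ?thesis using l sum.remove[of "{1..k}" l "\<lambda>j. deg (ar m cBO j) + 1"] by simp
  next
    case False
    then have "{1..k} - {l} = {1..k}" by auto
    then show ?thesis using False by simp
  qed
  show ?thesis
    unfolding potential_def m' k_def[symmetric] 1 2 3 by simp
qed

definition mk_edge :: "int \<Rightarrow> int \<Rightarrow> int \<times> int" where
  "mk_edge a b = (if x1 a < x1 b then (a, b) else (b, a))"

lemma mk_edge_edges:
  assumes "b \<in> nbrs a" "a \<noteq> b"
  shows "mk_edge a b \<in> edges"
proof -
  have ab: "meets a b" "meets b a" "a \<in> {0..<n}" "b \<in> {0..<n}"
    using assms by (auto simp: nbrs_def meets_def)
  then have "x1 a \<noteq> x1 b" using x1_inj[of a b] assms(2) by blast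
  then show ?thesis using ab by (simp add: mk_edge_def edges_def)
qed

lemma mk_edge_bounds: "X2 (mk_edge a b) = max (x2 a) (x2 b)" "Y2 (mk_edge a b) = max (y2 a) (y2 b)"
  by (auto simp: mk_edge_def X2_def Y2_def)

text \<open>\<open>R\<close> is budget for the rest of the computation, handed through untouched.
  Beyond the fixed 400 steps everything is paid by the drop of the potential.\<close>

lemma push_edge_ok:
  assumes st: "sweep_st t PL PU W m"
    and cnt: "counts_ok (t + 1) m"
    and a: "a \<in> {0..<n}" "t = x2 a" "ar m 31 vv = a"
    and b: "b \<in> nbrs a" "x2 b < t" "ar m 31 vb = b"
    and e: "mk_edge a b \<in> PL"
    and before: "\<And>f. f \<in> edges \<Longrightarrow> X2 f < t \<Longrightarrow> f \<in> PU"
    and PUt: "\<And>f. f \<in> PU \<Longrightarrow> X2 f \<le> t"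
  shows "hp push_edge m (R + 400 + potential W m)
    (\<lambda>m' p'. \<exists>W'. sweep_st t PL (insert (mk_edge a b) PU) W' m' \<and> counts_ok (t + 1) m' \<and>
       W' \<subseteq> insert a (insert b W) \<and>
       same m m' {cBE, cBO, cD} {vk, vq, vl, vw, vo, vs, vse, vc} \<and> R + potential W' m' \<le> p')"
    (is "hp _ _ _ ?Q")
proof -
  note S = st[unfolded sweep_st_def]
  have inp: "input_ok m" and graph: "graph_ok m" and vx: "ar m 31 vx = t" using S by auto
  have bV: "b \<in> {0..<n}" using b nbrs_subset by blast
  have ab: "a \<noteq> b" using a b by auto
  define e0 where "e0 = mk_edge a b"
  have e0: "e0 \<in> edges" unfolding e0_def by (rule mk_edge_edges[OF b(1) ab])
  have X2e: "X2 e0 = t" "Y2 e0 = max (y2 a) (y2 b)" using a b by (auto simp: e0_def mk_edge_bounds)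
  define w where "w = (if y2 a < y2 b then b else a)"
  have w: "w \<in> {0..<n}" "y2 w = Y2 e0" "w = fst e0 \<or> w = snd e0" "x2 w \<le> t"
    using a b bV X2e by (auto simp: w_def e0_def mk_edge_def)
  define k l where "k = ar m 31 vk" and "l = ar m cLam (cd e0)"
  define m1 where "m1 = m(loc 31 vq := cd e0, loc 31 vl := l, loc 31 vw := w)"
  have inps: "ar m cX1 a = x1 a" "ar m cX1 b = x1 b" "ar m cRow a = n * a" "ar m cRow b = n * b"
    "ar m cY2 a = y2 a" "ar m cY2 b = y2 b"
    using inp a bV by (auto simp: input_ok_def)
  have pre: "sem push_pre m = m1"
    using a b inps
    by (cases "x1 a < x1 b"; cases "y2 a < y2 b")
      (simp_all add: push_pre_def m1_def l_def w_def e0_def mk_edge_def cd_def)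
  have s1: "same m m1 {} {vq, vl, vw}" by (simp add: m1_def)
  have inp1: "input_ok m1" by (rule input_ok_same[OF inp s1]) auto
  have graph1: "graph_ok m1" by (rule graph_ok_same[OF graph s1]) auto
  have SI: "sweep_inv (ar m cLam) (ar m cPrd) k (ar m cBE) (ar m cBO) PL PU"
    and RI: "rec_inv (ar m cLam) k (ar m cBO) W" using S by (auto simp: k_def)
  note lower = sweep_inv_lower[OF SI e[folded e0_def], folded l_def]
  have m1_vars: "ar m1 31 vk = k" "ar m1 31 vl = l" "ar m1 31 vw = w" "ar m1 31 vq = cd e0"
    by (simp_all add: m1_def k_def)
  have m1_cols: "ar m1 c = ar m c" if "c < 32" "c \<noteq> 31" for c
    using that by (simp add: m1_def)
  have cnt0: "count_inv (ar m cD) {1..k} (ar m cBO) (t + 1)" using cnt by (simp add: counts_ok_def k_def)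
  \<comment> \<open>The common end of both kinds of update: in \<open>m2\<close> level
    \<open>l\<close> is absent from the counters, because it is new or because its entry has been
    withdrawn. \<open>m3\<close> merely supplies a memory in which the resulting potential can be
    written down.\<close>
  have finish: "hp record_edge m2 (R + 200 * (deg w + 1) + 60 + potential (insert w W) m3) ?Q"
    if better: "k < l \<or> y2 w < y2 (ar m cBO l)"
      and m2: "input_ok m2" "graph_ok m2" "ar m2 31 vk = max k l" "ar m2 31 vw = w" "ar m2 31 vl = l" "ar m2 31 vq = cd e0"
        "same m m2 {cD} {vk, vq, vl, vw, vo, vs, vse, vc}"
        "count_inv (ar m2 cD) ({1..k} - {l}) (ar m cBO) (t + 1)"
      and m3: "ar m3 31 vk = max k l" "ar m3 cBO = (ar m cBO)(l := w)" for m2 m3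
  proof (rule hp_hr[OF record_edge_ok[OF m2(1,2,4) w(1) m2(5,6)]])
    fix m' assume m': "ar m' cBE = (ar m2 cBE)(l := cd e0) \<and> ar m' cBO = (ar m2 cBO)(l := w) \<and>
       (\<forall>v. ar m' cD v = ar m2 cD v + (if v \<in> nbrs w \<and> y1 v < y2 w then 1 else 0)) \<and>
       same m2 m' {cBE, cBO, cD} {vo, vs, vse, vc}"
    then have s2: "same m2 m' {cBE, cBO, cD} {vo, vs, vse, vc}" by blast
    have same': "same m m' {cBE, cBO, cD} {vk, vq, vl, vw, vo, vs, vse, vc}"
      by (rule same_trans[OF m2(7) s2]) auto
    have cols: "ar m' c = ar m c" if "c < 32" "c \<noteq> 31" "c \<notin> {cBE, cBO, cD}" for c
      using sameD[OF same' that] .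
    have BE: "ar m' cBE = (ar m cBE)(l := cd e0)" "ar m' cBO = (ar m cBO)(l := w)"
      using m' sameD[OF m2(7), of cBE] sameD[OF m2(7), of cBO] by auto
    have vk': "ar m' 31 vk = max k l" "ar m' 31 vx = t"
      using sameD1[OF s2, of vk] m2(3) sameD1[OF same', of vx] vx by auto
    have "input_ok m'" by (rule input_ok_same[OF inp same']) auto
    moreover have "graph_ok m'" by (rule graph_ok_same[OF graph same']) auto
    moreover have "sweep_inv (ar m cLam) (ar m cPrd) (max k l) ((ar m cBE)(l := cd e0)) ((ar m cBO)(l := w)) PL (insert e0 PU)"
      by (rule sweep_inv_push[OF SI e[folded e0_def] _ better w(3,2)]) (simp add: l_def)
    moreover note rec = rec_inv_push[OF SI RI e[folded e0_def] l_def better w(3,2)]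
    have rec2: "rec_inv (ar m cLam) (max k l) ((ar m cBO)(l := w)) (insert w W)"
      using rec(2) before X2e by simp
    ultimately have st': "sweep_st t PL (insert e0 PU) (insert w W) m'"
      using S vk' BE cols[of cLam] cols[of cPrd] cols[of cEU] cols[of cEW] by (simp add: sweep_st_def)
    \<comment> \<open>Here \<open>t + 1\<close> is essential: \<open>w\<close> may be the vertex
      that ends at \<open>t\<close> itself.\<close>
    have "count_inv (ar m' cD) (insert l ({1..k} - {l})) ((ar m cBO)(l := w)) (t + 1)"
      by (rule count_inv_add[OF m2(8) w(1)]) (use w m' in auto)
    moreover have "insert l ({1..k} - {l}) = {1..max k l}" using lower better by auto
    ultimately have "counts_ok (t + 1) m'" using vk' BE by (simp add: counts_ok_def)
    moreover have "potential (insert w W) m' = potential (insert w W) m3"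
      using vk' BE m3 by (simp add: potential_def)
    moreover have "insert w W \<subseteq> insert a (insert b W)" by (auto simp: w_def)
    ultimately show "\<exists>p'. 200 * (deg w + 1) + 60 + p' \<le> R + 200 * (deg w + 1) + 60 + potential (insert w W) m3 \<and> ?Q m' p'"
      using st' same' by (intro exI[of _ "R + potential (insert w W) m3"] conjI exI[of _ "insert w W"])
        (auto simp: e0_def)
  qed
  have wW: "w \<notin> W" if "k < l \<or> y2 w < y2 (ar m cBO l)"
    using rec_inv_push(1)[OF SI RI e[folded e0_def] l_def that w(3,2)] before X2e by simp
  define m3 where "m3 = m(loc 31 vk := max k l, loc cBO l := w)"
  have m3: "ar m3 31 vk = max k l" "ar m3 cBO = (ar m cBO)(l := w)" by (simp_all add: m3_def)
  have pot: "potential (insert w W) m3 + 1000 * (deg w + 1) +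
      (if l \<le> k then 1000 * (deg (ar m cBO l) + 1) else 0) \<le> potential W m"
    if "k < l \<or> y2 w < y2 (ar m cBO l)"
    using potential_push[OF w(1) wW[OF that], of l m m3] lower m3 by (simp add: k_def)
  have rest: "hp (Cond (Minus (V vl) (V vk)) (Asg vk (V vl) ;; record_edge)
       (Cond (Minus (Ix cY2 (Ix cBO (V vl))) (Ix cY2 (V vw)))
          (Asg vo (Ix cBO (V vl)) ;; upd (- 1) ;; record_edge) Skip)) m1 (R + 200 + potential W m) ?Q"
  proof (rule hp_Cond[where p = "R + 150 + potential W m"])
    assume "0 < aval (Minus (V vl) (V vk)) m1"
    then have kl: "k < l" using m1_vars by simp
    define m2 where "m2 = m1(loc 31 vk := l)"
    have s2: "same m1 m2 {} {vk}" by (simp add: m2_def)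
    have "input_ok m2" by (rule input_ok_same[OF inp1 s2]) auto
    moreover have "graph_ok m2" by (rule graph_ok_same[OF graph1 s2]) auto
    moreover have "ar m2 31 vk = max k l" "ar m2 31 vw = w" "ar m2 31 vl = l" "ar m2 31 vq = cd e0"
      using m1_vars kl by (simp_all add: m2_def)
    moreover have "same m m2 {cD} {vk, vq, vl, vw, vo, vs, vse, vc}" by (rule same_trans[OF s1 s2]) auto
    moreover have "{1..k} - {l} = {1..k}" using kl by auto
    then have "count_inv (ar m2 cD) ({1..k} - {l}) (ar m cBO) (t + 1)"
      using cnt0 m1_cols by (simp add: m2_def)
    ultimately have *: "hp record_edge m2 (R + 200 * (deg w + 1) + 60 + potential (insert w W) m3) ?Q"
      using kl m3 by (intro finish) auto
    have "hr (Asg vk (V vl)) m1 10 (\<lambda>m'. m' = m2)"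
      by (rule hr_loopfree) (simp_all add: m2_def m1_vars)
    then show "hp (Asg vk (V vl) ;; record_edge) m1 (R + 150 + potential W m) ?Q"
    proof (rule hp_Seq[OF hp_hr])
      fix m' assume "m' = m2"
      then show "\<exists>p'. 10 + p' \<le> R + 150 + potential W m \<and> hp record_edge m' p' ?Q"
        using * pot kl by (intro exI[of _ "R + 200 * (deg w + 1) + 60 + potential (insert w W) m3"]) auto
    qed
  next
    assume "aval (Minus (V vl) (V vk)) m1 \<le> 0"
    then have kl: "l \<le> k" using m1_vars by simp
    define o' where "o' = ar m cBO l"
    obtain g where o': "o' \<in> {0..<n}" "g \<in> PU" "x2 o' \<le> X2 g"
      using SI kl lower(1) unfolding sweep_inv_def o'_def by meson
    then have o't: "x2 o' \<le> t" using PUt[OF o'(2)] by simp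
    have Y: "ar m cY2 o' = y2 o'" "ar m cY2 w = y2 w" using inp o' w by (auto simp: input_ok_def)
    show "hp (Cond (Minus (Ix cY2 (Ix cBO (V vl))) (Ix cY2 (V vw)))
          (Asg vo (Ix cBO (V vl)) ;; upd (- 1) ;; record_edge) Skip) m1 (R + 150 + potential W m) ?Q"
    proof (rule hp_Cond[where p = "R + 100 + potential W m"])
      assume "0 < aval (Minus (Ix cY2 (Ix cBO (V vl))) (Ix cY2 (V vw))) m1"
      then have better: "y2 w < y2 o'" using m1_vars m1_cols Y by (simp add: o'_def)
      define m2 where "m2 = m1(loc 31 vo := o')"
      have s2: "same m1 m2 {} {vo}" by (simp add: m2_def)
      have inp2: "input_ok m2" by (rule input_ok_same[OF inp1 s2]) auto
      have graph2: "graph_ok m2" by (rule graph_ok_same[OF graph1 s2]) auto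
      have vo2: "ar m2 31 vo = o'" by (simp add: m2_def)
      have s12: "same m m2 {cD} {vk, vq, vl, vw, vo, vs, vse, vc}" by (rule same_trans[OF s1 s2]) auto
      have pot': "potential (insert w W) m3 + 1000 * (deg w + 1) + 1000 * (deg o' + 1) \<le> potential W m"
        using pot better kl by (simp add: o'_def)
      have "hp (upd (- 1) ;; record_edge) m2 (R + 200 * (deg o' + 1) + 200 * (deg w + 1) + 60 + potential (insert w W) m3) ?Q"
      proof (rule hp_Seq[OF hp_hr[OF upd_ok[OF inp2 graph2 vo2 o'(1)]]], elim conjE)
        fix m' assume D: "\<forall>v. ar m' cD v = ar m2 cD v + (if v \<in> nbrs o' \<and> y1 v < y2 o' then - 1 else 0)"
          and s3: "same m2 m' {cD} {vs, vse, vc}"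
        have "input_ok m'" by (rule input_ok_same[OF inp2 s3]) auto
        moreover have "graph_ok m'" by (rule graph_ok_same[OF graph2 s3]) auto
        moreover have "ar m' 31 vk = max k l" "ar m' 31 vw = w" "ar m' 31 vl = l" "ar m' 31 vq = cd e0"
          using m1_vars kl sameD1[OF s3, of vk] sameD1[OF s3, of vw] sameD1[OF s3, of vl] sameD1[OF s3, of vq]
          by (simp_all add: m2_def)
        moreover have "same m m' {cD} {vk, vq, vl, vw, vo, vs, vse, vc}" by (rule same_trans[OF s12 s3]) auto
        moreover have "ar m2 cD = ar m cD" using m1_cols by (simp add: m2_def)
        then have "count_inv (ar m' cD) ({1..k} - {l}) (ar m cBO) (t + 1)"
          by (intro count_inv_remove[OF cnt0]) (use o' o't kl lower(1) D in \<open>auto simp: o'_def\<close>)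
        ultimately have "hp record_edge m' (R + 200 * (deg w + 1) + 60 + potential (insert w W) m3) ?Q"
          using better m3 by (intro finish) (auto simp: o'_def)
        then show "\<exists>p'. 200 * (deg o' + 1) + p' \<le>
            R + 200 * (deg o' + 1) + 200 * (deg w + 1) + 60 + potential (insert w W) m3 \<and> hp record_edge m' p' ?Q"
          by (intro exI[of _ "R + 200 * (deg w + 1) + 60 + potential (insert w W) m3"]) auto
      qed
      then have *: "hp (upd (- 1) ;; record_edge) m2 (R + 80 + potential W m) ?Q"
        by (rule hp_weaken) (use pot' in auto)
      have "hr (Asg vo (Ix cBO (V vl))) m1 20 (\<lambda>m'. m' = m2)"
        by (rule hr_loopfree) (simp_all add: m2_def m1_vars m1_cols o'_def)
      then show "hp (Asg vo (Ix cBO (V vl)) ;; upd (- 1) ;; record_edge) m1 (R + 100 + potential W m) ?Q"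
      proof (rule hp_Seq[OF hp_hr])
        fix m' assume "m' = m2"
        then show "\<exists>p'. 20 + p' \<le> R + 100 + potential W m \<and> hp (upd (- 1) ;; record_edge) m' p' ?Q"
          using * by (intro exI[of _ "R + 80 + potential W m"]) auto
      qed
    next
      assume "aval (Minus (Ix cY2 (Ix cBO (V vl))) (Ix cY2 (V vw))) m1 \<le> 0"
      then have worse: "y2 o' \<le> y2 w" using m1_vars m1_cols Y by (simp add: o'_def)
      have "sweep_inv (ar m cLam) (ar m cPrd) k (ar m cBE) (ar m cBO) PL (insert e0 PU)"
        by (rule sweep_inv_skip[OF SI e[folded e0_def]]) (use worse kl w in \<open>auto simp: l_def o'_def\<close>)
      then have "sweep_st t PL (insert e0 PU) W m1"
        using S inp1 graph1 m1_cols m1_vars sameD1[OF s1, of vx] by (simp add: sweep_st_def k_def)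
      moreover have "counts_ok (t + 1) m1" using cnt0 m1_cols m1_vars by (simp add: counts_ok_def)
      moreover have "same m m1 {cBE, cBO, cD} {vk, vq, vl, vw, vo, vs, vse, vc}" by (rule same_mono[OF s1]) auto
      moreover have "potential W m1 = potential W m" using m1_cols m1_vars by (simp add: potential_def k_def)
      ultimately have Q: "?Q m1 (R + potential W m)" by (intro exI[of _ W]) (auto simp: e0_def)
      have "hr Skip m1 0 (\<lambda>m'. m' = m1)" by (rule hr_loopfree) simp_all
      then show "hp Skip m1 (R + 100 + potential W m) ?Q"
      proof (rule hp_hr)
        fix m' assume "m' = m1"
        then show "\<exists>p'. 0 + p' \<le> R + 100 + potential W m \<and> ?Q m' p'"
          using Q by (intro exI[of _ "R + potential W m"]) simp
      qed
    qed simp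
  qed simp
  have "hr push_pre m 150 (\<lambda>m'. m' = m1)"
    by (rule hr_loopfree) (simp_all only: pre, simp_all add: push_pre_def)
  then show ?thesis
    unfolding push_edge_def
  proof (rule hp_Seq[OF hp_hr])
    fix m' assume "m' = m1"
    then show "\<exists>p'. 150 + p' \<le> R + 400 + potential W m \<and> hp (Cond (Minus (V vl) (V vk)) (Asg vk (V vl) ;; record_edge)
       (Cond (Minus (Ix cY2 (Ix cBO (V vl))) (Ix cY2 (V vw)))
          (Asg vo (Ix cBO (V vl)) ;; upd (- 1) ;; record_edge) Skip)) m' p' ?Q"
      using rest by (intro exI[of _ "R + 200 + potential W m"]) simp
  qed
qed

text \<open>The edges with \<open>X2 e = t\<close> join \<open>a\<close> to the neighbours that end
  earlier. An edge to a neighbour that ends later is pushed at the right end of that neighbour, and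
  the strict comparison also discards \<open>a\<close> itself, which is in its own list.\<close>

lemma push_loop_ok:
  assumes st: "sweep_st t {e \<in> edges. X1 e < t} {e \<in> edges. X2 e < t} W m"
    and cnt: "counts_ok (t + 1) m"
    and a: "a \<in> {0..<n}" "t = x2 a" "ar m 31 vv = a" "ar m 31 vp = n * a" "ar m 31 vpe = n * a + int (deg a)"
    and W: "\<And>w. w \<in> W \<Longrightarrow> x2 w < t"
  shows "hp push_loop m (R + 700 * (deg a + 1) + potential W m)
    (\<lambda>m' p'. \<exists>W'. sweep_st t {e \<in> edges. X1 e < t} {e \<in> edges. X2 e < t + 1} W' m' \<and>
       counts_ok (t + 1) m' \<and> (\<forall>w\<in>W'. x2 w \<le> t) \<and> R + potential W' m' \<le> p')"
proof -
  define A where "A i = ar m cAdj (n * a + i)" for i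
  note S = st[unfolded sweep_st_def]
  have inp: "input_ok m" and graph: "graph_ok m" using S by auto
  have bij: "bij_betw A {0..<int (deg a)} (nbrs a)"
    using graph a unfolding graph_ok_def A_def by auto
  let ?PL = "{e \<in> edges. X1 e < t}"
  define PU where "PU i = {e \<in> edges. X2 e < t} \<union> {mk_edge a b | b. b \<in> A ` {0..<i} \<and> x2 b < t}" for i
  have new_edge: "mk_edge a b \<in> edges \<and> X2 (mk_edge a b) = t" if "b \<in> nbrs a" "x2 b < t" for b
    using mk_edge_edges[OF that(1)] that a mk_edge_bounds(1)[of a b] by auto
  have PU_end: "PU (int (deg a)) = {e \<in> edges. X2 e < t + 1}"
  proof -
    have "A ` {0..<int (deg a)} = nbrs a" using bij by (simp add: bij_betw_def)
    moreover have "{mk_edge a b | b. b \<in> nbrs a \<and> x2 b < t} = {e \<in> edges. X2 e = t}"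
    proof (intro equalityI subsetI)
      fix e assume "e \<in> {mk_edge a b | b. b \<in> nbrs a \<and> x2 b < t}"
      then show "e \<in> {e \<in> edges. X2 e = t}" using new_edge by blast
    next
      fix e assume e: "e \<in> {e \<in> edges. X2 e = t}"
      then have ed: "fst e \<in> {0..<n}" "snd e \<in> {0..<n}" "x1 (fst e) < x1 (snd e)" "meets (fst e) (snd e)"
        using edgesD by auto
      then have ne: "x2 (fst e) \<noteq> x2 (snd e)" using x2_inj[of "fst e" "snd e"] by auto
      consider "x2 (fst e) = t" "x2 (snd e) < t" | "x2 (snd e) = t" "x2 (fst e) < t"
        using e ne by (auto simp: X2_def max_def split: if_splits)
      then show "e \<in> {mk_edge a b | b. b \<in> nbrs a \<and> x2 b < t}"
      proof cases
        case 1
        then have "fst e = a" using x2_inj[of "fst e" a] ed a by simp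
        then have "e = mk_edge a (snd e)" "snd e \<in> nbrs a"
          using ed by (auto simp: mk_edge_def nbrs_def prod_eq_iff)
        then show ?thesis using 1 by blast
      next
        case 2
        then have "snd e = a" using x2_inj[of "snd e" a] ed a by simp
        then have "e = mk_edge a (fst e)" "fst e \<in> nbrs a"
          using ed meets_sym[of a "fst e"] by (auto simp: mk_edge_def nbrs_def prod_eq_iff)
        then show ?thesis using 2 by blast
      qed
    qed
    ultimately have "PU (int (deg a)) = {e \<in> edges. X2 e < t} \<union> {e \<in> edges. X2 e = t}"
      by (simp add: PU_def)
    also have "\<dots> = {e \<in> edges. X2 e < t + 1}" by auto
    finally show ?thesis .
  qed
  define inv where "inv i U m' \<longleftrightarrow> 0 \<le> i \<and> i \<le> int (deg a) \<and> ar m' 31 vp = n * a + i \<and>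
      sweep_st t ?PL (PU i) U m' \<and> counts_ok (t + 1) m' \<and> (\<forall>w\<in>U. x2 w \<le> t) \<and>
      same m m' {cBE, cBO, cD} {vk, vq, vl, vw, vo, vs, vse, vc, vb, vp}" for i U m'
  have inv0: "inv 0 W m" using st a cnt W by (force simp: inv_def PU_def)
  define J where "J m' p' \<longleftrightarrow> (\<exists>U i. inv i U m' \<and> R + 10 + 650 * nat (int (deg a) - i) + potential U m' \<le> p')" for m' p'
  have vpe: "ar m' 31 vpe = n * a + int (deg a)" if "inv i U m'" for i U m'
    using that sameD1[of m m' _ _ vpe] a by (auto simp: inv_def)
  have step: "hp push_body m' (630 + (R + 10 + 650 * nat (int (deg a) - (i + 1))) + potential U m') J"
    if inv: "inv i U m'" and i: "i < int (deg a)" for i U m'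
  proof -
    let ?R = "R + 10 + 650 * nat (int (deg a) - (i + 1))"
    note I = inv[unfolded inv_def]
    have st': "sweep_st t ?PL (PU i) U m'" and cnt': "counts_ok (t + 1) m'"
      and same: "same m m' {cBE, cBO, cD} {vk, vq, vl, vw, vo, vs, vse, vc, vb, vp}" using I by auto
    note S' = st'[unfolded sweep_st_def]
    have i0: "i \<in> {0..<int (deg a)}" using I i by auto
    define b where "b = A i"
    have bn: "b \<in> nbrs a" unfolding b_def using bij_betwE[OF bij] i0 by blast
    then have bV: "b \<in> {0..<n}" using nbrs_subset by blast
    have eqs: "ar m' cAdj = ar m cAdj" "ar m' 31 vv = a" "ar m' 31 vx = t" "ar m' 31 vp = n * a + i"
      using sameD[OF same, of cAdj] sameD1[OF same, of vv] sameD1[OF same, of vx] a S I by auto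
    have Adj: "ar m cAdj (n * a + i) = b" by (simp add: A_def b_def)
    have prefix: "A ` {0..<i + 1} = insert b (A ` {0..<i})"
    proof -
      have "{0..<i + 1} = insert i {0..<i}" using i0 by auto
      then show ?thesis by (simp add: b_def)
    qed
    define m1 where "m1 = m'(loc 31 vb := b, loc 31 vp := n * a + i + 1)"
    have s1: "same m' m1 {} {vb, vp}" by (simp add: m1_def)
    have inp1: "input_ok m1" by (rule input_ok_same[OF _ s1]) (use S' in auto)
    have graph1: "graph_ok m1" by (rule graph_ok_same[OF _ s1]) (use S' in auto)
    have cols: "ar m1 c = ar m' c" if "c < 32" "c \<noteq> 31" for c using that by (simp add: m1_def)
    have vars1: "ar m1 31 vk = ar m' 31 vk" "ar m1 31 vv = a" "ar m1 31 vb = b" "ar m1 31 vx = t"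
      "ar m1 31 vp = n * a + (i + 1)"
      using eqs by (simp_all add: m1_def)
    have st1: "sweep_st t ?PL (PU i) U m1" using S' inp1 graph1 by (simp add: sweep_st_def cols vars1)
    have cnt1: "counts_ok (t + 1) m1" using cnt' by (simp add: counts_ok_def cols vars1)
    have pot1: "potential U m1 = potential U m'" by (simp add: potential_def cols vars1)
    have x2b: "ar m1 cX2 b = x2 b" using inp1 bV by (auto simp: input_ok_def)
    have same1: "same m m1 {cBE, cBO, cD} {vk, vq, vl, vw, vo, vs, vse, vc, vb, vp}"
      by (rule same_trans[OF same s1]) auto
    have rest: "hp (Cond (Minus (V vx) (Ix cX2 (V vb))) push_edge Skip) m1 (?R + 500 + potential U m') J"
    proof (rule hp_Cond[where p = "?R + 400 + potential U m'"])
      assume "0 < aval (Minus (V vx) (Ix cX2 (V vb))) m1"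
      then have lt: "x2 b < t" using vars1 x2b by simp
      note ne = new_edge[OF bn lt]
      have PUi: "PU (i + 1) = insert (mk_edge a b) (PU i)" unfolding PU_def prefix using lt by auto
      have "hp push_edge m1 (?R + 400 + potential U m1)
        (\<lambda>m' p'. \<exists>W'. sweep_st t ?PL (insert (mk_edge a b) (PU i)) W' m' \<and> counts_ok (t + 1) m' \<and>
           W' \<subseteq> insert a (insert b U) \<and>
           same m1 m' {cBE, cBO, cD} {vk, vq, vl, vw, vo, vs, vse, vc} \<and> ?R + potential W' m' \<le> p')"
      proof (rule push_edge_ok[OF st1 cnt1 a(1,2) vars1(2) bn lt vars1(3)])
        show "mk_edge a b \<in> ?PL" using ne edge_bounds[of "mk_edge a b"] by auto
        show "f \<in> PU i" if "f \<in> edges" "X2 f < t" for f using that by (simp add: PU_def)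
        show "X2 f \<le> t" if "f \<in> PU i" for f
        proof -
          have "A ` {0..<i} \<subseteq> nbrs a" using bij i by (auto simp: bij_betw_def)
          then show ?thesis using that new_edge by (force simp: PU_def)
        qed
      qed
      then show "hp push_edge m1 (?R + 400 + potential U m') J"
      proof (rule hp_weaken)
        fix m'' p''
        assume "\<exists>W'. sweep_st t ?PL (insert (mk_edge a b) (PU i)) W' m'' \<and> counts_ok (t + 1) m'' \<and>
           W' \<subseteq> insert a (insert b U) \<and>
           same m1 m'' {cBE, cBO, cD} {vk, vq, vl, vw, vo, vs, vse, vc} \<and> ?R + potential W' m'' \<le> p''"
        then obtain W' where W': "sweep_st t ?PL (PU (i + 1)) W' m''" "counts_ok (t + 1) m''"
           "W' \<subseteq> insert a (insert b U)" "?R + potential W' m'' \<le> p''"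
           and s2: "same m1 m'' {cBE, cBO, cD} {vk, vq, vl, vw, vo, vs, vse, vc}" unfolding PUi by blast
        have "same m m'' {cBE, cBO, cD} {vk, vq, vl, vw, vo, vs, vse, vc, vb, vp}"
          by (rule same_trans[OF same1 s2]) auto
        moreover have "ar m'' 31 vp = n * a + (i + 1)" using sameD1[OF s2, of vp] vars1 by simp
        moreover have "\<forall>w\<in>W'. x2 w \<le> t" using W'(3) I lt a(2) by auto
        ultimately have "inv (i + 1) W' m''" unfolding inv_def using W' i0 by simp
        then show "J m'' p''" unfolding J_def using W'(4) by blast
      qed (simp add: pot1)
    next
      assume "aval (Minus (V vx) (Ix cX2 (V vb))) m1 \<le> 0"
      then have "\<not> x2 b < t" using vars1 x2b by simp
      then have "PU (i + 1) = PU i" unfolding PU_def prefix by auto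
      then have "inv (i + 1) U m1" unfolding inv_def using st1 cnt1 same1 I i0 vars1 by simp
      then have "J m1 (?R + potential U m1)" unfolding J_def by blast
      moreover have "hr Skip m1 0 (\<lambda>m'. m' = m1)" by (rule hr_loopfree) simp_all
      ultimately show "hp Skip m1 (?R + 400 + potential U m') J"
        by (elim hp_hr) (auto simp: pot1 intro: exI[of _ "?R + potential U m'"])
    qed simp
    have "hr (Asg vb (Ix cAdj (V vp)) ;; Asg vp (Plus (V vp) (N 1))) m' 50 (\<lambda>m''. m'' = m1)"
      by (rule hr_loopfree) (simp_all add: m1_def eqs Adj)
    then show ?thesis
      unfolding push_body_def
    proof (rule hp_Seq[OF hp_hr])
      fix m'' assume "m'' = m1"
      then show "\<exists>p'. 50 + p' \<le> 630 + ?R + potential U m' \<and>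
          hp (Cond (Minus (V vx) (Ix cX2 (V vb))) push_edge Skip) m'' p' J"
        using rest by (intro exI[of _ "?R + 500 + potential U m'"]) simp
    qed
  qed
  show ?thesis
    unfolding push_loop_def
  proof (rule hp_While[where I = J])
    show "J m (R + 700 * (deg a + 1) + potential W m)"
      unfolding J_def using inv0 by (intro exI[of _ W] exI[of _ 0]) simp
  next
    fix m' p assume J: "J m' p" and g: "0 < aval (Minus (V vpe) (V vp)) m'"
    then obtain U i where U: "inv i U m'" "R + 10 + 650 * nat (int (deg a) - i) + potential U m' \<le> p"
      unfolding J_def by blast
    have i: "i < int (deg a)" using U(1) g vpe[OF U(1)] by (auto simp: inv_def)
    then have "650 * nat (int (deg a) - i) = 650 + 650 * nat (int (deg a) - (i + 1))" by simp
    then show "\<exists>q. ecost (Minus (V vpe) (V vp)) + 3 + q \<le> p \<and> hp push_body m' q J"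
      using step[OF U(1) i] U(2) by (intro exI[of _ "630 + (R + 10 + 650 * nat (int (deg a) - (i + 1))) + potential U m'"]) simp
  next
    fix m' p assume J: "J m' p" and g: "aval (Minus (V vpe) (V vp)) m' \<le> 0"
    then obtain U i where U: "inv i U m'" "R + 10 + 650 * nat (int (deg a) - i) + potential U m' \<le> p"
      unfolding J_def by blast
    have i: "i = int (deg a)" using U(1) g vpe[OF U(1)] by (auto simp: inv_def)
    then show "\<exists>q. ecost (Minus (V vpe) (V vp)) + 1 + q \<le> p \<and>
      (\<exists>W'. sweep_st t ?PL {e \<in> edges. X2 e < t + 1} W' m' \<and>
       counts_ok (t + 1) m' \<and> (\<forall>w\<in>W'. x2 w \<le> t) \<and> R + potential W' m' \<le> q)"
      using U PU_end by (intro exI[of _ "R + potential U m'"] conjI exI[of _ U]) (auto simp: inv_def)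
  qed
qed

definition sweep_all :: "int \<Rightarrow> int set \<Rightarrow> (int \<Rightarrow> int) \<Rightarrow> bool" where
  "sweep_all t W m \<longleftrightarrow> 1 \<le> t \<and> t \<le> 2 * n + 1 \<and>
     sweep_st t {e \<in> edges. X1 e < t} {e \<in> edges. X2 e < t} W m \<and> counts_ok t m \<and> (\<forall>w\<in>W. x2 w < t)"

lemma counts_ok_mono: "counts_ok t m \<Longrightarrow> t \<le> t' \<Longrightarrow> counts_ok t' m"
  unfolding counts_ok_def by (rule count_inv_mono)

text \<open>No coordinate is both a left and a right end. At a left end no edge ends and at a right
  end none begins, so both edge sets advance to \<open>t + 1\<close> although only one of the loops
  is run.\<close>

lemma sweep_body_ok:
  assumes all: "sweep_all t W m" and t: "t \<in> {1..2 * n}"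
  shows "hp sweep_body m (R + 150 + 700 * (deg (owner t) + 1) + potential W m)
    (\<lambda>m' p'. \<exists>W'. sweep_all (t + 1) W' m' \<and> R + potential W' m' \<le> p')" (is "hp _ _ _ ?Q")
proof -
  define a where "a = owner t"
  have aV: "a \<in> {0..<n}" unfolding a_def using t x_cases by blast
  note H = all[unfolded sweep_all_def]
  have st: "sweep_st t {e \<in> edges. X1 e < t} {e \<in> edges. X2 e < t} W m" and cnt: "counts_ok t m"
    and W: "\<And>w. w \<in> W \<Longrightarrow> x2 w < t" using H by auto
  note S = st[unfolded sweep_st_def]
  have inp: "input_ok m" and graph: "graph_ok m" and vx: "ar m 31 vx = t" using S by auto
  define m1 where "m1 = m(loc 31 vv := a, loc 31 vp := n * a, loc 31 vpe := n * a + int (deg a))"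
  have "ar m cXV t = a" "ar m cRow a = n * a" "ar m cDeg a = int (deg a)"
    using inp graph t aV by (auto simp: input_ok_def graph_ok_def a_def)
  then have pre: "sem event_pre m = m1" by (simp add: event_pre_def m1_def vx)
  have s1: "same m m1 {} {vv, vp, vpe}" by (simp add: m1_def)
  have inp1: "input_ok m1" by (rule input_ok_same[OF inp s1]) auto
  have graph1: "graph_ok m1" by (rule graph_ok_same[OF graph s1]) auto
  have cols: "ar m1 c = ar m c" if "c < 32" "c \<noteq> 31" for c using that by (simp add: m1_def)
  have vars1: "ar m1 31 vk = ar m 31 vk" "ar m1 31 vx = t" "ar m1 31 vv = a" "ar m1 31 vp = n * a"
    "ar m1 31 vpe = n * a + int (deg a)"
    by (simp_all add: m1_def vx)
  have st1: "sweep_st t {e \<in> edges. X1 e < t} {e \<in> edges. X2 e < t} W m1"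
    using S inp1 graph1 by (simp add: sweep_st_def cols vars1)
  have cnt1: "counts_ok t m1" using cnt by (simp add: counts_ok_def cols vars1)
  have pot1: "potential W m1 = potential W m" by (simp add: potential_def cols vars1)
  have x2a: "ar m1 cX2 a = x2 a" using inp1 aV by (auto simp: input_ok_def)
  define Q1 where "Q1 m' p' \<longleftrightarrow> (\<exists>W'. sweep_st t {e \<in> edges. X1 e < t + 1} {e \<in> edges. X2 e < t + 1} W' m' \<and>
     counts_ok (t + 1) m' \<and> (\<forall>w\<in>W'. x2 w \<le> t) \<and> R + 20 + potential W' m' \<le> p')" for m' p'
  have "hp (Cond (Minus (Ix cX2 (V vv)) (V vx)) label_loop push_loop) m1
      (R + 20 + 50 + 700 * (deg a + 1) + potential W m) Q1"
  proof (rule hp_Cond[where p = "R + 20 + 700 * (deg a + 1) + potential W m"])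
    assume "0 < aval (Minus (Ix cX2 (V vv)) (V vx)) m1"
    then have "t < x2 a" using vars1 x2a by simp
    then have ta: "t = x1 a" unfolding a_def using x_cases[OF t] by force
    have "{e \<in> edges. X2 e < t + 1} = {e \<in> edges. X2 e < t}"
    proof -
      have "X2 e \<noteq> t" if "e \<in> edges" for e
        using edgesD[OF that] x1_neq_x2[OF aV, of "fst e"] x1_neq_x2[OF aV, of "snd e"] ta
        by (auto simp: X2_def max_def)
      then show ?thesis by force
    qed
    note PU = this
    show "hp label_loop m1 (R + 20 + 700 * (deg a + 1) + potential W m) Q1"
    proof (rule hp_hr[OF label_loop_ok[OF st1 cnt1 aV ta vars1(3,4,5) W]])
      fix m' assume m': "sweep_st t {e \<in> edges. X1 e < t + 1} {e \<in> edges. X2 e < t} W m' \<and>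
        same m1 m' {cLam, cPrd, cEU, cEW} {vb, vp, vl, vq}"
      then have s2: "same m1 m' {cLam, cPrd, cEU, cEW} {vb, vp, vl, vq}" by blast
      have eqs: "ar m' cD = ar m cD" "ar m' cBO = ar m cBO" "ar m' 31 vk = ar m 31 vk"
        using sameD[OF s2, of cD] sameD[OF s2, of cBO] sameD1[OF s2, of vk] cols vars1 by auto
      then have "counts_ok (t + 1) m'" "potential W m' = potential W m"
        using counts_ok_mono[OF cnt, of "t + 1"] by (auto simp: counts_ok_def potential_def)
      then have "Q1 m' (R + 20 + potential W m)"
        unfolding Q1_def PU using m' W by (intro exI[of _ W]) force
      then show "\<exists>p'. 500 * (deg a + 1) + p' \<le> R + 20 + 700 * (deg a + 1) + potential W m \<and> Q1 m' p'"
        by (intro exI[of _ "R + 20 + potential W m"]) simp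
    qed
  next
    assume "aval (Minus (Ix cX2 (V vv)) (V vx)) m1 \<le> 0"
    then have "\<not> t < x2 a" using vars1 x2a by simp
    then have ta: "t = x2 a" unfolding a_def using x_cases[OF t] by force
    have "{e \<in> edges. X1 e < t + 1} = {e \<in> edges. X1 e < t}"
    proof -
      have "X1 e \<noteq> t" if "e \<in> edges" for e
        using edgesD[OF that] x1_neq_x2[OF _ aV] ta by (auto simp: X1_def)
      then show ?thesis by force
    qed
    note PL = this
    have cnt2: "counts_ok (t + 1) m1" using counts_ok_mono[OF cnt1] by simp
    have "hp push_loop m1 (R + 20 + 700 * (deg a + 1) + potential W m1) Q1"
      unfolding Q1_def PL by (rule push_loop_ok[OF st1 cnt2 aV ta vars1(3,4,5) W])
    then show "hp push_loop m1 (R + 20 + 700 * (deg a + 1) + potential W m) Q1"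
      by (simp only: pot1)
  qed simp
  then have loops: "hp (Cond (Minus (Ix cX2 (V vv)) (V vx)) label_loop push_loop ;; Asg vx (Plus (V vx) (N 1))) m1
      (R + 70 + 700 * (deg a + 1) + potential W m) ?Q"
  proof (intro hp_Seq, elim hp_weaken)
    fix m' p' assume "Q1 m' p'"
    then obtain W' where W': "sweep_st t {e \<in> edges. X1 e < t + 1} {e \<in> edges. X2 e < t + 1} W' m'"
      "counts_ok (t + 1) m'" "\<forall>w\<in>W'. x2 w \<le> t" "R + 20 + potential W' m' \<le> p'"
      unfolding Q1_def by blast
    define m2 where "m2 = m'(loc 31 vx := t + 1)"
    have "ar m' 31 vx = t" using W'(1) by (simp add: sweep_st_def)
    then have hr: "hr (Asg vx (Plus (V vx) (N 1))) m' 20 (\<lambda>m''. m'' = m2)"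
      by (intro hr_loopfree) (simp_all add: m2_def)
    have s2: "same m' m2 {} {vx}" by (simp add: m2_def)
    have inp2: "input_ok m2" by (rule input_ok_same[OF _ s2]) (use W'(1) in \<open>auto simp: sweep_st_def\<close>)
    have graph2: "graph_ok m2" by (rule graph_ok_same[OF _ s2]) (use W'(1) in \<open>auto simp: sweep_st_def\<close>)
    have "sweep_st (t + 1) {e \<in> edges. X1 e < t + 1} {e \<in> edges. X2 e < t + 1} W' m2"
      using W'(1) inp2 graph2 by (simp add: sweep_st_def m2_def)
    moreover have "counts_ok (t + 1) m2" using W'(2) by (simp add: counts_ok_def m2_def)
    ultimately have "sweep_all (t + 1) W' m2" using W'(3) t by (auto simp: sweep_all_def)
    moreover have "potential W' m2 = potential W' m'" by (simp add: potential_def m2_def)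
    ultimately have "?Q m2 (R + potential W' m')" by (intro exI[of _ W']) simp
    then show "hp (Asg vx (Plus (V vx) (N 1))) m' p' ?Q"
      using hr W'(4) by (elim hp_hr) (auto intro!: exI[of _ "R + potential W' m'"])
  qed simp
  have "hr event_pre m 60 (\<lambda>m'. m' = m1)"
    by (rule hr_loopfree) (simp_all only: pre, simp_all add: event_pre_def)
  then show ?thesis
    unfolding sweep_body_def a_def[symmetric]
  proof (rule hp_Seq[OF hp_hr])
    fix m' assume "m' = m1"
    then show "\<exists>p'. 60 + p' \<le> R + 150 + 700 * (deg a + 1) + potential W m \<and>
        hp (Cond (Minus (Ix cX2 (V vv)) (V vx)) label_loop push_loop ;; Asg vx (Plus (V vx) (N 1))) m' p' ?Q"
      using loops by (intro exI[of _ "R + 70 + 700 * (deg a + 1) + potential W m"]) simp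
  qed
qed

lemma sweep_loop_ok:
  assumes inp: "input_ok m" and graph: "graph_ok m" and vars: "ar m 31 vx = 1" "ar m 31 vk = 0"
    and D: "\<And>v. 0 \<le> v \<Longrightarrow> ar m cD v = 0"
  shows "hr sweep_loop m (10000 * (card edges + nat n) + 100)
    (\<lambda>m'. \<exists>W. sweep_st (2 * n + 1) edges edges W m')"
proof -
  define J where "J m' p \<longleftrightarrow> (\<exists>t W. sweep_all t W m' \<and>
    30 + (\<Sum>x\<in>{t..2 * n}. 900 * (deg (owner x) + 1)) + potential W m' \<le> p)" for m' p
  have "{e \<in> edges. X1 e < 1} = {}" "{e \<in> edges. X2 e < 1} = {}" using edge_bounds by force+
  note empty = this
  have init: "sweep_all 1 {} m"
    using inp graph vars D n_nonneg unfolding sweep_all_def empty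
    by (simp add: sweep_st_def sweep_inv_def rec_inv_def counts_ok_def count_inv_def)
  \<comment> \<open>No level exists yet, so the potential consists of the double reserve of all
    vertices.\<close>
  have "potential {} m = 2000 * (\<Sum>v\<in>{0..<n}. deg v + 1)" by (simp add: potential_def vars)
  also have "(\<Sum>v\<in>{0..<n}. deg v + 1) = 2 * card edges + 2 * nat n"
    by (simp only: sum.distrib sum_deg sum_constant) simp
  finally have pot: "potential {} m = 4000 * (card edges + nat n)" by simp
  have "(\<Sum>a\<in>{1..2 * n}. deg (owner a)) = 4 * card edges + 2 * nat n"
    using sum_deg_owner sum_deg by simp
  moreover have "card {1..2 * n} = 2 * nat n" by simp
  ultimately have "(\<Sum>a\<in>{1..2 * n}. deg (owner a) + 1) = 4 * (card edges + nat n)"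
    by (simp only: sum.distrib sum_constant) simp
  then have sums: "(\<Sum>a\<in>{1..2 * n}. 900 * (deg (owner a) + 1)) = 3600 * (card edges + nat n)"
    by (simp only: sum_distrib_left[symmetric])
  have vn: "ar m' 31 vn = n" "ar m' 31 vx = t" if "sweep_all t W m'" for t W m'
    using that by (auto simp: sweep_all_def sweep_st_def input_ok_def)
  have "hp sweep_loop m (10000 * (card edges + nat n) + 100) (\<lambda>m' _. \<exists>W. sweep_st (2 * n + 1) edges edges W m')"
    unfolding sweep_loop_def
  proof (rule hp_While[where I = J])
    show "J m (10000 * (card edges + nat n) + 100)"
      unfolding J_def using init pot sums by (intro exI[of _ 1] exI[of _ "{}"]) simp
  next
    fix m' p assume "J m' p" and g: "0 < aval (Minus (Plus (Plus (V vn) (V vn)) (N 1)) (V vx)) m'"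
    then obtain t W where tW: "sweep_all t W m'"
      "30 + (\<Sum>x\<in>{t..2 * n}. 900 * (deg (owner x) + 1)) + potential W m' \<le> p"
      unfolding J_def by blast
    have t: "t \<in> {1..2 * n}" using g vn[OF tW(1)] tW(1) by (auto simp: sweep_all_def)
    let ?R = "30 + (\<Sum>x\<in>{t + 1..2 * n}. 900 * (deg (owner x) + 1))"
    have "{t..2 * n} = insert t {t + 1..2 * n}" using t by auto
    then have s: "(\<Sum>x\<in>{t..2 * n}. 900 * (deg (owner x) + 1)) =
        900 * (deg (owner t) + 1) + (\<Sum>x\<in>{t + 1..2 * n}. 900 * (deg (owner x) + 1))" by simp
    have "hp sweep_body m' (?R + 150 + 700 * (deg (owner t) + 1) + potential W m') J"
      by (rule hp_weaken[OF sweep_body_ok[OF tW(1) t, of ?R] order_refl]) (auto simp: J_def)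
    then show "\<exists>q. ecost (Minus (Plus (Plus (V vn) (V vn)) (N 1)) (V vx)) + 3 + q \<le> p \<and> hp sweep_body m' q J"
      using tW(2) s by (intro exI[of _ "?R + 150 + 700 * (deg (owner t) + 1) + potential W m'"]) simp
  next
    fix m' p assume "J m' p" and g: "aval (Minus (Plus (Plus (V vn) (V vn)) (N 1)) (V vx)) m' \<le> 0"
    then obtain t W where tW: "sweep_all t W m'"
      "30 + (\<Sum>x\<in>{t..2 * n}. 900 * (deg (owner x) + 1)) + potential W m' \<le> p"
      unfolding J_def by blast
    have t: "t = 2 * n + 1" using g vn[OF tW(1)] tW(1) by (auto simp: sweep_all_def)
    have "{e \<in> edges. X1 e < t} = edges" "{e \<in> edges. X2 e < t} = edges" using edge_bounds t by force+
    then have "sweep_st (2 * n + 1) edges edges W m'" using tW(1) t by (simp add: sweep_all_def)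
    then show "\<exists>q. ecost (Minus (Plus (Plus (V vn) (V vn)) (N 1)) (V vx)) + 1 + q \<le> p \<and>
        (\<exists>W. sweep_st (2 * n + 1) edges edges W m')"
      using tW(2) by (intro exI[of _ 0]) auto
  qed
  then have "hr sweep_loop m (10000 * (card edges + nat n) + 100) (\<lambda>m'. \<exists>p' :: nat. \<exists>W. sweep_st (2 * n + 1) edges edges W m')"
    by (rule hr_hp)
  then show ?thesis by simp
qed

end

section \<open>Reading the model and writing the matching\<close>

lemma loc_neq_raw [simp]:
  "0 \<le> v \<Longrightarrow> - 64 < i \<Longrightarrow> i \<noteq> loc a v" "0 \<le> v \<Longrightarrow> - 64 < i \<Longrightarrow> loc a v \<noteq> i"
  by (auto simp: loc_def)

lemma ar_raw [simp]: "0 \<le> v \<Longrightarrow> - 64 < i \<Longrightarrow> ar (m(i := z)) a v = ar m a v"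
  by (auto simp: ar_def loc_def)

definition read_field :: "nat \<Rightarrow> nat \<Rightarrow> com" where
  "read_field c d =
     GetRaw vz (V vr) ;;
     (Put c (V vi) (V vz) ;; Put d (V vz) (V vi) ;; Asg vr (Plus (V vr) (N 1)))"

text \<open>\<open>vacc\<close> carries the product of \<open>n\<close> and the current index,
  obtained by additions.\<close>

definition read_post :: com where
  "read_post =
     Put cRow (V vi) (V vacc) ;;
     Asg vacc (Plus (V vacc) (V vn)) ;;
     Asg vi (Plus (V vi) (N 1))"

definition read_body :: com where
  "read_body = read_field cX1 cXV ;; read_field cX2 cXV ;; read_field cY1 cYV ;; read_field cY2 cYV ;; read_post"

definition read_loop :: com where
  "read_loop = While (Minus (V vn) (V vi)) read_body"

definition read_input :: com where
  "read_input = GetRaw vn (N 1) ;; Asg vr (N 2) ;; read_loop"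

text \<open>Predecessors are followed from the top level down, so the edges are written from right
  to left. The output starts at raw cell 2 and overwrites the input, which has been copied to the
  columns by then.\<close>

definition out_body :: com where
  "out_body =
     PutRaw (V vr) (Ix cEU (V vq)) ;;
     PutRaw (Plus (V vr) (N 1)) (Ix cEW (V vq)) ;;
     Asg vq (Ix cPrd (V vq)) ;;
     Asg vr (Plus (V vr) (N 2)) ;;
     Asg vj (Minus (V vj) (N 1))"

definition out_pre :: com where
  "out_pre = Asg vq (Ix cBE (V vk)) ;; Asg vj (V vk) ;; Asg vr (N 2)"

definition out_post :: com where
  "out_post = PutRaw (N (- 1)) (N 2) ;; PutRaw (N (- 2)) (V vk)"

definition write_output :: com where
  "write_output = out_pre ;; While (V vj) out_body ;; out_post"

definition prog :: com where
  "prog = read_input ;; Asg vx (N 1) ;; arcs_loop ;; Asg vx (N 1) ;; sweep_loop ;; write_output"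

lemma read_field_ok:
  assumes "ar m 31 vr = r" "ar m 31 vi = i" "0 \<le> r" "c < 31" "d < 31"
  shows "hr (read_field c d) m 100 (\<lambda>m'. m' = m(loc 31 vz := m r, loc c i := m r, loc d (m r) := i, loc 31 vr := r + 1))"
proof -
  let ?m1 = "m(loc 31 vz := m r)"
  have "hr (Put c (V vi) (V vz) ;; Put d (V vz) (V vi) ;; Asg vr (Plus (V vr) (N 1))) ?m1 60
      (\<lambda>m'. m' = ?m1(loc c i := m r, loc d (m r) := i, loc 31 vr := r + 1))"
    by (rule hr_loopfree) (use assms in simp_all)
  then have "hr (GetRaw vz (V vr)) m 10 (\<lambda>m'. hr (Put c (V vi) (V vz) ;; Put d (V vz) (V vi) ;; Asg vr (Plus (V vr) (N 1))) m' 60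
      (\<lambda>m'. m' = ?m1(loc c i := m r, loc d (m r) := i, loc 31 vr := r + 1)))"
    by (intro hr_GetRaw) (use assms in simp_all)
  then show ?thesis
    unfolding read_field_def by (rule hr_Seq) simp
qed

context trapezoids
begin

definition initial :: "(int \<Rightarrow> int) \<Rightarrow> bool" where
  "initial m \<longleftrightarrow> m 1 = n \<and> (\<forall>v\<in>{0..<n}. m (2 + 4 * v) = x1 v \<and> m (3 + 4 * v) = x2 v \<and>
     m (4 + 4 * v) = y1 v \<and> m (5 + 4 * v) = y2 v) \<and> (\<forall>a<32. \<forall>v\<ge>0. ar m a v = 0)"

definition read_inv :: "(int \<Rightarrow> int) \<Rightarrow> int \<Rightarrow> (int \<Rightarrow> int) \<Rightarrow> bool" where
  "read_inv m i m' \<longleftrightarrow> 0 \<le> i \<and> i \<le> n \<and> ar m' 31 vn = n \<and> ar m' 31 vi = i \<and> ar m' 31 vr = 2 + 4 * i \<and>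
     ar m' 31 vacc = n * i \<and> (\<forall>a\<ge>0. m' a = m a) \<and>
     (\<forall>v. 0 \<le> v \<longrightarrow> v < i \<longrightarrow> ar m' cX1 v = x1 v \<and> ar m' cX2 v = x2 v \<and> ar m' cY1 v = y1 v \<and> ar m' cY2 v = y2 v \<and>
        ar m' cRow v = n * v \<and> ar m' cXV (x1 v) = v \<and> ar m' cXV (x2 v) = v \<and>
        ar m' cYV (y1 v) = v \<and> ar m' cYV (y2 v) = v) \<and>
     same m m' {2..8} {vn, vi, vr, vacc, vz}"

lemma read_body_ok:
  assumes m0: "initial m" and inv: "read_inv m i m'" and i: "i < n"
  shows "hr read_body m' 500 (read_inv m (i + 1))"
proof -
  note I = inv[unfolded read_inv_def]
  have iV: "i \<in> {0..<n}" using I i by simp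
  have raw: "m' a = m a" if "0 \<le> a" for a using I that by blast
  have vals: "m' (2 + 4 * i) = x1 i" "m' (3 + 4 * i) = x2 i" "m' (4 + 4 * i) = y1 i" "m' (5 + 4 * i) = y2 i"
    using m0 iV by (simp_all add: initial_def raw)
  have pos: "0 \<le> x1 i" "0 \<le> x2 i" "0 \<le> y1 i" "0 \<le> y2 i"
    using x_range[OF iV] y_range[OF iV] x12[OF iV] y12[OF iV] by auto
  define m1 where "m1 = m'(loc 31 vz := x1 i, loc cX1 i := x1 i, loc cXV (x1 i) := i, loc 31 vr := 3 + 4 * i)"
  define m2 where "m2 = m1(loc 31 vz := x2 i, loc cX2 i := x2 i, loc cXV (x2 i) := i, loc 31 vr := 4 + 4 * i)"
  define m3 where "m3 = m2(loc 31 vz := y1 i, loc cY1 i := y1 i, loc cYV (y1 i) := i, loc 31 vr := 5 + 4 * i)"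
  define m4 where "m4 = m3(loc 31 vz := y2 i, loc cY2 i := y2 i, loc cYV (y2 i) := i, loc 31 vr := 6 + 4 * i)"
  define m5 where "m5 = m4(loc cRow i := n * i, loc 31 vacc := n * i + n, loc 31 vi := i + 1)"
  have raw1: "m1 a = m' a" if "0 \<le> a" for a using that pos iV by (simp add: m1_def)
  have raw2: "m2 a = m' a" if "0 \<le> a" for a using that pos iV raw1 by (simp add: m2_def)
  have raw3: "m3 a = m' a" if "0 \<le> a" for a using that pos iV raw2 by (simp add: m3_def)
  have raw4: "m4 a = m' a" if "0 \<le> a" for a using that pos iV raw3 by (simp add: m4_def)
  have raw5: "m5 a = m' a" if "0 \<le> a" for a using that pos iV raw4 by (simp add: m5_def)
  have i0: "0 \<le> i" using iV by simp
  have v1: "ar m' 31 vr = 2 + 4 * i" "ar m' 31 vi = i" using I by auto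
  have v2: "ar m1 31 vr = 3 + 4 * i" "ar m1 31 vi = i" using v1 by (simp_all add: m1_def)
  have v3: "ar m2 31 vr = 4 + 4 * i" "ar m2 31 vi = i" using v2 by (simp_all add: m2_def)
  have v4: "ar m3 31 vr = 5 + 4 * i" "ar m3 31 vi = i" using v3 by (simp_all add: m3_def)
  have succ: "2 + 4 * i + 1 = 3 + 4 * i" "3 + 4 * i + 1 = 4 + 4 * i" "4 + 4 * i + 1 = 5 + 4 * i" "5 + 4 * i + 1 = 6 + 4 * i"
    by simp_all
  have h1: "hr (read_field cX1 cXV) m' 100 (\<lambda>m''. m'' = m1)"
    using read_field_ok[OF v1, of cX1 cXV, unfolded vals succ] i0 unfolding m1_def by simp
  have vals1: "m1 (3 + 4 * i) = x2 i" using raw1[of "3 + 4 * i"] i0 vals by simp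
  have h2: "hr (read_field cX2 cXV) m1 100 (\<lambda>m''. m'' = m2)"
    using read_field_ok[OF v2, of cX2 cXV, unfolded vals1 succ] i0 unfolding m2_def by simp
  have vals2: "m2 (4 + 4 * i) = y1 i" using raw2[of "4 + 4 * i"] i0 vals by simp
  have h3: "hr (read_field cY1 cYV) m2 100 (\<lambda>m''. m'' = m3)"
    using read_field_ok[OF v3, of cY1 cYV, unfolded vals2 succ] i0 unfolding m3_def by simp
  have vals3: "m3 (5 + 4 * i) = y2 i" using raw3[of "5 + 4 * i"] i0 vals by simp
  have h4: "hr (read_field cY2 cYV) m3 100 (\<lambda>m''. m'' = m4)"
    using read_field_ok[OF v4, of cY2 cYV, unfolded vals3 succ] i0 unfolding m4_def by simp
  have "sem read_post m4 = m5"
    using I by (simp add: read_post_def m5_def) (simp add: m4_def m3_def m2_def m1_def)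
  then have h5: "hr read_post m4 100 (\<lambda>m''. m'' = m5)"
    by (intro hr_loopfree) (simp_all add: read_post_def)
  have final: "hr read_body m' 500 (\<lambda>m''. m'' = m5)"
    unfolding read_body_def
    apply (rule hr_Seq[where T = 100 and T' = 400, OF hr_weaken[OF h1 order_refl]]; simp)
    apply (rule hr_Seq[where T = 100 and T' = 300, OF hr_weaken[OF h2 order_refl]]; simp)
    apply (rule hr_Seq[where T = 100 and T' = 200, OF hr_weaken[OF h3 order_refl]]; simp)
    apply (rule hr_Seq[where T = 100 and T' = 100, OF hr_weaken[OF h4 order_refl]]; simp)
    apply (rule h5)
    done
  have new: "ar m5 cX1 v = x1 v \<and> ar m5 cX2 v = x2 v \<and> ar m5 cY1 v = y1 v \<and> ar m5 cY2 v = y2 v \<and>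
      ar m5 cRow v = n * v \<and> ar m5 cXV (x1 v) = v \<and> ar m5 cXV (x2 v) = v \<and>
      ar m5 cYV (y1 v) = v \<and> ar m5 cYV (y2 v) = v" if v: "0 \<le> v" "v < i + 1" for v
  proof (cases "v = i")
    case True
    then show ?thesis using x12[OF iV] y12[OF iV] by (simp add: m5_def m4_def m3_def m2_def m1_def)
  next
    case False
    then have vV: "v \<in> {0..<n}" "v < i" using v i by auto
    have "x1 v \<noteq> x1 i" "x2 v \<noteq> x2 i" "x1 v \<noteq> x2 i" "x2 v \<noteq> x1 i"
      "y1 v \<noteq> y1 i" "y2 v \<noteq> y2 i" "y1 v \<noteq> y2 i" "y2 v \<noteq> y1 i"
      using x1_inj[OF vV(1) iV] x2_inj[OF vV(1) iV] x1_neq_x2[OF vV(1) iV] x1_neq_x2[OF iV vV(1)]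
        y1_inj[OF vV(1) iV] y2_inj[OF vV(1) iV] y1_neq_y2[OF vV(1) iV] y1_neq_y2[OF iV vV(1)] False by auto
    then show ?thesis using I v vV False by (simp add: m5_def m4_def m3_def m2_def m1_def)
  qed
  have "same m m5 {2..8} {vn, vi, vr, vacc, vz}"
    using I by (simp add: m5_def m4_def m3_def m2_def m1_def)
  moreover have "ar m5 31 vn = n" "ar m5 31 vi = i + 1" "ar m5 31 vr = 2 + 4 * (i + 1)" "ar m5 31 vacc = n * (i + 1)"
    using I by (simp_all add: m5_def m4_def m3_def m2_def m1_def algebra_simps)
  ultimately have "read_inv m (i + 1) m5"
    unfolding read_inv_def using new raw5 raw iV by simp
  then show ?thesis by (intro hr_weaken[OF final order_refl]) simp
qed

lemma read_input_ok:
  assumes m0: "initial m"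
  shows "hr read_input m (600 * nat n + 100)
    (\<lambda>m'. input_ok m' \<and> same m m' {2..8} {vn, vi, vr, vacc, vz})"
proof -
  define m2 where "m2 = m(loc 31 vn := n, loc 31 vr := 2)"
  have "ar m 31 v = 0" if "0 \<le> v" for v using m0 that by (simp add: initial_def)
  moreover have "\<forall>a\<ge>0. m2 a = m a"
  proof (intro allI impI)
    fix a :: int assume "0 \<le> a"
    then show "m2 a = m a" by (simp add: m2_def)
  qed
  ultimately have inv0: "read_inv m 0 m2"
    using n_nonneg unfolding read_inv_def by (intro conjI) (auto simp: m2_def)
  have loop: "hr read_loop m2 (600 * nat n + 20) (\<lambda>m'. input_ok m' \<and> same m m' {2..8} {vn, vi, vr, vacc, vz})"
    unfolding read_loop_def
  proof (rule hr_While[where I = "\<lambda>m'. read_inv m (ar m' 31 vi) m'" and pot = "\<lambda>m'. 600 * nat (n - ar m' 31 vi)"])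
    show "read_inv m (ar m2 31 vi) m2" using inv0 by (simp add: read_inv_def)
  next
    fix m' assume inv: "read_inv m (ar m' 31 vi) m'" and g: "0 < aval (Minus (V vn) (V vi)) m'"
    then have i: "ar m' 31 vi < n" by (simp add: read_inv_def)
    have "hr read_body m' 500 (\<lambda>m''. read_inv m (ar m'' 31 vi) m'' \<and>
        ecost (Minus (V vn) (V vi)) + 3 + 500 + 600 * nat (n - ar m'' 31 vi) \<le> 600 * nat (n - ar m' 31 vi))"
      by (rule hr_weaken[OF read_body_ok[OF m0 inv i] order_refl]) (use i in \<open>auto simp: read_inv_def\<close>)
    then show "\<exists>T. hr read_body m' T (\<lambda>m''. read_inv m (ar m'' 31 vi) m'' \<and>
        ecost (Minus (V vn) (V vi)) + 3 + T + 600 * nat (n - ar m'' 31 vi) \<le> 600 * nat (n - ar m' 31 vi))" by blast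
  next
    fix m' assume inv: "read_inv m (ar m' 31 vi) m'" and g: "aval (Minus (V vn) (V vi)) m' \<le> 0"
    then have "ar m' 31 vi = n" by (simp add: read_inv_def)
    then have I: "read_inv m n m'" using inv by simp
    have "ar m' cXV x = owner x" if x: "x \<in> {1..2 * n}" for x
    proof -
      have "owner x \<in> {0..<n}" "x1 (owner x) = x \<or> x2 (owner x) = x" using x_cases[OF x] by metis+
      then show ?thesis using I unfolding read_inv_def by force
    qed
    then show "input_ok m' \<and> same m m' {2..8} {vn, vi, vr, vacc, vz}"
      using I by (simp add: input_ok_def read_inv_def)
  next
    have "ar m2 31 vi = 0" using inv0 by (simp add: read_inv_def)
    then show "600 * nat (n - ar m2 31 vi) + ecost (Minus (V vn) (V vi)) + 1 \<le> 600 * nat n + 20" by simp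
  qed
  have "hr (Asg vr (N 2)) (m(loc 31 vn := n)) 10 (\<lambda>m'. m' = m2)"
    by (rule hr_loopfree) (simp_all add: m2_def)
  then have "hr (Asg vr (N 2)) (m(loc 31 vn := n)) 10
      (\<lambda>m'. hr read_loop m' (600 * nat n + 20) (\<lambda>m'. input_ok m' \<and> same m m' {2..8} {vn, vi, vr, vacc, vz}))"
    by (rule hr_weaken[OF _ order_refl]) (use loop in simp)
  then have "hr (Asg vr (N 2) ;; read_loop) (m(loc 31 vn := n)) (600 * nat n + 30)
      (\<lambda>m'. input_ok m' \<and> same m m' {2..8} {vn, vi, vr, vacc, vz})"
    by (rule hr_Seq) simp
  then have "hr (GetRaw vn (N 1)) m 10 (\<lambda>m'. hr (Asg vr (N 2) ;; read_loop) m' (600 * nat n + 30)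
      (\<lambda>m'. input_ok m' \<and> same m m' {2..8} {vn, vi, vr, vacc, vz}))"
    by (intro hr_GetRaw) (use m0 in \<open>simp_all add: initial_def\<close>)
  then show ?thesis
    unfolding read_input_def by (rule hr_Seq) simp
qed

section \<open>Writing a longest chain\<close>

definition chain :: "(int \<times> int) list \<Rightarrow> bool" where
  "chain es \<longleftrightarrow> set es \<subseteq> edges \<and> sorted_wrt (\<lambda>e f. eleft f e) es"

lemma eleft_trans: "eleft e f \<Longrightarrow> eleft f g \<Longrightarrow> f \<in> edges \<Longrightarrow> eleft e g"
  using edge_bounds[of f] by (auto simp: eleft_def)

text \<open>Nonnegative raw addresses are columns at negative indices, so writing the output
  violates \<open>same\<close>; the frame is therefore stated for nonnegative indices only. For
  \<open>j = 0\<close> nothing is required of \<open>vq\<close>, because the predecessor of an edge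
  of level 1 is arbitrary.\<close>

definition out_inv :: "(int \<Rightarrow> int) \<Rightarrow> int \<Rightarrow> (int \<Rightarrow> int) \<Rightarrow> bool" where
  "out_inv m j m' \<longleftrightarrow> 0 \<le> j \<and> j \<le> ar m 31 vk \<and> ar m' 31 vj = j \<and> ar m' 31 vk = ar m 31 vk \<and>
     ar m' 31 vr = 2 + 2 * (ar m 31 vk - j) \<and>
     (\<forall>a<31. \<forall>v\<ge>0. ar m' a v = ar m a v) \<and>
     (\<exists>es. length es = nat (ar m 31 vk - j) \<and> chain es \<and>
        (\<forall>i<length es. m' (2 + 2 * int i) = fst (es ! i) \<and> m' (3 + 2 * int i) = snd (es ! i)) \<and>
        (0 < j \<longrightarrow> (\<exists>e\<in>edges. ar m' 31 vq = cd e \<and> ar m cLam (cd e) = j \<and> (\<forall>f\<in>set es. eleft e f))))"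

lemma out_body_ok:
  assumes SI: "sweep_inv (ar m cLam) (ar m cPrd) (ar m 31 vk) (ar m cBE) (ar m cBO) edges edges"
    and EU: "\<And>e. e \<in> edges \<Longrightarrow> ar m cEU (cd e) = fst e \<and> ar m cEW (cd e) = snd e"
    and inv: "out_inv m j m'" and j: "0 < j"
  shows "out_inv m (j - 1) (sem out_body m')"
proof -
  define k where "k = ar m 31 vk"
  note I = inv[unfolded out_inv_def, folded k_def]
  have jk: "j \<le> k" "ar m' 31 vj = j" "ar m' 31 vk = k" "ar m' 31 vr = 2 + 2 * (k - j)" using I by auto
  obtain es e where es: "length es = nat (k - j)" "chain es"
    "\<And>i. i < length es \<Longrightarrow> m' (2 + 2 * int i) = fst (es ! i) \<and> m' (3 + 2 * int i) = snd (es ! i)"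
    and e: "e \<in> edges" "ar m' 31 vq = cd e" "ar m cLam (cd e) = j" "\<And>f. f \<in> set es \<Longrightarrow> eleft e f"
    using I j by blast
  have cd0: "0 \<le> cd f" if "f \<in> edges" for f using edgesD[OF that] n_nonneg by (simp add: cd_def)
  have cols: "ar m' a (cd e) = ar m a (cd e)" if "a < 31" for a using I that cd0[OF e(1)] by blast
  define r where "r = 2 + 2 * (k - j)"
  have r2: "2 \<le> r" and vr: "ar m' 31 vr = r" using jk by (simp_all add: r_def)
  define m1 where "m1 = m'(r := fst e, r + 1 := snd e, loc 31 vq := ar m cPrd (cd e), loc 31 vr := r + 2, loc 31 vj := j - 1)"
  have sem: "sem out_body m' = m1"
    using EU[OF e(1)] r2 vr by (simp add: out_body_def jk(2) e(2) cols cd0[OF e(1)] m1_def)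
  have m1_cols: "ar m1 a v = ar m' a v" if "a < 31" "0 \<le> v" for a v
    using that r2 by (simp add: m1_def)
  have m1_raw: "m1 i = (if i = r then fst e else if i = r + 1 then snd e else m' i)" if "0 \<le> i" for i
    using that by (simp add: m1_def)
  have "chain (es @ [e])"
    using es(2) e(1,4) by (simp add: chain_def sorted_wrt_append)
  moreover have len: "length (es @ [e]) = nat (k - (j - 1))" using es(1) jk by simp
  moreover have "m1 (2 + 2 * int i) = fst ((es @ [e]) ! i) \<and> m1 (3 + 2 * int i) = snd ((es @ [e]) ! i)"
    if "i < length (es @ [e])" for i
  proof (cases "i < length es")
    case True
    then have "int i < k - j" using es(1) by simp
    then show ?thesis using es(3)[OF True] True by (simp add: m1_raw r_def nth_append)
  next
    case False
    then have i: "i = length es" using that by simp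
    then have "int i = k - j" using es(1) jk by simp
    then show ?thesis using i by (simp add: m1_raw r_def)
  qed
  moreover have "\<exists>f\<in>edges. ar m1 31 vq = cd f \<and> ar m cLam (cd f) = j - 1 \<and> (\<forall>g\<in>set (es @ [e]). eleft f g)"
    if h: "0 < j - 1"
  proof -
    have "ar m cLam (cd e) = 1 \<or> (\<exists>f\<in>edges. ar m cPrd (cd e) = cd f \<and> eleft f e \<and> ar m cLam (cd f) = ar m cLam (cd e) - 1)"
      using SI e(1) unfolding sweep_inv_def by blast
    then obtain f where f: "f \<in> edges" "ar m cPrd (cd e) = cd f" "eleft f e" "ar m cLam (cd f) = j - 1"
      using h e(3) by auto
    moreover have "eleft f g" if "g \<in> set es" for g using eleft_trans[OF f(3) e(4)[OF that] e(1)] .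
    ultimately show ?thesis by (intro bexI[of _ f]) (auto simp: m1_def)
  qed
  ultimately have "\<exists>es. length es = nat (k - (j - 1)) \<and> chain es \<and>
        (\<forall>i<length es. m1 (2 + 2 * int i) = fst (es ! i) \<and> m1 (3 + 2 * int i) = snd (es ! i)) \<and>
        (0 < j - 1 \<longrightarrow> (\<exists>e\<in>edges. ar m1 31 vq = cd e \<and> ar m cLam (cd e) = j - 1 \<and> (\<forall>f\<in>set es. eleft e f)))"
    by blast
  moreover have "ar m1 31 vk = k" "ar m1 31 vj = j - 1" "ar m1 31 vr = 2 + 2 * (k - (j - 1))"
    using jk r2 by (simp_all add: m1_def r_def)
  moreover have "\<forall>a<31. \<forall>v\<ge>0. ar m1 a v = ar m a v" using m1_cols I by simp
  ultimately show ?thesis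
    unfolding out_inv_def sem k_def[symmetric] using j jk by simp
qed

text \<open>Every level is attained by some edge. This bounds the output phase by the number of
  edges.\<close>

lemma level_le_card_edges:
  assumes SI: "sweep_inv lam prd k be bo edges edges"
  shows "nat k \<le> card edges"
proof -
  have "{1..k} \<subseteq> (\<lambda>e. lam (cd e)) ` edges"
  proof
    fix j assume "j \<in> {1..k}"
    then have "1 \<le> j" "j \<le> k" by auto
    then obtain e where "e \<in> edges" "lam (cd e) = j" using SI unfolding sweep_inv_def by meson
    then show "j \<in> (\<lambda>e. lam (cd e)) ` edges" by blast
  qed
  then have "card {1..k} \<le> card ((\<lambda>e. lam (cd e)) ` edges)" by (intro card_mono) auto
  also have "\<dots> \<le> card edges" by (intro card_image_le) simp
  finally show ?thesis by simp
qed

lemma write_output_ok: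
  assumes SI: "sweep_inv (ar m cLam) (ar m cPrd) (ar m 31 vk) (ar m cBE) (ar m cBO) edges edges"
    and EU: "\<And>e. e \<in> edges \<Longrightarrow> ar m cEU (cd e) = fst e \<and> ar m cEW (cd e) = snd e"
  shows "hr write_output m (200 * card edges + 150)
    (\<lambda>m'. \<exists>es. length es = nat (ar m 31 vk) \<and> chain es \<and>
       m' (- 1) = 2 \<and> m' (- 2) = ar m 31 vk \<and>
       (\<forall>i<length es. m' (2 + 2 * int i) = fst (es ! i) \<and> m' (3 + 2 * int i) = snd (es ! i)))"
    (is "hr _ _ _ ?Q")
proof -
  define k where "k = ar m 31 vk"
  have k0: "0 \<le> k" using SI by (simp add: sweep_inv_def k_def)
  define m1 where "m1 = m(loc 31 vq := ar m cBE k, loc 31 vj := k, loc 31 vr := 2)"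
  have pre: "sem out_pre m = m1" by (simp add: out_pre_def m1_def k_def)
  have "\<exists>e\<in>edges. ar m cBE k = cd e \<and> ar m cLam (cd e) = k" if "0 < k"
  proof -
    have "1 \<le> k" "k \<le> ar m 31 vk" using that by (auto simp: k_def)
    then show ?thesis using SI unfolding sweep_inv_def by meson
  qed
  then have inv0: "out_inv m k m1"
    unfolding out_inv_def using k0 by (auto simp: m1_def k_def chain_def intro!: exI[of _ "[]"])
  have size: "csize out_body \<le> 150" "loopfree out_body" by (simp_all add: out_body_def)
  have loop: "hr (While (V vj) out_body) m1 (200 * nat k + 10) (out_inv m 0)"
  proof (rule hr_While[where I = "\<lambda>m'. out_inv m (ar m' 31 vj) m'" and pot = "\<lambda>m'. 200 * nat (ar m' 31 vj)"])
    show "out_inv m (ar m1 31 vj) m1" using inv0 by (simp add: out_inv_def)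
  next
    fix m' assume inv: "out_inv m (ar m' 31 vj) m'" and g: "0 < aval (V vj) m'"
    have nxt: "out_inv m (ar m' 31 vj - 1) (sem out_body m')"
      using out_body_ok[OF SI EU inv] g by simp
    then have "ar (sem out_body m') 31 vj = ar m' 31 vj - 1" by (simp add: out_inv_def)
    then show "\<exists>T. hr out_body m' T (\<lambda>m''. out_inv m (ar m'' 31 vj) m'' \<and>
        ecost (V vj) + 3 + T + 200 * nat (ar m'' 31 vj) \<le> 200 * nat (ar m' 31 vj))"
      using size nxt g by (intro exI[of _ 150] hr_loopfree) auto
  next
    fix m' assume "out_inv m (ar m' 31 vj) m'" "aval (V vj) m' \<le> 0"
    moreover then have "ar m' 31 vj = 0" by (simp add: out_inv_def)
    ultimately show "out_inv m 0 m'" by simp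
  next
    show "200 * nat (ar m1 31 vj) + ecost (V vj) + 1 \<le> 200 * nat k + 10" by (simp add: m1_def)
  qed
  have post: "hr out_post m' 30 ?Q" if inv: "out_inv m 0 m'" for m'
  proof -
    have "?Q (m'(- 1 := 2, - 2 := k))"
      using inv by (auto simp: out_inv_def k_def)
    moreover have "sem out_post m' = m'(- 1 := 2, - 2 := k)"
      using inv by (simp add: out_post_def out_inv_def k_def)
    ultimately show ?thesis by - (rule hr_loopfree, simp_all only:, simp_all add: out_post_def)
  qed
  have "hr (While (V vj) out_body ;; out_post) m1 (200 * nat k + 40) ?Q"
    by (rule hr_Seq[OF hr_weaken[OF loop order_refl post]]) auto
  then have "hr out_pre m 50 (\<lambda>m'. hr (While (V vj) out_body ;; out_post) m' (200 * nat k + 40) ?Q)"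
    by - (rule hr_loopfree, simp_all only: pre, simp_all add: out_pre_def)
  then show ?thesis
    unfolding write_output_def
    by (rule hr_Seq) (use level_le_card_edges[OF SI] in \<open>simp add: k_def\<close>)
qed

lemma prog_ok:
  assumes m0: "initial m"
  shows "hr prog m (30000 * (card edges + nat n) + 1000)
    (\<lambda>m'. \<exists>es. (\<forall>C. C \<subseteq> edges \<longrightarrow> (\<forall>e\<in>C. \<forall>f\<in>C. e \<noteq> f \<longrightarrow> eleft e f \<or> eleft f e) \<longrightarrow> card C \<le> length es) \<and>
       chain es \<and> m' (- 1) = 2 \<and> m' (- 2) = int (length es) \<and>
       (\<forall>i<length es. m' (2 + 2 * int i) = fst (es ! i) \<and> m' (3 + 2 * int i) = snd (es ! i)))"
    (is "hr _ _ _ ?Q")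
proof -
  have zero: "ar m a v = 0" if "a < 32" "0 \<le> v" for a v using m0 that by (simp add: initial_def)
  have out: "hr write_output m' (200 * card edges + 150) ?Q" if st: "sweep_st (2 * n + 1) edges edges W m'" for W m'
  proof (rule hr_weaken[OF write_output_ok order_refl])
    show SI: "sweep_inv (ar m' cLam) (ar m' cPrd) (ar m' 31 vk) (ar m' cBE) (ar m' cBO) edges edges"
      using st by (simp add: sweep_st_def)
    show "ar m' cEU (cd e) = fst e \<and> ar m' cEW (cd e) = snd e" if "e \<in> edges" for e
      using st that by (simp add: sweep_st_def)
    have k0: "0 \<le> ar m' 31 vk" using SI unfolding sweep_inv_def by blast
    fix m''
    assume "\<exists>es. length es = nat (ar m' 31 vk) \<and> chain es \<and> m'' (- 1) = 2 \<and> m'' (- 2) = ar m' 31 vk \<and>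
       (\<forall>i<length es. m'' (2 + 2 * int i) = fst (es ! i) \<and> m'' (3 + 2 * int i) = snd (es ! i))"
    then obtain es where es: "length es = nat (ar m' 31 vk)" "chain es" "m'' (- 1) = 2" "m'' (- 2) = ar m' 31 vk"
       "\<forall>i<length es. m'' (2 + 2 * int i) = fst (es ! i) \<and> m'' (3 + 2 * int i) = snd (es ! i)" by blast
    have "card C \<le> length es" if C: "C \<subseteq> edges" "\<forall>e\<in>C. \<forall>f\<in>C. e \<noteq> f \<longrightarrow> eleft e f \<or> eleft f e" for C
    proof -
      have "int (card C) \<le> ar m' 31 vk" by (rule chain_card_le[OF SI C(1)]) (use C(2) in blast)
      then show ?thesis using es(1) by linarith
    qed
    moreover have "m'' (- 2) = int (length es)" using es(1,4) k0 by simp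
    ultimately show "?Q m''" using es by blast
  qed
  define P1 where "P1 m' \<longleftrightarrow> input_ok m' \<and> same m m' {2..8} {vn, vi, vr, vacc, vz}" for m'
  define P2 where "P2 m' \<longleftrightarrow> input_ok m' \<and> graph_ok m' \<and> ar m' 31 vk = 0 \<and> (\<forall>v\<ge>0. ar m' cD v = 0)" for m'
  have sweep: "hr (sweep_loop ;; write_output) m' (11000 * (card edges + nat n) + 250) ?Q"
    if "P2 m'" "ar m' 31 vx = 1" for m'
    by (rule hr_Seq[OF hr_weaken[OF sweep_loop_ok order_refl]]) (use that out in \<open>auto simp: P2_def\<close>)
  have sweep': "hr (Asg vx (N 1) ;; sweep_loop ;; write_output) m' (11000 * (card edges + nat n) + 260) ?Q"
    if "P2 m'" for m'
  proof (rule hr_Seq[OF hr_loopfree[of _ 10]])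
    have s: "same m' (m'(loc 31 vx := 1)) {} {vx}" by simp
    have "input_ok (m'(loc 31 vx := 1))" by (rule input_ok_same[OF _ s]) (use that in \<open>auto simp: P2_def\<close>)
    moreover have "graph_ok (m'(loc 31 vx := 1))" by (rule graph_ok_same[OF _ s]) (use that in \<open>auto simp: P2_def\<close>)
    ultimately have "P2 (m'(loc 31 vx := 1))" using that by (simp add: P2_def)
    then show "hr (sweep_loop ;; write_output) (sem (Asg vx (N 1)) m') (11000 * (card edges + nat n) + 250) ?Q"
      using sweep by simp
  qed simp_all
  have arcs': "hr (Asg vx (N 1) ;; arcs_loop ;; Asg vx (N 1) ;; sweep_loop ;; write_output) m' (21000 * (card edges + nat n) + 370) ?Q"
    if P: "P1 m'" for m'
  proof (rule hr_Seq[OF hr_loopfree[of _ 10]])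
    have s: "same m m' {2..8} {vn, vi, vr, vacc, vz}" using P by (simp add: P1_def)
    let ?m = "m'(loc 31 vx := 1)"
    have s': "same m' ?m {} {vx}" by simp
    have in': "input_ok ?m" by (rule input_ok_same[OF _ s']) (use P in \<open>auto simp: P1_def\<close>)
    have z: "ar m' a v = 0" if "a \<in> {cS, cM, cDeg, cD}" "0 \<le> v" for a v
      using that sameD[OF s, of a] zero[of a v] by auto
    have k: "ar ?m 31 vk = 0" using sameD1[OF s, of vk] zero[of 31 vk] by simp
    have "hr arcs_loop ?m (2300 * (4 * card edges + 4 * nat n) + 100)
      (\<lambda>m''. arcs_ok {(u, v). meets u v} m'' \<and> same ?m m'' {cS, cM, cDeg, cAdj} {vx, vv, vy, vu, vq, vj})"
      by (rule arcs_loop_ok[OF in']) (simp_all add: z)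
    then have "hr arcs_loop ?m (2300 * (4 * card edges + 4 * nat n) + 100)
      (\<lambda>m''. hr (Asg vx (N 1) ;; sweep_loop ;; write_output) m'' (11000 * (card edges + nat n) + 260) ?Q)"
    proof (rule hr_weaken[OF _ order_refl])
      fix m'' assume m'': "arcs_ok {(u, v). meets u v} m'' \<and> same ?m m'' {cS, cM, cDeg, cAdj} {vx, vv, vy, vu, vq, vj}"
      then have s: "same ?m m'' {cS, cM, cDeg, cAdj} {vx, vv, vy, vu, vq, vj}" by blast
      have "input_ok m''" by (rule input_ok_same[OF in' s]) auto
      moreover have "graph_ok m''" using m'' arcs_ok_graph_ok by blast
      ultimately have "P2 m''" using sameD[OF s, of cD] sameD1[OF s, of vk] k z[of cD] by (simp add: P2_def)
      then show "hr (Asg vx (N 1) ;; sweep_loop ;; write_output) m'' (11000 * (card edges + nat n) + 260) ?Q"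
        by (rule sweep')
    qed
    then have "hr (arcs_loop ;; Asg vx (N 1) ;; sweep_loop ;; write_output) ?m (21000 * (card edges + nat n) + 360) ?Q"
      by (rule hr_Seq) simp
    then show "hr (arcs_loop ;; Asg vx (N 1) ;; sweep_loop ;; write_output) (sem (Asg vx (N 1)) m')
      (21000 * (card edges + nat n) + 360) ?Q" by simp
  qed simp_all
  show ?thesis
    unfolding prog_def
  proof (rule hr_Seq[OF hr_weaken[OF read_input_ok[OF m0] order_refl]])
    fix m' assume "input_ok m' \<and> same m m' {2..8} {vn, vi, vr, vacc, vz}"
    then show "hr (Asg vx (N 1) ;; arcs_loop ;; Asg vx (N 1) ;; sweep_loop ;; write_output) m'
      (21000 * (card edges + nat n) + 370) ?Q" using arcs' by (simp add: P1_def)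
  qed simp
qed

end

section \<open>From the combinatorial to the geometric model\<close>

definition rim :: "trapezoid \<Rightarrow> real \<Rightarrow> real set" where
  "rim A h = {(1 - h) * tx1 A + h * ty1 A .. (1 - h) * tx2 A + h * ty2 A}"

text \<open>Slicing by height reduces the plane geometry to intervals. One direction encloses the
  two generating segments in four half-planes, the other interpolates along the slanted sides and
  then horizontally.\<close>

lemma trap_set_iff:
  assumes "tx1 A \<le> tx2 A" "ty1 A \<le> ty2 A"
  shows "(u, h) \<in> trap_set A \<longleftrightarrow> 0 \<le> h \<and> h \<le> 1 \<and> u \<in> rim A h"
proof
  let ?B = "{(u, 0) | u. real (tx1 A) \<le> u \<and> u \<le> real (tx2 A)} \<union>
      {(u, 1) | u. real (ty1 A) \<le> u \<and> u \<le> real (ty2 A)} :: (real \<times> real) set"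
  let ?C = "{p. 0 \<le> snd p} \<inter> {p. snd p \<le> 1} \<inter>
      {p. (1 - snd p) * tx1 A + snd p * ty1 A \<le> fst p} \<inter>
      {p. fst p \<le> (1 - snd p) * tx2 A + snd p * ty2 A} :: (real \<times> real) set"
  have "?C = {p. inner (0, - 1) p \<le> 0} \<inter> {p. inner (0, 1) p \<le> 1} \<inter>
      {p. inner (- 1, real (ty1 A) - tx1 A) p \<le> - tx1 A} \<inter> {p. inner (1, real (tx2 A) - ty2 A) p \<le> tx2 A}"
    by (auto simp: inner_prod_def algebra_simps)
  then have "convex ?C" by (simp only:) (intro convex_Int convex_halfspace_le)
  moreover have "?B \<subseteq> ?C" by auto
  ultimately have "trap_set A \<subseteq> ?C" unfolding trap_set_def by (intro hull_minimal)
  then show "0 \<le> h \<and> h \<le> 1 \<and> u \<in> rim A h" if "(u, h) \<in> trap_set A"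
    using that by (auto simp: rim_def)
next
  assume *: "0 \<le> h \<and> h \<le> 1 \<and> u \<in> rim A h"
  define l r where "l = (1 - h) * tx1 A + h * ty1 A" and "r = (1 - h) * tx2 A + h * ty2 A"
  have conv: "convex (trap_set A)" by (simp add: trap_set_def)
  have corner: "(real (tx1 A), 0) \<in> trap_set A" "(real (tx2 A), 0) \<in> trap_set A"
    "(real (ty1 A), 1) \<in> trap_set A" "(real (ty2 A), 1) \<in> trap_set A"
    unfolding trap_set_def using assms by (auto intro!: hull_inc)
  have "(1 - h) *\<^sub>R (real (tx1 A), 0) + h *\<^sub>R (real (ty1 A), 1) \<in> trap_set A"
    "(1 - h) *\<^sub>R (real (tx2 A), 0) + h *\<^sub>R (real (ty2 A), 1) \<in> trap_set A"
    using * corner by (intro convexD[OF conv]; simp)+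
  then have lr: "(l, h) \<in> trap_set A" "(r, h) \<in> trap_set A" by (simp_all add: l_def r_def)
  have "l \<le> u" "u \<le> r" using * by (auto simp: rim_def l_def r_def)
  show "(u, h) \<in> trap_set A"
  proof (cases "l = r")
    case True
    then show ?thesis using lr \<open>l \<le> u\<close> \<open>u \<le> r\<close> by simp
  next
    case False
    define s where "s = (u - l) / (r - l)"
    have s: "0 \<le> s" "s \<le> 1" "u = l + s * (r - l)" using False \<open>l \<le> u\<close> \<open>u \<le> r\<close> by (auto simp: s_def field_simps)
    have "(1 - s) *\<^sub>R (l, h) + s *\<^sub>R (r, h) \<in> trap_set A"
      using s lr by (intro convexD[OF conv]) auto
    moreover have "(1 - s) *\<^sub>R (l, h) + s *\<^sub>R (r, h) = (u, h)" using s(3) by (simp add: algebra_simps)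
    ultimately show ?thesis by simp
  qed
qed

definition trap_left :: "trapezoid \<Rightarrow> trapezoid \<Rightarrow> bool" where
  "trap_left A B \<longleftrightarrow> tx2 A < tx1 B \<and> ty2 A < ty1 B"

lemma crossing_segments:
  fixes p0 p1 q0 q1 :: real
  assumes "p0 \<le> q0" "q1 \<le> p1"
  shows "\<exists>h. 0 \<le> h \<and> h \<le> 1 \<and> (1 - h) * p0 + h * p1 = (1 - h) * q0 + h * q1"
proof (cases "q0 - p0 + (p1 - q1) = 0")
  case True
  then show ?thesis using assms by (intro exI[of _ 0]) auto
next
  case False
  then have pos: "0 < q0 - p0 + (p1 - q1)" using assms by simp
  \<comment> \<open>The difference of the two segments is linear in the height; this is its
    zero.\<close>
  define h where "h = (q0 - p0) / (q0 - p0 + (p1 - q1))"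
  have "h * (q0 - p0 + (p1 - q1)) = q0 - p0" using pos by (simp add: h_def)
  then have "(1 - h) * p0 + h * p1 = (1 - h) * q0 + h * q1" by (simp add: algebra_simps)
  moreover have "0 \<le> h" "h \<le> 1" using assms pos by (auto simp: h_def)
  ultimately show ?thesis by blast
qed

text \<open>Heights 0 and 1 show that the lower intervals and the upper intervals are disjoint. If
  their orders disagreed, the left sides of the two trapezoids would cross, and the crossing point
  would belong to both.\<close>

lemma trap_set_disjoint_iff:
  assumes A: "tx1 A \<le> tx2 A" "ty1 A \<le> ty2 A" and B: "tx1 B \<le> tx2 B" "ty1 B \<le> ty2 B"
  shows "trap_set A \<inter> trap_set B = {} \<longleftrightarrow> trap_left A B \<or> trap_left B A"
proof
  have disj: "trap_set A \<inter> trap_set B = {}" if l: "trap_left A B"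
    and A: "tx1 A \<le> tx2 A" "ty1 A \<le> ty2 A" and B: "tx1 B \<le> tx2 B" "ty1 B \<le> ty2 B" for A B
  proof (rule ccontr)
    assume "\<not> ?thesis"
    then obtain u h where "(u, h) \<in> trap_set A" "(u, h) \<in> trap_set B" by auto
    then have h: "0 \<le> h" "h \<le> 1" and "(1 - h) * tx1 B + h * ty1 B \<le> u" "u \<le> (1 - h) * tx2 A + h * ty2 A"
      using trap_set_iff[OF A] trap_set_iff[OF B] by (auto simp: rim_def)
    then have "(1 - h) * (real (tx1 B) - tx2 A) + h * (real (ty1 B) - ty2 A) \<le> 0" by (simp add: algebra_simps)
    moreover have "(1 - h) * (real (tx1 B) - tx2 A) + h * (real (ty1 B) - ty2 A) > 0"
    proof (cases "h = 0")
      case False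
      then have "0 < h * (real (ty1 B) - ty2 A)" using l h by (simp add: trap_left_def)
      moreover have "0 \<le> (1 - h) * (real (tx1 B) - tx2 A)" using l h by (simp add: trap_left_def)
      ultimately show ?thesis by simp
    qed (use l in \<open>simp add: trap_left_def\<close>)
    ultimately show False by simp
  qed
  show "trap_left A B \<or> trap_left B A \<Longrightarrow> trap_set A \<inter> trap_set B = {}"
    using disj[of A B] disj[of B A] A B by auto
  assume empty: "trap_set A \<inter> trap_set B = {}"
  have meet: False if "0 \<le> h" "h \<le> 1" "u \<in> rim A h" "u \<in> rim B h" for u h
    using that empty trap_set_iff[OF A, of u h] trap_set_iff[OF B, of u h] by blast
  have bottom: "tx2 A < tx1 B \<or> tx2 B < tx1 A"
    using meet[of 0 "real (tx1 A)"] meet[of 0 "real (tx1 B)"] A B by (simp add: rim_def) (metis linorder_not_le linorder_linear)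
  have top: "ty2 A < ty1 B \<or> ty2 B < ty1 A"
    using meet[of 1 "real (ty1 A)"] meet[of 1 "real (ty1 B)"] A B by (simp add: rim_def) (metis linorder_not_le linorder_linear)
  have mixed: False if lt: "tx2 A < tx1 B" "ty2 B < ty1 A"
  proof -
    obtain h where h: "0 \<le> h" "h \<le> 1" "(1 - h) * real (tx1 A) + h * ty1 A = (1 - h) * real (tx1 B) + h * ty1 B"
      using crossing_segments[of "real (tx1 A)" "real (tx1 B)" "real (ty1 B)" "real (ty1 A)"] lt A B by auto
    have "(1 - h) * real (tx1 A) \<le> (1 - h) * tx2 A" "h * real (ty1 A) \<le> h * ty2 A"
      "(1 - h) * real (tx1 B) \<le> (1 - h) * tx2 B" "h * real (ty1 B) \<le> h * ty2 B"
      using h A B by (auto intro!: mult_left_mono)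
    then show False using meet[OF h(1,2), of "(1 - h) * tx1 A + h * ty1 A"] h(3) by (auto simp: rim_def)
  qed
  have mixed': False if lt: "tx2 B < tx1 A" "ty2 A < ty1 B"
  proof -
    obtain h where h: "0 \<le> h" "h \<le> 1" "(1 - h) * real (tx1 B) + h * ty1 B = (1 - h) * real (tx1 A) + h * ty1 A"
      using crossing_segments[of "real (tx1 B)" "real (tx1 A)" "real (ty1 A)" "real (ty1 B)"] lt A B by auto
    have "(1 - h) * real (tx1 A) \<le> (1 - h) * tx2 A" "h * real (ty1 A) \<le> h * ty2 A"
      "(1 - h) * real (tx1 B) \<le> (1 - h) * tx2 B" "h * real (ty1 B) \<le> h * ty2 B"
      using h A B by (auto intro!: mult_left_mono)
    then show False using meet[OF h(1,2), of "(1 - h) * tx1 A + h * ty1 A"] h(3) by (auto simp: rim_def)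
  qed
  show "trap_left A B \<or> trap_left B A"
    using bottom top mixed mixed' by (auto simp: trap_left_def)
qed

section \<open>Induced matchings as chains of edges\<close>

context trapezoids
begin

definition uedge :: "int \<times> int \<Rightarrow> nat set" where
  "uedge e = {nat (fst e), nat (snd e)}"

lemma uedge_mem_iff:
  assumes "a \<in> {0..<n}" "b \<in> {0..<n}"
  shows "{nat a, nat b} \<in> uedge ` edges \<longleftrightarrow> a \<noteq> b \<and> meets a b"
proof
  assume "{nat a, nat b} \<in> uedge ` edges"
  then obtain e where e: "e \<in> edges" "{nat a, nat b} = {nat (fst e), nat (snd e)}" by (auto simp: uedge_def)
  then have "a = fst e \<and> b = snd e \<or> a = snd e \<and> b = fst e"
    using edgesD[OF e(1)] assms by (auto simp: doubleton_eq_iff)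
  then show "a \<noteq> b \<and> meets a b" using edgesD[OF e(1)] meets_sym by auto
next
  assume *: "a \<noteq> b \<and> meets a b"
  then have "x1 a \<noteq> x1 b" using x1_inj[OF assms] by blast
  then have "(a, b) \<in> edges \<or> (b, a) \<in> edges" using * meets_sym by (auto simp: edges_def)
  then show "{nat a, nat b} \<in> uedge ` edges"
    unfolding uedge_def by (metis (no_types, lifting) fst_conv image_iff insert_commute snd_conv)
qed

lemma uedge_inj: "inj_on uedge edges"
proof (rule inj_onI)
  fix e f assume *: "e \<in> edges" "f \<in> edges" "uedge e = uedge f"
  then have "fst e = fst f \<and> snd e = snd f \<or> fst e = snd f \<and> snd e = fst f"
    using edgesD[of e] edgesD[of f] by (auto simp: uedge_def doubleton_eq_iff)
  then show "e = f" using edgesD[OF *(1)] edgesD[OF *(2)] by (auto simp: prod_eq_iff)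
qed

lemma eleft_left:
  assumes "eleft e f" "u = fst e \<or> u = snd e" "v = fst f \<or> v = snd f" "e \<in> edges" "f \<in> edges"
  shows "left u v"
  using assms edgesD[of f] by (auto simp: eleft_def left_def X1_def X2_def Y1_def Y2_def)

text \<open>All four cross pairs are comparable by \<open>left\<close>. If two comparisons pointed
  in different directions, transitivity would make the two ends of \<open>e\<close> or of
  \<open>f\<close> comparable, although they meet.\<close>

lemma separated_eleft:
  assumes e: "e \<in> edges" and f: "f \<in> edges"
    and sep: "\<And>u v. u = fst e \<or> u = snd e \<Longrightarrow> v = fst f \<or> v = snd f \<Longrightarrow> \<not> meets u v"
  shows "eleft e f \<or> eleft f e"
proof -
  obtain a b where ab: "e = (a, b)" by (cases e)
  obtain c d where cd: "f = (c, d)" by (cases f)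
  have V: "a \<in> {0..<n}" "b \<in> {0..<n}" "c \<in> {0..<n}" "d \<in> {0..<n}" and m: "meets a b" "meets c d"
    using edgesD[OF e] edgesD[OF f] ab cd by auto
  have trans: "left u w" if "left u v" "left v w" "v \<in> {0..<n}" for u v w
    using that x12[OF that(3)] y12[OF that(3)] by (auto simp: left_def)
  have cross: "left u v \<or> left v u" if "u = a \<or> u = b" "v = c \<or> v = d" for u v
    using sep[of u v] that V ab cd by (auto simp: meets_def)
  have nab: "\<not> left a b" "\<not> left b a" "\<not> left c d" "\<not> left d c" using m by (auto simp: meets_def)
  have all: "(left a c \<and> left a d \<and> left b c \<and> left b d) \<or> (left c a \<and> left d a \<and> left c b \<and> left d b)"
    using cross[of a c] cross[of a d] cross[of b c] cross[of b d] nab trans V by metis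
  then show ?thesis
    using edgesD[OF e] edgesD[OF f] by (auto simp: ab cd left_def eleft_def X1_def X2_def Y1_def Y2_def)
qed

text \<open>An induced matching is pulled back along the injection \<open>uedge\<close> to a set of
  oriented edges; these are pairwise separated, so they form a chain and \<open>opt\<close>
  applies.\<close>

lemma max_induced_matching_chain:
  assumes es: "set es \<subseteq> edges" "sorted_wrt (\<lambda>e f. eleft f e) es"
    and opt: "\<And>C. C \<subseteq> edges \<Longrightarrow> (\<forall>e\<in>C. \<forall>f\<in>C. e \<noteq> f \<longrightarrow> eleft e f \<or> eleft f e) \<Longrightarrow> card C \<le> length es"
  shows "max_induced_matching (uedge ` edges) (uedge ` set es)"
  unfolding max_induced_matching_def
proof (intro conjI allI impI)
  have irrefl: "\<not> eleft e e" if "e \<in> edges" for e using edge_bounds[OF that] by (auto simp: eleft_def)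
  have comp: "eleft e f \<or> eleft f e" if "e \<in> set es" "f \<in> set es" "e \<noteq> f" for e f
  proof -
    obtain i j where ij: "i < length es" "es ! i = e" "j < length es" "es ! j = f"
      using \<open>e \<in> set es\<close> \<open>f \<in> set es\<close> by (metis in_set_conv_nth)
    then have "i < j \<or> j < i" using that(3) by (metis linorder_neqE_nat)
    then show ?thesis using sorted_wrt_nth_less[OF es(2)] ij by blast
  qed
  have "distinct es"
  proof (unfold distinct_conv_nth, intro allI impI)
    fix i j assume ij: "i < length es" "j < length es" "i \<noteq> j"
    have lt: "es ! i \<noteq> es ! j" if "i < j" "j < length es" for i j
      using sorted_wrt_nth_less[OF es(2) that] irrefl es(1) that by (metis nth_mem subsetD)
    show "es ! i \<noteq> es ! j" using lt[of i j] lt[of j i] ij by (metis linorder_neqE_nat)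
  qed
  then have "card (uedge ` set es) = length es"
    using card_image[OF inj_on_subset[OF uedge_inj es(1)]] distinct_card by metis
  note card = this
  show "induced_matching (uedge ` edges) (uedge ` set es)"
    unfolding induced_matching_def
  proof (intro conjI ballI impI)
    show "uedge ` set es \<subseteq> uedge ` edges" using es(1) by blast
    fix E F u v assume EF: "E \<in> uedge ` set es" "F \<in> uedge ` set es" "E \<noteq> F" "u \<in> E" "v \<in> F"
    then obtain e f where ef: "e \<in> set es" "f \<in> set es" "E = uedge e" "F = uedge f" "e \<noteq> f" by blast
    obtain a where a: "a = fst e \<or> a = snd e" "u = nat a" using EF ef by (auto simp: uedge_def)
    obtain b where b: "b = fst f \<or> b = snd f" "v = nat b" using EF ef by (auto simp: uedge_def)
    have edg: "e \<in> edges" "f \<in> edges" using ef es(1) by auto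
    have "left a b \<or> left b a"
      using comp[OF ef(1,2,5)] eleft_left[of e f a b] eleft_left[of f e b a] a b edg by blast
    then have "\<not> meets a b" by (auto simp: meets_def)
    moreover have "a \<in> {0..<n}" "b \<in> {0..<n}" using a b edgesD[OF edg(1)] edgesD[OF edg(2)] by auto
    ultimately show "{u, v} \<notin> uedge ` edges" unfolding a(2) b(2) by (simp add: uedge_mem_iff)
  qed
  fix M' assume M': "induced_matching (uedge ` edges) M'"
  define C where "C = {e \<in> edges. uedge e \<in> M'}"
  have C: "C \<subseteq> edges" by (auto simp: C_def)
  have "M' = uedge ` C" using M' by (auto simp: C_def induced_matching_def)
  then have "card M' = card C" using card_image[OF inj_on_subset[OF uedge_inj C]] by simp
  also have "card C \<le> length es"
  proof (rule opt[OF C], intro ballI impI)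
    fix e f assume ef: "e \<in> C" "f \<in> C" "e \<noteq> f"
    then have edg: "e \<in> edges" "f \<in> edges" and M: "uedge e \<in> M'" "uedge f \<in> M'" by (auto simp: C_def)
    have ne: "uedge e \<noteq> uedge f" using inj_onD[OF uedge_inj _ edg] ef(3) by blast
    have sep: "{nat u, nat v} \<notin> uedge ` edges" if "u = fst e \<or> u = snd e" "v = fst f \<or> v = snd f" for u v
    proof -
      have "nat u \<in> uedge e" "nat v \<in> uedge f" using that unfolding uedge_def by blast+
      moreover have "\<forall>E\<in>M'. \<forall>F\<in>M'. E \<noteq> F \<longrightarrow> (\<forall>u\<in>E. \<forall>v\<in>F. {u, v} \<notin> uedge ` edges)"
        using M' unfolding induced_matching_def by (rule conjunct2)
      ultimately show ?thesis using M ne by meson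
    qed
    show "eleft e f \<or> eleft f e"
    proof (rule separated_eleft[OF edg])
      fix u v assume uv: "u = fst e \<or> u = snd e" "v = fst f \<or> v = snd f"
      note Ve = edgesD[OF edg(1)] and Vf = edgesD[OF edg(2)]
      have "u \<noteq> v"
      proof
        assume "u = v"
        \<comment> \<open>A common vertex needs its own argument, since \<open>{u, v}\<close> is
          then a singleton and never an edge. With \<open>u'\<close> the other end of
          \<open>e\<close>, the pair \<open>{u', v}\<close> is the edge \<open>e\<close> itself,
          which separation forbids.\<close>
        define u' where "u' = (if u = fst e then snd e else fst e)"
        have "u' = fst e \<or> u' = snd e" by (simp add: u'_def)
        moreover have "{nat u', nat v} = uedge e"
          using uv(1) unfolding \<open>u = v\<close>[symmetric] u'_def uedge_def by (auto split: if_splits)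
        moreover have "uedge e \<in> uedge ` edges" using edg by blast
        ultimately show False using sep[of u' v] uv(2) by simp
      qed
      then show "\<not> meets u v"
      proof -
        have "u \<in> {0..<n}" "v \<in> {0..<n}" using uv Ve Vf by metis+
        then show ?thesis using sep[OF uv] \<open>u \<noteq> v\<close> by (simp add: uedge_mem_iff)
      qed
    qed
  qed
  finally show "card M' \<le> card (uedge ` set es)" by (simp add: card)
qed

end

section \<open>Valid models as instances of the locale\<close>

lemma length_concat_pairs: "length (concat (map (\<lambda>A. [f A, g A]) xs)) = 2 * length xs"
  by (induction xs) auto

lemma nth_concat_pairs:
  "i < length xs \<Longrightarrow> concat (map (\<lambda>A. [f A, g A]) xs) ! (2 * i) = f (xs ! i)"
  "i < length xs \<Longrightarrow> concat (map (\<lambda>A. [f A, g A]) xs) ! (2 * i + 1) = g (xs ! i)"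
  by (induction xs arbitrary: i) (auto simp: less_Suc_eq_0_disj)

lemma distinct_concat_pairsD:
  assumes d: "distinct (concat (map (\<lambda>A. [f A, g A]) xs))" and ij: "i < length xs" "j < length xs"
  shows "f (xs ! i) = f (xs ! j) \<Longrightarrow> i = j" "g (xs ! i) = g (xs ! j) \<Longrightarrow> i = j" "f (xs ! i) \<noteq> g (xs ! j)"
proof -
  let ?c = "concat (map (\<lambda>A. [f A, g A]) xs)"
  have len: "2 * i < length ?c" "2 * i + 1 < length ?c" "2 * j < length ?c" "2 * j + 1 < length ?c"
    using ij unfolding length_concat_pairs by auto
  note n = nth_concat_pairs[of i xs f g, OF ij(1)] nth_concat_pairs[of j xs f g, OF ij(2)]
  show "f (xs ! i) = f (xs ! j) \<Longrightarrow> i = j"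
    using nth_eq_iff_index_eq[OF d len(1,3)] n by simp
  show "g (xs ! i) = g (xs ! j) \<Longrightarrow> i = j"
    using nth_eq_iff_index_eq[OF d len(2,4)] n by simp
  show "f (xs ! i) \<noteq> g (xs ! j)"
    using nth_eq_iff_index_eq[OF d len(1,4)] n by (simp; presburger)
qed

text \<open>Pigeonhole: 2n distinct values in a set with 2n elements exhaust it.\<close>

lemma cover_concat_pairs:
  assumes d: "distinct (concat (map (\<lambda>A. [f A, g A]) xs))"
    and sub: "set (concat (map (\<lambda>A. [f A, g A]) xs)) \<subseteq> {1..2 * length xs}"
    and x: "x \<in> {1..2 * length xs}"
  shows "\<exists>i<length xs. f (xs ! i) = x \<or> g (xs ! i) = x"
proof -
  have "card (set (concat (map (\<lambda>A. [f A, g A]) xs))) = 2 * length xs"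
    using distinct_card[OF d] length_concat_pairs[of f g xs] by simp
  then have "set (concat (map (\<lambda>A. [f A, g A]) xs)) = {1..2 * length xs}"
    by (intro card_subset_eq[OF _ sub]) auto
  with x have "x \<in> set (concat (map (\<lambda>A. [f A, g A]) xs))" by simp
  then obtain A where "A \<in> set xs" "x = f A \<or> x = g A" by auto
  then show ?thesis by (metis in_set_conv_nth)
qed

definition coord :: "trapezoid list \<Rightarrow> (trapezoid \<Rightarrow> nat) \<Rightarrow> int \<Rightarrow> int" where
  "coord tau f v = int (f (tau ! nat v))"

lemma valid_model_trapezoids:
  assumes "valid_model tau"
  shows "trapezoids (int (length tau)) (coord tau tx1) (coord tau tx2) (coord tau ty1) (coord tau ty2)"
proof -
  note V = assms[unfolded valid_model_def]
  have dx: "distinct (concat (map (\<lambda>A. [tx1 A, tx2 A]) tau))"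
    and dy: "distinct (concat (map (\<lambda>A. [ty1 A, ty2 A]) tau))" using V by auto
  have range: "A \<in> set tau \<Longrightarrow> {tx1 A, tx2 A, ty1 A, ty2 A} \<subseteq> {1..2 * length tau}" for A
    using V by fastforce
  have sub: "set (concat (map (\<lambda>A. [tx1 A, tx2 A]) tau)) \<subseteq> {1..2 * length tau}"
    using range by auto
  have mem: "tau ! nat v \<in> set tau" "nat v < length tau" if "v \<in> {0..<int (length tau)}" for v
    using that by auto
  show ?thesis
  proof (unfold_locales, goal_cases)
    case 1
    then show ?case by simp
  next
    case (2 v)
    have "tx1 (tau ! nat v) \<noteq> tx2 (tau ! nat v)" using distinct_concat_pairsD(3)[OF dx mem(2)[OF 2] mem(2)[OF 2]] .
    then show ?case using V mem[OF 2] by (auto simp: coord_def le_less)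
  next
    case (3 v)
    have "ty1 (tau ! nat v) \<noteq> ty2 (tau ! nat v)" using distinct_concat_pairsD(3)[OF dy mem(2)[OF 3] mem(2)[OF 3]] .
    then show ?case using V mem[OF 3] by (auto simp: coord_def le_less)
  next
    case (4 v)
    then show ?case using range[OF mem(1)[OF 4]] by (auto simp: coord_def)
  next
    case (5 v)
    then show ?case using range[OF mem(1)[OF 5]] by (auto simp: coord_def)
  next
    case (6 u v)
    then show ?case using distinct_concat_pairsD(1)[OF dx mem(2)[OF 6(1)] mem(2)[OF 6(2)]] by (auto simp: coord_def)
  next
    case (7 u v)
    then show ?case using distinct_concat_pairsD(2)[OF dx mem(2)[OF 7(1)] mem(2)[OF 7(2)]] by (auto simp: coord_def)
  next
    case (8 u v)
    then show ?case using distinct_concat_pairsD(3)[OF dx mem(2)[OF 8(1)] mem(2)[OF 8(2)]] by (simp add: coord_def)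
  next
    case (9 u v)
    then show ?case using distinct_concat_pairsD(1)[OF dy mem(2)[OF 9(1)] mem(2)[OF 9(2)]] by (auto simp: coord_def)
  next
    case (10 u v)
    then show ?case using distinct_concat_pairsD(2)[OF dy mem(2)[OF 10(1)] mem(2)[OF 10(2)]] by (auto simp: coord_def)
  next
    case (11 u v)
    then show ?case using distinct_concat_pairsD(3)[OF dy mem(2)[OF 11(1)] mem(2)[OF 11(2)]] by (simp add: coord_def)
  next
    case (12 x)
    then have "nat x \<in> {1..2 * length tau}" by auto
    then obtain i where "i < length tau" "tx1 (tau ! i) = nat x \<or> tx2 (tau ! i) = nat x"
      using cover_concat_pairs[OF dx sub] by blast
    then show ?case using 12 by (intro bexI[of _ "int i"]) (auto simp: coord_def)
  qed
qed

lemma tg_edges_eq: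
  assumes "valid_model tau"
  shows "tg_edges tau = trapezoids.uedge ` trapezoids.edges (int (length tau)) (coord tau tx1) (coord tau tx2) (coord tau ty1) (coord tau ty2)"
proof -
  interpret trapezoids "int (length tau)" "coord tau tx1" "coord tau tx2" "coord tau ty1" "coord tau ty2"
    by (rule valid_model_trapezoids[OF assms])
  have valid: "tx1 (tau ! i) \<le> tx2 (tau ! i)" "ty1 (tau ! i) \<le> ty2 (tau ! i)" if "i < length tau" for i
    using assms that by (auto simp: valid_model_def)
  have meet: "trap_set (tau ! i) \<inter> trap_set (tau ! j) \<noteq> {} \<longleftrightarrow> meets (int i) (int j)"
    if "i < length tau" "j < length tau" for i j
    using that trap_set_disjoint_iff[OF valid[OF that(1)] valid[OF that(2)]]
    by (simp add: meets_def left_def trap_left_def coord_def)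
  have mem: "{i, j} \<in> uedge ` edges \<longleftrightarrow> i \<noteq> j \<and> meets (int i) (int j)" if "i < length tau" "j < length tau" for i j
    using uedge_mem_iff[of "int i" "int j"] that by simp
  show ?thesis
  proof (intro equalityI subsetI)
    fix E assume "E \<in> tg_edges tau"
    then show "E \<in> uedge ` edges" using meet mem by (auto simp: tg_edges_def)
  next
    fix E assume E: "E \<in> uedge ` edges"
    then obtain e where e: "e \<in> edges" "E = {nat (fst e), nat (snd e)}" by (auto simp: uedge_def)
    define i j where "i = nat (fst e)" and "j = nat (snd e)"
    have ij: "i < length tau" "j < length tau" using edgesD[OF e(1)] by (auto simp: i_def j_def)
    have "E = {i, j}" using e(2) by (simp only: i_def j_def)
    moreover have "i \<noteq> j" "trap_set (tau ! i) \<inter> trap_set (tau ! j) \<noteq> {}"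
      using E mem[OF ij] meet[OF ij] \<open>E = {i, j}\<close> by simp_all
    ultimately show "E \<in> tg_edges tau" using ij unfolding tg_edges_def by blast
  qed
qed

lemma initial_init_state:
  assumes "valid_model tau"
  shows "trapezoids.initial (int (length tau)) (coord tau tx1) (coord tau tx2) (coord tau ty1) (coord tau ty2) (snd (init_state tau))"
proof -
  interpret trapezoids "int (length tau)" "coord tau tx1" "coord tau tx2" "coord tau ty1" "coord tau ty2"
    by (rule valid_model_trapezoids[OF assms])
  have field: "snd (init_state tau) (int (2 + 4 * i + k)) = int ([tx1 A, tx2 A, ty1 A, ty2 A] ! k)"
    if "i < length tau" "k < 4" "A = tau ! i" for i k A
  proof -
    have "nat (int (2 + 4 * i + k) - 2) = 4 * i + k" by simp
    moreover have "(4 * i + k) div 4 = i" "(4 * i + k) mod 4 = k" using that(2) by auto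
    moreover have "int (2 + 4 * i + k) < 2 + 4 * int (length tau)" using that by simp
    ultimately show ?thesis using that by (simp add: init_state_def Let_def)
  qed
  have "snd (init_state tau) (2 + 4 * v) = coord tau tx1 v \<and> snd (init_state tau) (3 + 4 * v) = coord tau tx2 v \<and>
     snd (init_state tau) (4 + 4 * v) = coord tau ty1 v \<and> snd (init_state tau) (5 + 4 * v) = coord tau ty2 v"
    if v: "v \<in> {0..<int (length tau)}" for v
  proof -
    have lt: "nat v < length tau" and i: "int (nat v) = v" using v by auto
    show ?thesis
      using field[OF lt _ refl, of 0] field[OF lt _ refl, of 1] field[OF lt _ refl, of 2] field[OF lt _ refl, of 3] i
      by (simp add: coord_def numeral_eq_Suc add.commute)
  qed
  moreover have "ar (snd (init_state tau)) a v = 0" if "0 \<le> v" for a v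
    using that by (simp add: ar_def loc_def init_state_def)
  moreover have "snd (init_state tau) 1 = int (length tau)" by (simp add: init_state_def)
  ultimately show ?thesis by (simp add: initial_def)
qed

lemma cwf_prog: "cwf prog"
  by (simp add: prog_def read_input_def read_loop_def read_body_def read_field_def read_post_def arcs_loop_def
      arcs_body_def arcs_pre_def arcs_post_def insert_loop_def insert_body_def add_arc_def sweep_loop_def
      sweep_body_def event_pre_def label_loop_def label_body_def push_loop_def push_body_def push_edge_def
      push_pre_def record_edge_def record_pre_def upd_def upd_pre_def upd_body_def write_output_def out_pre_def
      out_body_def out_post_def)

lemma output_edges_eq:
  fixes es :: "(int \<times> int) list"
  assumes "m (- 1) = 2" "m (- 2) = int (length es)"
    and "\<And>i. i < length es \<Longrightarrow> m (2 + 2 * int i) = fst (es ! i) \<and> m (3 + 2 * int i) = snd (es ! i)"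
  shows "output_edges (pc, m) = (\<lambda>e. {fst e, snd e}) ` set es"
proof -
  have "output_edges (pc, m) = {{m (2 + 2 * j), m (3 + 2 * j)} | j. 0 \<le> j \<and> j < int (length es)}"
    using assms by (simp add: output_edges_def Let_def algebra_simps)
  also have "\<dots> = (\<lambda>i. {m (2 + 2 * int i), m (3 + 2 * int i)}) ` {..<length es}"
  proof (intro equalityI subsetI)
    fix E assume "E \<in> {{m (2 + 2 * j), m (3 + 2 * j)} | j. 0 \<le> j \<and> j < int (length es)}"
    then obtain j where "0 \<le> j" "j < int (length es)" "E = {m (2 + 2 * j), m (3 + 2 * j)}" by blast
    then show "E \<in> (\<lambda>i. {m (2 + 2 * int i), m (3 + 2 * int i)}) ` {..<length es}"
      by (intro image_eqI[of _ _ "nat j"]) auto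
  next
    fix E assume "E \<in> (\<lambda>i. {m (2 + 2 * int i), m (3 + 2 * int i)}) ` {..<length es}"
    then obtain i where "i < length es" "E = {m (2 + 2 * int i), m (3 + 2 * int i)}" by blast
    then show "E \<in> {{m (2 + 2 * j), m (3 + 2 * j)} | j. 0 \<le> j \<and> j < int (length es)}"
      by (intro CollectI exI[of _ "int i"]) simp
  qed
  also have "\<dots> = (\<lambda>i. {fst (es ! i), snd (es ! i)}) ` {..<length es}"
    using assms(3) by (intro image_cong) auto
  also have "\<dots> = (\<lambda>e. {fst e, snd e}) ` ((!) es ` {..<length es})" by (simp add: image_image)
  also have "(!) es ` {..<length es} = set es" by (auto simp: set_conv_nth)
  finally show ?thesis .
qed

theorem theorem3:
  shows "\<exists>(P :: instr list) (c :: nat). \<forall>tau. valid_model tau \<longrightarrow>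
           (\<exists>t. t \<le> c * (card (tg_edges tau) + length tau) + c \<and>
                halted P ((ram_step P ^^ t) (init_state tau)) \<and>
                (\<exists>M. max_induced_matching (tg_edges tau) M \<and>
                     output_edges ((ram_step P ^^ t) (init_state tau)) = (`) int ` M))"
proof (rule exI[of _ "code prog 0"], rule exI[of _ 30000], intro allI impI)
  fix tau assume valid: "valid_model tau"
  let ?P = "code prog 0"
  let ?m = "snd (init_state tau)"
  interpret trapezoids "int (length tau)" "coord tau tx1" "coord tau tx2" "coord tau ty1" "coord tau ty2"
    by (rule valid_model_trapezoids[OF valid])
  have tg: "tg_edges tau = uedge ` edges" by (rule tg_edges_eq[OF valid])
  then have card: "card (tg_edges tau) = card edges" by (simp add: card_image[OF uedge_inj])
  from prog_ok[OF initial_init_state[OF valid]] obtain t m' es where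
    run: "run prog ?m t m'" and t: "t \<le> 30000 * (card edges + length tau) + 1000"
    and opt: "\<And>C. C \<subseteq> edges \<Longrightarrow> (\<forall>e\<in>C. \<forall>f\<in>C. e \<noteq> f \<longrightarrow> eleft e f \<or> eleft f e) \<Longrightarrow> card C \<le> length es"
    and es: "chain es" and out: "m' (- 1) = 2" "m' (- 2) = int (length es)"
      "\<And>i. i < length es \<Longrightarrow> m' (2 + 2 * int i) = fst (es ! i) \<and> m' (3 + 2 * int i) = snd (es ! i)"
    unfolding hr_def by auto
  have sub: "set es \<subseteq> edges" using es by (simp add: chain_def)
  have "code_at ?P 0 ?P" by (auto simp: code_at_def)
  moreover have "agree ?m ?m" by (simp add: agree_def)
  ultimately obtain mm where mm: "steps ?P t (0, ?m) = (csize prog, mm)" "agree m' mm"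
    using code_correct[OF run, of ?P 0 ?m] cwf_prog by auto
  have "init_state tau = (0, ?m)" by (simp add: init_state_def)
  with mm(1) have steps: "steps ?P t (init_state tau) = (csize prog, mm)" by metis
  \<comment> \<open>All temporaries lie at address -64 or below, so the simulation determines every
    cell that the output is read from.\<close>
  have raw: "mm i = m' i" if "- 64 < i" for i
    using mm(2) that by (auto simp: agree_def loc_def)
  have "output_edges (csize prog, mm) = (\<lambda>e. {fst e, snd e}) ` set es"
    using out by (intro output_edges_eq) (simp_all add: raw)
  also have "\<dots> = (`) int ` (uedge ` set es)"
    unfolding image_image using sub edgesD by (intro image_cong) (force simp: uedge_def)+
  finally have "output_edges (steps ?P t (init_state tau)) = (`) int ` (uedge ` set es)"
    by (simp only: steps)
  moreover have "max_induced_matching (tg_edges tau) (uedge ` set es)"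
    unfolding tg by (rule max_induced_matching_chain[OF sub _ opt]) (use es in \<open>simp_all add: chain_def\<close>)
  \<comment> \<open>The compiled code contains no \<open>Halt\<close>; it stops by running past its
    end, where \<open>fetch\<close> returns \<open>Halt\<close>.\<close>
  moreover have "halted ?P (steps ?P t (init_state tau))"
    unfolding steps by (simp add: halted_def fetch_def)
  moreover have "t \<le> 30000 * (card (tg_edges tau) + length tau) + 30000" using t card by simp
  ultimately show "\<exists>t. t \<le> 30000 * (card (tg_edges tau) + length tau) + 30000 \<and>
                halted ?P ((ram_step ?P ^^ t) (init_state tau)) \<and>
                (\<exists>M. max_induced_matching (tg_edges tau) M \<and>
                     output_edges ((ram_step ?P ^^ t) (init_state tau)) = (`) int ` M)"
    by (intro exI[of _ t] exI[of _ "uedge ` set es"] conjI)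
qed

end
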